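(* Let $k$ be a perfect field of characteristic $p>0$, let $R$ be a smooth $k$-algebra, and let $\mathcal{W}\Omega_R^{\ast}$ be the saturated de Rham–Witt complex of $R$, equipped with its canonical ring homomorphism $\rho\colon R\to\mathrm{H}^0(\mathcal{W}\Omega_R^{\ast}/p\mathcal{W}\Omega_R^{\ast})$. If $A^{\ast}$ is any strict Dieudonné algebra, then every ring homomorphism $f\colon R\to \mathrm{H}^0(A^{\ast}/pA^{\ast})$ extends uniquely to a map of strict Dieudonné algebras $\mathcal{W}\Omega_R^{\ast}\to A^{\ast}$; that is, there is a unique morphism of Dieudonné algebras $g\colon\mathcal{W}\Omega_R^{\ast}\to A^{\ast}$ such that the composite of $\rho$ with the map $\mathrm{H}^0(\mathcal{W}\Omega_R^{\ast}/p)\to\mathrm{H}^0(A^{\ast}/p)$ induced by $g$ equals $f$.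
   Context: Fix a prime $p$. A Dieudonné complex is a cochain complex of abelian groups $(M^{\ast},d)$ with a map of graded abelian groups $F\colon M^{\ast}\to M^{\ast}$ satisfying $dF=pFd$. It is saturated if it is $p$-torsion-free and for all $n$, $F$ induces an isomorphism $M^n\to\{x\in M^n:dx\in pM^{n+1}\}$; then the Verschiebung $V$ is the unique map with $F(Vx)=px$. For saturated $M^{\ast}$ put $\mathcal{W}_r(M)^{\ast}=M^{\ast}/(\mathrm{im}(V^r)+\mathrm{im}(dV^r))$ and $\mathcal{W}(M)^{\ast}=\varprojlim_r\mathcal{W}_r(M)^{\ast}$. $M^{\ast}$ is strict if it is saturated and $M^{\ast}\to\mathcal{W}(M)^{\ast}$ is an isomorphism. A Dieudonné algebra is a commutative differential graded algebra $(A^{\ast},d)$ (graded-commutative, with $x^2=0$ for homogeneous $x$ of odd degree, and $d$ satisfying the Leibniz rule) with a graded ring homomorphism $F\colon A^{\ast}\to A^{\ast}$ such that $dF=pFd$, $A^n=0$ for $n<0$, and $Fx\equiv x^p \pmod p$ for $x\in A^0$. Morphisms are graded ring homomorphisms commuting with $d$ and $F$. It is saturated/strict if its underlying Dieudonné complex is. The completed saturation $\mathcal{W}\mathrm{Sat}(A^{\ast})$ of a Dieudonné algebra $A^{\ast}$ is the strict Dieudonné algebra with a morphism $A^{\ast}\to\mathcal{W}\mathrm{Sat}(A^{\ast})$ that is universal among morphisms of Dieudonné algebras from $A^{\ast}$ to strict Dieudonné algebras; it is obtained by first forming the universal saturated Dieudonné complex $\mathrm{Sat}(A^{\ast})$ under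 $A^{\ast}$ and then applying $\mathcal{W}$. Construction of $\mathcal{W}\Omega_R^{\ast}$ for $R$ smooth over $k$: choose a $p$-adically complete, $p$-torsion-free $W(k)$-algebra $\widetilde{R}$ with an isomorphism $\widetilde{R}/p\widetilde{R}\simeq R$, and a ring homomorphism $\varphi\colon\widetilde{R}\to\widetilde{R}$ with $\varphi(x)\equiv x^p\pmod p$ (such choices exist). Let $\widehat{\Omega}^{\ast}_{\widetilde{R}}=\varprojlim_n\Omega^{\ast}_{\widetilde{R}}/p^n\Omega^{\ast}_{\widetilde{R}}$ be the completed de Rham complex; it is a Dieudonné algebra for the unique (continuous) ring homomorphism $F$ with $F(x)=\varphi(x)$ and $F(dx)=x^{p-1}dx+d\left(\frac{\varphi(x)-x^p}{p}\right)$ for $x\in\widetilde{R}$. Then $\mathcal{W}\Omega_R^{\ast}:=\mathcal{W}\mathrm{Sat}(\widehat{\Omega}^{\ast}_{\widetilde{R}})$. The map $\rho$ (induced by the Frobenius of $R$) sends $x\in R$ to the class of the image of $F(\widetilde{x})=\varphi(\widetilde{x})$, where $\widetilde{x}\in\widetilde{R}$ is any lift of $x$. *)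

theory Defs
  imports
    "HOL-Computational_Algebra.Primes"
    "HOL-Algebra.Free_Abelian_Groups"
    "HOL-Algebra.Generated_Groups"
    "HOL-Algebra.Generated_Rings"
    "HOL-Algebra.QuotRing"
begin

text \<open>
  Abelian groups are \<^locale>\<open>comm_group\<close>s.  The group operation of the degree \<open>n\<close> part \<open>Gr M n\<close>
  of a graded object is therefore written \<open>\<otimes>\<close> (with neutral element \<open>\<one>\<close>, and \<open>x [^] q\<close> for the
  \<open>q\<close>-fold multiple of \<open>x\<close>) although it is the addition of the mathematics; the product of a
  graded ring is \<open>GMult\<close>.
\<close>

section \<open>Completions\<close>

definition multiples :: "nat \<Rightarrow> ('a, 'm) monoid_scheme \<Rightarrow> 'a set" where
  "multiples q G = (\<lambda>x. x [^]\<^bsub>G\<^esub> q) ` carrier G"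

text \<open>
  The inverse limit of the quotients \<open>G Mod N r\<close> along a descending sequence \<open>N\<close> of subgroups.
  The transition map \<open>G Mod N (Suc r) \<rightarrow> G Mod N r\<close> sends a coset to the unique coset containing it,
  so compatible families are the families of cosets that decrease with \<open>r\<close>.
\<close>
definition completion :: "('a, 'm) monoid_scheme \<Rightarrow> (nat \<Rightarrow> 'a set) \<Rightarrow> (nat \<Rightarrow> 'a set) monoid" where
  "completion G N =
     \<lparr>carrier = {X. \<forall>r. X r \<in> carrier (G Mod N r) \<and> X (Suc r) \<subseteq> X r},
      mult = (\<lambda>X Y r. X r \<otimes>\<^bsub>G Mod N r\<^esub> Y r),
      one = (\<lambda>r. \<one>\<^bsub>G Mod N r\<^esub>)\<rparr>"

definition to_completion :: "('a, 'm) monoid_scheme \<Rightarrow> (nat \<Rightarrow> 'a set) \<Rightarrow> 'a \<Rightarrow> nat \<Rightarrow> 'a set" where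
  "to_completion G N x = (\<lambda>r. N r #>\<^bsub>G\<^esub> x)"

definition p_torsion_free :: "nat \<Rightarrow> ('a, 'm) monoid_scheme \<Rightarrow> bool" where
  "p_torsion_free p G \<longleftrightarrow> (\<forall>x\<in>carrier G. x [^]\<^bsub>G\<^esub> p = \<one>\<^bsub>G\<^esub> \<longrightarrow> x = \<one>\<^bsub>G\<^esub>)"

definition p_complete :: "nat \<Rightarrow> ('a, 'm) monoid_scheme \<Rightarrow> bool" where
  "p_complete p G \<longleftrightarrow>
     to_completion G (\<lambda>r. multiples (p ^ r) G) \<in> iso G (completion G (\<lambda>r. multiples (p ^ r) G))"

section \<open>Cochain complexes and Dieudonne complexes\<close>

record 'a cochain =
  Gr :: "int \<Rightarrow> 'a monoid"
  Diff :: "int \<Rightarrow> 'a \<Rightarrow> 'a"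

locale cochain_complex =
  fixes M :: "('a, 'm) cochain_scheme"
  assumes comm_group_Gr: "comm_group (Gr M n)"
    and Diff_hom: "Diff M n \<in> hom (Gr M n) (Gr M (n + 1))"
    and Diff_Diff: "x \<in> carrier (Gr M n) \<Longrightarrow> Diff M (n + 1) (Diff M n x) = \<one>\<^bsub>Gr M (n + 2)\<^esub>"

locale dieudonne_complex = cochain_complex M for M :: "('a, 'm) cochain_scheme" +
  fixes p :: nat and F :: "int \<Rightarrow> 'a \<Rightarrow> 'a"
  assumes prime_p: "Factorial_Ring.prime p"
    and F_hom: "F n \<in> hom (Gr M n) (Gr M n)"
    and Diff_F: "x \<in> carrier (Gr M n) \<Longrightarrow>
      Diff M n (F n x) = F (n + 1) (Diff M n x) [^]\<^bsub>Gr M (n + 1)\<^esub> p"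

locale saturated_dieudonne_complex = dieudonne_complex +
  assumes torsion_free: "p_torsion_free p (Gr M n)"
    and F_bij: "bij_betw (F n) (carrier (Gr M n))
      {x \<in> carrier (Gr M n). Diff M n x \<in> multiples p (Gr M (n + 1))}"

definition verschiebung ::
    "('a, 'm) cochain_scheme \<Rightarrow> nat \<Rightarrow> (int \<Rightarrow> 'a \<Rightarrow> 'a) \<Rightarrow> int \<Rightarrow> 'a \<Rightarrow> 'a" where
  "verschiebung M p F n x = (THE y. y \<in> carrier (Gr M n) \<and> F n y = x [^]\<^bsub>Gr M n\<^esub> p)"

text \<open>The degree \<open>n\<close> part of \<open>im (V\<^sup>r) + im (d V\<^sup>r)\<close>.\<close>
definition standard_filtration ::
    "('a, 'm) cochain_scheme \<Rightarrow> nat \<Rightarrow> (int \<Rightarrow> 'a \<Rightarrow> 'a) \<Rightarrow> int \<Rightarrow> nat \<Rightarrow> 'a set" where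
  "standard_filtration M p F n r =
     ((verschiebung M p F n ^^ r) ` carrier (Gr M n))
       <#>\<^bsub>Gr M n\<^esub>
     (Diff M (n - 1) ` (verschiebung M p F (n - 1) ^^ r) ` carrier (Gr M (n - 1)))"

locale strict_dieudonne_complex = saturated_dieudonne_complex +
  assumes strict: "to_completion (Gr M n) (standard_filtration M p F n)
    \<in> iso (Gr M n) (completion (Gr M n) (standard_filtration M p F n))"

section \<open>Differential graded algebras and Dieudonne algebras\<close>

record 'a dga = "'a cochain" +
  GMult :: "int \<Rightarrow> int \<Rightarrow> 'a \<Rightarrow> 'a \<Rightarrow> 'a"
  GOne :: 'a

definition signed :: "('a, 'm) monoid_scheme \<Rightarrow> int \<Rightarrow> 'a \<Rightarrow> 'a" where
  "signed G m x = (if even m then x else inv\<^bsub>G\<^esub> x)"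

locale cdga = cochain_complex A for A :: "('a, 'm) dga_scheme" +
  assumes GMult_closed: "\<lbrakk>x \<in> carrier (Gr A m); y \<in> carrier (Gr A n)\<rbrakk> \<Longrightarrow>
      GMult A m n x y \<in> carrier (Gr A (m + n))"
    and GMult_l_distr: "\<lbrakk>x \<in> carrier (Gr A m); x' \<in> carrier (Gr A m); y \<in> carrier (Gr A n)\<rbrakk> \<Longrightarrow>
      GMult A m n (x \<otimes>\<^bsub>Gr A m\<^esub> x') y = GMult A m n x y \<otimes>\<^bsub>Gr A (m + n)\<^esub> GMult A m n x' y"
    and GMult_r_distr: "\<lbrakk>x \<in> carrier (Gr A m); y \<in> carrier (Gr A n); y' \<in> carrier (Gr A n)\<rbrakk> \<Longrightarrow>
      GMult A m n x (y \<otimes>\<^bsub>Gr A n\<^esub> y') = GMult A m n x y \<otimes>\<^bsub>Gr A (m + n)\<^esub> GMult A m n x y'"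
    and GMult_assoc:
      "\<lbrakk>x \<in> carrier (Gr A l); y \<in> carrier (Gr A m); z \<in> carrier (Gr A n)\<rbrakk> \<Longrightarrow>
      GMult A (l + m) n (GMult A l m x y) z = GMult A l (m + n) x (GMult A m n y z)"
    and GOne_closed: "GOne A \<in> carrier (Gr A 0)"
    and GMult_l_one: "x \<in> carrier (Gr A n) \<Longrightarrow> GMult A 0 n (GOne A) x = x"
    and GMult_r_one: "x \<in> carrier (Gr A n) \<Longrightarrow> GMult A n 0 x (GOne A) = x"
    and GMult_comm: "\<lbrakk>x \<in> carrier (Gr A m); y \<in> carrier (Gr A n)\<rbrakk> \<Longrightarrow>
      GMult A m n x y = signed (Gr A (m + n)) (m * n) (GMult A n m y x)"
    and GMult_odd_square: "\<lbrakk>odd m; x \<in> carrier (Gr A m)\<rbrakk> \<Longrightarrow>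
      GMult A m m x x = \<one>\<^bsub>Gr A (m + m)\<^esub>"
    and Leibniz: "\<lbrakk>x \<in> carrier (Gr A m); y \<in> carrier (Gr A n)\<rbrakk> \<Longrightarrow>
      Diff A (m + n) (GMult A m n x y) =
        GMult A (m + 1) n (Diff A m x) y
          \<otimes>\<^bsub>Gr A (m + n + 1)\<^esub> signed (Gr A (m + n + 1)) m (GMult A m (n + 1) x (Diff A n y))"

definition deg0_ring :: "('a, 'm) dga_scheme \<Rightarrow> 'a ring" where
  "deg0_ring A = \<lparr>carrier = carrier (Gr A 0), mult = GMult A 0 0, one = GOne A,
     zero = \<one>\<^bsub>Gr A 0\<^esub>, add = mult (Gr A 0)\<rparr>"

definition graded_ring_hom ::
    "('a, 'm) dga_scheme \<Rightarrow> ('b, 'n) dga_scheme \<Rightarrow> (int \<Rightarrow> 'a \<Rightarrow> 'b) set" where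
  "graded_ring_hom A B = {g.
     (\<forall>n. g n \<in> hom (Gr A n) (Gr B n)) \<and>
     (\<forall>m n. \<forall>x\<in>carrier (Gr A m). \<forall>y\<in>carrier (Gr A n).
        g (m + n) (GMult A m n x y) = GMult B m n (g m x) (g n y)) \<and>
     g 0 (GOne A) = GOne B}"

locale dieudonne_algebra = cdga A + dieudonne_complex A p F
  for A :: "('a, 'm) dga_scheme" and p :: nat and F :: "int \<Rightarrow> 'a \<Rightarrow> 'a" +
  assumes F_ring_hom: "F \<in> graded_ring_hom A A"
    and nonneg: "n < 0 \<Longrightarrow> carrier (Gr A n) = {\<one>\<^bsub>Gr A n\<^esub>}"
    and F_lifts_power: "x \<in> carrier (Gr A 0) \<Longrightarrow>
      F 0 x \<ominus>\<^bsub>deg0_ring A\<^esub> (x [^]\<^bsub>deg0_ring A\<^esub> p) \<in> multiples p (Gr A 0)"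

locale strict_dieudonne_algebra = dieudonne_algebra A p F + strict_dieudonne_complex A p F
  for A :: "('a, 'm) dga_scheme" and p :: nat and F :: "int \<Rightarrow> 'a \<Rightarrow> 'a"

text \<open>Morphisms are normalised to be \<open>undefined\<close> off the carriers, so that equality of elements of
  this set is equality of morphisms.\<close>
definition dieudonne_hom ::
    "('a, 'm) dga_scheme \<Rightarrow> (int \<Rightarrow> 'a \<Rightarrow> 'a) \<Rightarrow> ('b, 'n) dga_scheme \<Rightarrow> (int \<Rightarrow> 'b \<Rightarrow> 'b)
      \<Rightarrow> (int \<Rightarrow> 'a \<Rightarrow> 'b) set" where
  "dieudonne_hom A F B G = {g \<in> graded_ring_hom A B.
     (\<forall>n. \<forall>x\<in>carrier (Gr A n). g (n + 1) (Diff A n x) = Diff B n (g n x)) \<and>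
     (\<forall>n. \<forall>x\<in>carrier (Gr A n). g n (F n x) = G n (g n x)) \<and>
     (\<forall>n. g n \<in> extensional (carrier (Gr A n)))}"

text \<open>
  \<open>(W, FW)\<close> with \<open>\<iota>\<close> is a completed saturation of \<open>(A, F)\<close>.  The strict Dieudonne algebras \<open>B\<close> of the
  universal property range over those with elements in the type \<open>'b\<close>, which is a parameter since
  types cannot be quantified over inside a formula.  As a hypothesis this is weaker than universality
  among all strict Dieudonne algebras.
\<close>
definition completed_saturation ::
    "'b itself \<Rightarrow> nat \<Rightarrow> ('a, 'm) dga_scheme \<Rightarrow> (int \<Rightarrow> 'a \<Rightarrow> 'a) \<Rightarrow> ('w, 'n) dga_scheme
      \<Rightarrow> (int \<Rightarrow> 'w \<Rightarrow> 'w) \<Rightarrow> (int \<Rightarrow> 'a \<Rightarrow> 'w) \<Rightarrow> bool" where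
  "completed_saturation (T :: 'b itself) p A F W FW \<iota> \<longleftrightarrow>
     strict_dieudonne_algebra W p FW \<and>
     \<iota> \<in> dieudonne_hom A F W FW \<and>
     (\<forall>(B :: 'b dga) FB. strict_dieudonne_algebra B p FB \<longrightarrow>
        (\<forall>h \<in> dieudonne_hom A F B FB.
           \<exists>!g. g \<in> dieudonne_hom W FW B FB \<and>
             (\<forall>n. \<forall>x\<in>carrier (Gr A n). g n (\<iota> n x) = h n x)))"

text \<open>
  The ring \<open>H\<^sup>0(A/pA)\<close> for \<open>A\<close> concentrated in degrees \<open>\<ge> 0\<close>, where there are no coboundaries in
  degree 0.  The differential \<open>A\<^sup>0/p \<rightarrow> A\<^sup>1/p\<close> kills a coset \<open>X\<close> iff \<open>d X \<subseteq> p A\<^sup>1\<close>.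
\<close>
definition H0_mod :: "nat \<Rightarrow> ('a, 'm) dga_scheme \<Rightarrow> 'a set ring" where
  "H0_mod p A = (deg0_ring A Quot multiples p (Gr A 0))
     \<lparr>carrier := {X \<in> carrier (deg0_ring A Quot multiples p (Gr A 0)).
        Diff A 0 ` X \<subseteq> multiples p (Gr A 1)}\<rparr>"

definition H0_mod_map ::
    "nat \<Rightarrow> ('b, 'n) dga_scheme \<Rightarrow> (int \<Rightarrow> 'a \<Rightarrow> 'b) \<Rightarrow> 'a set \<Rightarrow> 'b set" where
  "H0_mod_map p B g X = (\<Union>x\<in>X. multiples p (Gr B 0) +>\<^bsub>deg0_ring B\<^esub> g 0 x)"

section \<open>The completed de Rham complex\<close>

text \<open>
  The de Rham complex of a commutative ring \<open>S\<close> (over the integers), that is, the exterior algebra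
  over \<open>S\<close> of the module of Kaehler differentials, by generators and relations: the pair
  \<open>(a, [b\<^sub>1, \<dots>, b\<^sub>n])\<close> stands for \<open>a db\<^sub>1 \<and> \<dots> \<and> db\<^sub>n\<close>.
\<close>
definition derham_gens :: "('a, 'm) ring_scheme \<Rightarrow> int \<Rightarrow> ('a \<times> 'a list) set" where
  "derham_gens S n = {(a, bs). a \<in> carrier S \<and> set bs \<subseteq> carrier S \<and> int (length bs) = n}"

inductive_set derham_rels :: "('a, 'm) ring_scheme \<Rightarrow> int \<Rightarrow> (('a \<times> 'a list) \<Rightarrow>\<^sub>0 int) set"
  for S (structure) and n where
  coeff_add:
    "\<lbrakk>(a, bs) \<in> derham_gens S n; (a', bs) \<in> derham_gens S n\<rbrakk> \<Longrightarrow>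
     frag_of (a \<oplus> a', bs) - frag_of (a, bs) - frag_of (a', bs) \<in> derham_rels S n"
| d_add:
    "\<lbrakk>(a, us @ [b] @ vs) \<in> derham_gens S n; (a, us @ [b'] @ vs) \<in> derham_gens S n\<rbrakk> \<Longrightarrow>
     frag_of (a, us @ [b \<oplus> b'] @ vs) - frag_of (a, us @ [b] @ vs) - frag_of (a, us @ [b'] @ vs)
       \<in> derham_rels S n"
| d_mult:
    "\<lbrakk>(a, us @ [b] @ vs) \<in> derham_gens S n; (a, us @ [b'] @ vs) \<in> derham_gens S n\<rbrakk> \<Longrightarrow>
     frag_of (a, us @ [b \<otimes> b'] @ vs) - frag_of (a \<otimes> b, us @ [b'] @ vs)
       - frag_of (a \<otimes> b', us @ [b] @ vs) \<in> derham_rels S n"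
| alternating:
    "(a, us @ [b, b] @ vs) \<in> derham_gens S n \<Longrightarrow> frag_of (a, us @ [b, b] @ vs) \<in> derham_rels S n"

definition derham_null :: "('a, 'm) ring_scheme \<Rightarrow> int \<Rightarrow> (('a \<times> 'a list) \<Rightarrow>\<^sub>0 int) set" where
  "derham_null S n = generate (free_Abelian_group (derham_gens S n)) (derham_rels S n)"

definition derham_class ::
    "('a, 'm) ring_scheme \<Rightarrow> int \<Rightarrow> (('a \<times> 'a list) \<Rightarrow>\<^sub>0 int) \<Rightarrow> (('a \<times> 'a list) \<Rightarrow>\<^sub>0 int) set" where
  "derham_class S n w = derham_null S n #>\<^bsub>free_Abelian_group (derham_gens S n)\<^esub> w"

definition derham_diff :: "('a, 'm) ring_scheme \<Rightarrow> (('a \<times> 'a list) \<Rightarrow>\<^sub>0 int) \<Rightarrow> (('a \<times> 'a list) \<Rightarrow>\<^sub>0 int)" where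
  "derham_diff S = frag_extend (\<lambda>(a, bs). frag_of (\<one>\<^bsub>S\<^esub>, a # bs))"

definition derham_mult ::
    "('a, 'm) ring_scheme \<Rightarrow> (('a \<times> 'a list) \<Rightarrow>\<^sub>0 int) \<Rightarrow> (('a \<times> 'a list) \<Rightarrow>\<^sub>0 int)
      \<Rightarrow> (('a \<times> 'a list) \<Rightarrow>\<^sub>0 int)" where
  "derham_mult S v w = frag_extend (\<lambda>(a, bs).
     frag_extend (\<lambda>(c, ds). frag_of (a \<otimes>\<^bsub>S\<^esub> c, bs @ ds)) w) v"

definition derham :: "('a, 'm) ring_scheme \<Rightarrow> (('a \<times> 'a list) \<Rightarrow>\<^sub>0 int) set dga" where
  "derham S =
     \<lparr>Gr = (\<lambda>n. free_Abelian_group (derham_gens S n) Mod derham_null S n),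
      Diff = (\<lambda>n X. \<Union>v\<in>X. derham_class S (n + 1) (derham_diff S v)),
      GMult = (\<lambda>m n X Y. \<Union>v\<in>X. \<Union>w\<in>Y. derham_class S (m + n) (derham_mult S v w)),
      GOne = derham_class S 0 (frag_of (\<one>\<^bsub>S\<^esub>, []))\<rparr>"

definition p_completed :: "nat \<Rightarrow> ('a, 'm) dga_scheme \<Rightarrow> (nat \<Rightarrow> 'a set) dga" where
  "p_completed p A =
     \<lparr>Gr = (\<lambda>n. completion (Gr A n) (\<lambda>r. multiples (p ^ r) (Gr A n))),
      Diff = (\<lambda>n X r. \<Union>x\<in>X r. multiples (p ^ r) (Gr A (n + 1)) #>\<^bsub>Gr A (n + 1)\<^esub> Diff A n x),
      GMult = (\<lambda>m n X Y r. \<Union>x\<in>X r. \<Union>y\<in>Y r.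
        multiples (p ^ r) (Gr A (m + n)) #>\<^bsub>Gr A (m + n)\<^esub> GMult A m n x y),
      GOne = (\<lambda>r. multiples (p ^ r) (Gr A 0) #>\<^bsub>Gr A 0\<^esub> GOne A)\<rparr>"

abbreviation completed_derham ::
    "nat \<Rightarrow> ('a, 'm) ring_scheme \<Rightarrow> (nat \<Rightarrow> (('a \<times> 'a list) \<Rightarrow>\<^sub>0 int) set set) dga" where
  "completed_derham p S \<equiv> p_completed p (derham S)"

definition derham_of_ring ::
    "nat \<Rightarrow> ('a, 'm) ring_scheme \<Rightarrow> 'a \<Rightarrow> nat \<Rightarrow> (('a \<times> 'a list) \<Rightarrow>\<^sub>0 int) set set" where
  "derham_of_ring p S x =
     to_completion (Gr (derham S) 0) (\<lambda>r. multiples (p ^ r) (Gr (derham S) 0))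
       (derham_class S 0 (frag_of (x, [])))"

section \<open>Perfect fields, Witt vectors and smooth algebras\<close>

definition perfect_field :: "nat \<Rightarrow> ('k, 'm) ring_scheme \<Rightarrow> bool" where
  "perfect_field p k \<longleftrightarrow> field k \<and> Factorial_Ring.prime p \<and> [p] \<cdot>\<^bsub>k\<^esub> \<one>\<^bsub>k\<^esub> = \<zero>\<^bsub>k\<^esub> \<and>
     (\<lambda>x. x [^]\<^bsub>k\<^esub> p) ` carrier k = carrier k"

text \<open>Integer polynomials in the indeterminates \<open>X\<^sub>0, Y\<^sub>0, X\<^sub>1, Y\<^sub>1, \<dots>\<close>; \<open>X\<^sub>i\<close> and \<open>Y\<^sub>i\<close> have the
  numbers \<open>2 i\<close> and \<open>2 i + 1\<close>.\<close>
type_synonym zpoly = "(nat \<Rightarrow>\<^sub>0 nat) \<Rightarrow>\<^sub>0 int"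

definition zvar :: "nat \<Rightarrow> zpoly" where
  "zvar i = Poly_Mapping.single (Poly_Mapping.single i 1) 1"

definition zeval :: "('k, 'm) ring_scheme \<Rightarrow> (nat \<Rightarrow> 'k) \<Rightarrow> zpoly \<Rightarrow> 'k" where
  "zeval k v P = (\<Oplus>\<^bsub>k\<^esub>e\<in>Poly_Mapping.keys P. [Poly_Mapping.lookup P e] \<cdot>\<^bsub>k\<^esub>
     (\<Otimes>\<^bsub>k\<^esub>i\<in>Poly_Mapping.keys e. v i [^]\<^bsub>k\<^esub> Poly_Mapping.lookup e i))"

definition witt_poly :: "nat \<Rightarrow> nat \<Rightarrow> (nat \<Rightarrow> zpoly) \<Rightarrow> zpoly" where
  "witt_poly p n Z = (\<Sum>i\<le>n. of_nat (p ^ i) * Z i ^ (p ^ (n - i)))"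

text \<open>Existence and uniqueness of these polynomials is Witt's theorem.\<close>
definition witt_add_poly :: "nat \<Rightarrow> nat \<Rightarrow> zpoly" where
  "witt_add_poly p = (THE S. \<forall>n. witt_poly p n S =
     witt_poly p n (\<lambda>i. zvar (2 * i)) + witt_poly p n (\<lambda>i. zvar (2 * i + 1)))"

definition witt_mult_poly :: "nat \<Rightarrow> nat \<Rightarrow> zpoly" where
  "witt_mult_poly p = (THE S. \<forall>n. witt_poly p n S =
     witt_poly p n (\<lambda>i. zvar (2 * i)) * witt_poly p n (\<lambda>i. zvar (2 * i + 1)))"

definition witt_vectors :: "nat \<Rightarrow> ('k, 'm) ring_scheme \<Rightarrow> (nat \<Rightarrow> 'k) ring" where
  "witt_vectors p k =
     (let ev = \<lambda>a b. zeval k (\<lambda>j. if even j then a (j div 2) else b (j div 2)) in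
     \<lparr>carrier = {a. \<forall>n. a n \<in> carrier k},
      mult = (\<lambda>a b n. ev a b (witt_mult_poly p n)),
      one = (\<lambda>n. if n = 0 then \<one>\<^bsub>k\<^esub> else \<zero>\<^bsub>k\<^esub>),
      zero = (\<lambda>n. \<zero>\<^bsub>k\<^esub>),
      add = (\<lambda>a b n. ev a b (witt_add_poly p n))\<rparr>)"

text \<open>
  Smooth algebras over a field \<open>k\<close>: finitely presented (equivalently, finitely generated, as \<open>k\<close> is
  Noetherian) and formally smooth, i.e. homomorphisms to \<open>B/J\<close> with \<open>J\<^sup>2 = 0\<close> lift to \<open>B\<close>.  It is no
  restriction that the test algebras \<open>B\<close> have their elements in \<open>'k list\<close>: if \<open>R = P/I\<close> with
  \<open>P = k[x\<^sub>1, \<dots>, x\<^sub>n]\<close>, then \<open>P\<close> and hence \<open>P/I\<^sup>2\<close> have at most as many elements as \<open>'k list\<close>, and a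
  section of \<open>P/I\<^sup>2 \<rightarrow> R\<close> yields all other liftings.
\<close>
definition smooth_algebra ::
    "('k, 'm) ring_scheme \<Rightarrow> ('r, 'n) ring_scheme \<Rightarrow> ('k \<Rightarrow> 'r) \<Rightarrow> bool" where
  "smooth_algebra k R \<alpha> \<longleftrightarrow> cring R \<and> \<alpha> \<in> ring_hom k R \<and>
     (\<exists>S. finite S \<and> S \<subseteq> carrier R \<and> generate_ring R (\<alpha> ` carrier k \<union> S) = carrier R) \<and>
     (\<forall>(B :: 'k list ring) \<beta> J u.
        cring B \<and> \<beta> \<in> ring_hom k B \<and> ideal J B \<and>
        (\<forall>x\<in>J. \<forall>y\<in>J. x \<otimes>\<^bsub>B\<^esub> y = \<zero>\<^bsub>B\<^esub>) \<and>
        u \<in> ring_hom R (B Quot J) \<and> (\<forall>c\<in>carrier k. u (\<alpha> c) = J +>\<^bsub>B\<^esub> \<beta> c) \<longrightarrow>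
        (\<exists>v \<in> ring_hom R B. (\<forall>c\<in>carrier k. v (\<alpha> c) = \<beta> c) \<and>
           (\<forall>x\<in>carrier R. J +>\<^bsub>B\<^esub> v x = u x)))"

section \<open>The saturated de Rham--Witt complex\<close>

text \<open>
  \<open>S\<close>, a \<open>W(k)\<close>-algebra via \<open>\<beta>\<close>, is a \<open>p\<close>-complete \<open>p\<close>-torsion-free lift of the \<open>k\<close>-algebra \<open>R\<close>
  via \<open>\<theta> : S/pS \<simeq> R\<close>, and \<open>\<phi>\<close> is a lift of Frobenius.  The condition that mentions \<open>c 0\<close> says
  that \<open>\<theta>\<close> is an isomorphism of algebras over \<open>W(k)/p = k\<close>.
\<close>
definition frobenius_lift ::
    "nat \<Rightarrow> ('k, 'm) ring_scheme \<Rightarrow> ('r, 'n) ring_scheme \<Rightarrow> ('k \<Rightarrow> 'r) \<Rightarrow> ('s, 'l) ring_scheme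
      \<Rightarrow> ((nat \<Rightarrow> 'k) \<Rightarrow> 's) \<Rightarrow> ('s set \<Rightarrow> 'r) \<Rightarrow> ('s \<Rightarrow> 's) \<Rightarrow> bool" where
  "frobenius_lift p k R \<alpha> S \<beta> \<theta> \<phi> \<longleftrightarrow>
     cring S \<and> p_torsion_free p (add_monoid S) \<and> p_complete p (add_monoid S) \<and>
     \<beta> \<in> ring_hom (witt_vectors p k) S \<and>
     \<theta> \<in> ring_iso (S Quot multiples p (add_monoid S)) R \<and>
     (\<forall>c\<in>carrier (witt_vectors p k).
        \<theta> (multiples p (add_monoid S) +>\<^bsub>S\<^esub> \<beta> c) = \<alpha> (c 0)) \<and>
     \<phi> \<in> ring_hom S S \<and>
     (\<forall>x\<in>carrier S. \<phi> x \<ominus>\<^bsub>S\<^esub> (x [^]\<^bsub>S\<^esub> p) \<in> multiples p (add_monoid S))"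

definition frobenius_delta :: "nat \<Rightarrow> ('s, 'l) ring_scheme \<Rightarrow> ('s \<Rightarrow> 's) \<Rightarrow> 's \<Rightarrow> 's" where
  "frobenius_delta p S \<phi> x = (THE y. y \<in> carrier S \<and> [p] \<cdot>\<^bsub>S\<^esub> y = \<phi> x \<ominus>\<^bsub>S\<^esub> (x [^]\<^bsub>S\<^esub> p))"

text \<open>
  Continuity of \<open>F\<close> for the topologies of the inverse limits is automatic: \<open>F\<close> is additive, and the
  kernel of the projection of the completion to \<open>\<Omega>/p\<^sup>r\<close> consists of the multiples of \<open>p\<^sup>r\<close>.
\<close>
definition derham_frobenius ::
    "nat \<Rightarrow> ('s, 'l) ring_scheme \<Rightarrow> ('s \<Rightarrow> 's)
      \<Rightarrow> (int \<Rightarrow> (nat \<Rightarrow> (('s \<times> 's list) \<Rightarrow>\<^sub>0 int) set set) \<Rightarrow> (nat \<Rightarrow> (('s \<times> 's list) \<Rightarrow>\<^sub>0 int) set set))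
      \<Rightarrow> bool" where
  "derham_frobenius p S \<phi> F \<longleftrightarrow>
     F \<in> graded_ring_hom (completed_derham p S) (completed_derham p S) \<and>
     (\<forall>x\<in>carrier S. F 0 (derham_of_ring p S x) = derham_of_ring p S (\<phi> x)) \<and>
     (\<forall>x\<in>carrier S. F 1 (Diff (completed_derham p S) 0 (derham_of_ring p S x)) =
        GMult (completed_derham p S) 0 1 (derham_of_ring p S (x [^]\<^bsub>S\<^esub> (p - 1)))
          (Diff (completed_derham p S) 0 (derham_of_ring p S x))
        \<otimes>\<^bsub>Gr (completed_derham p S) 1\<^esub>
        Diff (completed_derham p S) 0 (derham_of_ring p S (frobenius_delta p S \<phi> x)))"

text \<open>\<open>(W, FW)\<close> with \<open>\<iota>\<close> is the saturated de Rham--Witt complex of \<open>R\<close>, formed from the lift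
  \<open>(S, \<beta>, \<theta>, \<phi>)\<close>.  The type \<open>'b\<close> is that of \<^const>\<open>completed_saturation\<close>.\<close>
definition saturated_derham_witt ::
    "'b itself \<Rightarrow> nat \<Rightarrow> ('k, 'm) ring_scheme \<Rightarrow> ('r, 'n) ring_scheme \<Rightarrow> ('k \<Rightarrow> 'r)
      \<Rightarrow> ('s, 'l) ring_scheme \<Rightarrow> ((nat \<Rightarrow> 'k) \<Rightarrow> 's) \<Rightarrow> ('s set \<Rightarrow> 'r) \<Rightarrow> ('s \<Rightarrow> 's)
      \<Rightarrow> (int \<Rightarrow> (nat \<Rightarrow> (('s \<times> 's list) \<Rightarrow>\<^sub>0 int) set set) \<Rightarrow> (nat \<Rightarrow> (('s \<times> 's list) \<Rightarrow>\<^sub>0 int) set set))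
      \<Rightarrow> ('w, 'h) dga_scheme \<Rightarrow> (int \<Rightarrow> 'w \<Rightarrow> 'w)
      \<Rightarrow> (int \<Rightarrow> (nat \<Rightarrow> (('s \<times> 's list) \<Rightarrow>\<^sub>0 int) set set) \<Rightarrow> 'w) \<Rightarrow> bool" where
  "saturated_derham_witt T p k R \<alpha> S \<beta> \<theta> \<phi> F W FW \<iota> \<longleftrightarrow>
     frobenius_lift p k R \<alpha> S \<beta> \<theta> \<phi> \<and>
     derham_frobenius p S \<phi> F \<and>
     completed_saturation T p (completed_derham p S) F W FW \<iota>"

text \<open>The canonical map \<open>\<rho>\<close>; the class does not depend on the lift of \<open>x\<close> that is used.\<close>
definition canonical_rho ::
    "nat \<Rightarrow> ('r, 'n) ring_scheme \<Rightarrow> ('s, 'l) ring_scheme \<Rightarrow> ('s set \<Rightarrow> 'r) \<Rightarrow> ('s \<Rightarrow> 's)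
      \<Rightarrow> ('w, 'h) dga_scheme \<Rightarrow> (int \<Rightarrow> (nat \<Rightarrow> (('s \<times> 's list) \<Rightarrow>\<^sub>0 int) set set) \<Rightarrow> 'w)
      \<Rightarrow> 'r \<Rightarrow> 'w set" where
  "canonical_rho p R S \<theta> \<phi> W \<iota> x =
     (let y = (SOME y. y \<in> carrier S \<and> \<theta> (multiples p (add_monoid S) +>\<^bsub>S\<^esub> y) = x)
      in multiples p (Gr W 0) +>\<^bsub>deg0_ring W\<^esub> \<iota> 0 (derham_of_ring p S (\<phi> y)))"

end

theory Submission
  imports Defs
begin

text \<open>
  For a strict Dieudonne algebra \<open>A\<close> the Frobenius identifies \<open>A\<^sup>0 / V A\<^sup>0\<close> with \<open>H\<^sup>0(A/pA)\<close>, so \<open>f\<close> is a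
  ring homomorphism \<open>S \<rightarrow> R \<rightarrow> A\<^sup>0 / V A\<^sup>0\<close>.  It lifts uniquely to a ring homomorphism \<open>h : S \<rightarrow> A\<^sup>0\<close> with
  \<open>F h = h \<phi>\<close>: writing \<open>\<phi> x = x\<^sup>p + p \<delta> x\<close>, such an \<open>h\<close> is a fixed point of
  \<open>h \<mapsto> (x \<mapsto> F\<^sup>-\<^sup>1 (h(x)\<^sup>p) + V (h(\<delta> x)))\<close>, which contracts the \<open>V\<close>-adic topology because \<open>a \<equiv> b\<close> modulo \<open>V\<^sup>r\<close>
  implies \<open>a\<^sup>p \<equiv> b\<^sup>p\<close> modulo \<open>p V\<^sup>r = F V\<^sup>r\<^sup>+\<^sup>1\<close>; the same estimate shows inductively that the fixed point is
  additive and multiplicative modulo each \<open>V\<^sup>r\<close>.  By the universal property of the de Rham complex and completeness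
  of \<open>A\<close>, \<open>h\<close> extends uniquely to the completed de Rham complex of \<open>S\<close>, compatibly with \<open>F\<close> since
  \<open>p F d = d F\<close> and \<open>A\<close> is torsion-free.
\<close>

section \<open>Lifting along Frobenius lifts\<close>

text \<open>The identification with H^0(A/pA) is where saturation enters: an element of degree 0 is
  a cocycle modulo p exactly when it lies in the image of F, and F a lies in pA exactly when a lies
  in VA, because p z = F (V z) and F is injective. As \<rho> sends x to the class of F applied to a
  lift, the condition on g becomes a congruence modulo V between its restriction to S and chosen
  F-preimages of representatives of f.

  The obstacle is that a lift of f to A^0 is at first only a map of sets. The contraction therefore
  acts on all maps of sets, and being a homomorphism is measured afterwards, one ideal V^r at a
  time. The estimate for p-th powers requires r to be at least 1, since it rests on c^2 being p
  times an element of V^r for c in V^r; the level r = 1 has to be supplied by f.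

  In higher degrees the target is complete for the filtration by V^r and dV^r, while the source is
  completed p-adically. The identity p^r = V^r F^r compares the two and lets p-adic limits be formed
  in A.\<close>

lemma (in cring) binomial:
  assumes x: "x \<in> carrier R" and y: "y \<in> carrier R"
  shows "(x \<oplus> y) [^] (n::nat) = (\<Oplus>i\<in>{..n}. [(n choose i)] \<cdot> (x [^] i \<otimes> y [^] (n - i)))"
proof (induction n)
  case 0
  show ?case using x y by simp
next
  case (Suc n)
  have c: "[k] \<cdot> (x [^] (i::nat) \<otimes> y [^] (j::nat)) \<in> carrier R" for k :: nat and i j
    using x y by simp
  let ?t = "\<lambda>k i j. [(k::nat)] \<cdot> (x [^] (i::nat) \<otimes> y [^] (j::nat))"
  have X: "?t k i j \<otimes> x = ?t k (Suc i) j" for k i j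
    using x y by (subst add_pow_ldistr) (simp_all add: m_ac)
  have Y: "?t k i j \<otimes> y = ?t k i (Suc j)" for k i j
    using x y by (subst add_pow_ldistr) (simp_all add: m_assoc)
  \<comment> \<open>The term for i = \<open>Suc n\<close> has coefficient 0 and may be added;
    splitting off i = 0 then shifts the index so that Pascal's rule applies to the two sums.\<close>
  have 1: "(\<Oplus>i\<in>{..n}. ?t (n choose i) i (Suc n - i))
      = y [^] Suc n \<oplus> (\<Oplus>i\<in>{..n}. ?t (n choose Suc i) (Suc i) (n - i))"
  proof -
    have "(\<Oplus>i\<in>{..n}. ?t (n choose i) i (Suc n - i)) = (\<Oplus>i\<in>{..Suc n}. ?t (n choose i) i (Suc n - i))"
      using c by (subst finsum_Suc) (auto simp: x y binomial_eq_0)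
    also have "\<dots> = (\<Oplus>i\<in>{..n}. ?t (n choose Suc i) (Suc i) (n - i)) \<oplus> y [^] Suc n"
      using x y by (subst finsum_Suc2) (auto simp del: nat_pow_Suc)
    finally show ?thesis using x y by (simp add: a_comm del: nat_pow_Suc)
  qed
  have "(x \<oplus> y) [^] Suc n = (\<Oplus>i\<in>{..n}. ?t (n choose i) i (n - i)) \<otimes> x
      \<oplus> (\<Oplus>i\<in>{..n}. ?t (n choose i) i (n - i)) \<otimes> y"
    using Suc x y by (simp add: r_distr)
  also have "\<dots> = (\<Oplus>i\<in>{..n}. ?t (n choose i) (Suc i) (n - i))
      \<oplus> (\<Oplus>i\<in>{..n}. ?t (n choose i) i (Suc n - i))"
    using x y c by (simp add: finsum_ldistr X Y Suc_diff_le Pi_def cong: finsum_cong)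
  also have "\<dots> = (\<Oplus>i\<in>{..n}. ?t (n choose i) (Suc i) (n - i))
      \<oplus> (\<Oplus>i\<in>{..n}. ?t (n choose Suc i) (Suc i) (n - i)) \<oplus> y [^] Suc n"
    unfolding 1 using x y c by (simp add: a_ac Pi_def del: nat_pow_Suc)
  also have "\<dots> = (\<Oplus>i\<in>{..n}. ?t (Suc n choose Suc i) (Suc i) (n - i)) \<oplus> y [^] Suc n"
    using x y c by (simp add: finsum_addf[symmetric] Pi_def add.nat_pow_mult del: nat_pow_Suc)
  also have "\<dots> = (\<Oplus>i\<in>{..Suc n}. ?t (Suc n choose i) i (Suc n - i))"
    using x y by (subst finsum_Suc2) (auto simp del: nat_pow_Suc)
  finally show ?case .
qed

text \<open>\<open>((x + y) ^ p - x ^ p - y ^ p) / p\<close>, evaluated as an integer polynomial.\<close>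
definition frob_cross :: "('a, 'm) ring_scheme \<Rightarrow> nat \<Rightarrow> 'a \<Rightarrow> 'a \<Rightarrow> 'a" where
  "frob_cross R p x y = (\<Oplus>\<^bsub>R\<^esub>i\<in>{1..<p}. [((p choose i) div p)] \<cdot>\<^bsub>R\<^esub> (x [^]\<^bsub>R\<^esub> i \<otimes>\<^bsub>R\<^esub> y [^]\<^bsub>R\<^esub> (p - i)))"

context cring
begin

lemma frob_cross_closed [simp]:
  "\<lbrakk>x \<in> carrier R; y \<in> carrier R\<rbrakk> \<Longrightarrow> frob_cross R p x y \<in> carrier R"
  by (simp add: frob_cross_def Pi_def)

lemma finsum_add_pow:
  assumes "finite I" "\<And>i. i \<in> I \<Longrightarrow> u i \<in> carrier R"
  shows "(\<Oplus>i\<in>I. [(q::nat)] \<cdot> u i) = [q] \<cdot> (\<Oplus>i\<in>I. u i)"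
  using assms
proof (induction I rule: finite_induct)
  case (insert i I)
  then show ?case by (simp add: Pi_def add.nat_pow_distrib)
qed simp

text \<open>All inner binomial coefficients are divisible by p. The division is carried out on the
  integer coefficients, so the quotient makes sense in a ring with p-torsion.\<close>

lemma freshman_pow:
  assumes p: "Factorial_Ring.prime p" and x: "x \<in> carrier R" and y: "y \<in> carrier R"
  shows "(x \<oplus> y) [^] p = x [^] p \<oplus> y [^] p \<oplus> [p] \<cdot> frob_cross R p x y"
proof -
  let ?t = "\<lambda>i. [(p choose i)] \<cdot> (x [^] i \<otimes> y [^] (p - i))"
  have p1: "0 < p" using p prime_gt_0_nat by blast
  have "{..p} = insert 0 (insert p {1..<p})" using p1 by auto
  then have "(x \<oplus> y) [^] p = ?t 0 \<oplus> (?t p \<oplus> (\<Oplus>i\<in>{1..<p}. ?t i))"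
    unfolding binomial[OF x y] using p1 x y by (simp add: Pi_def)
  also have "(\<Oplus>i\<in>{1..<p}. ?t i) = (\<Oplus>i\<in>{1..<p}. [p] \<cdot> ([((p choose i) div p)] \<cdot> (x [^] i \<otimes> y [^] (p - i))))"
  proof (rule finsum_cong')
    fix i assume i: "i \<in> {1..<p}"
    then have "p dvd (p choose i)" using p by (intro dvd_choose_prime) auto
    then show "?t i = [p] \<cdot> ([((p choose i) div p)] \<cdot> (x [^] i \<otimes> y [^] (p - i)))"
      using x y by (simp add: add.nat_pow_pow mult.commute)
  qed (auto simp: x y)
  also have "\<dots> = [p] \<cdot> frob_cross R p x y"
    unfolding frob_cross_def using x y by (intro finsum_add_pow) auto
  finally show ?thesis using x y by (simp add: a_ac)
qed

lemma frob_cross_zero: "x \<in> carrier R \<Longrightarrow> frob_cross R p x \<zero> = \<zero>"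
proof -
  assume x: "x \<in> carrier R"
  have "frob_cross R p x \<zero> = (\<Oplus>i\<in>{1..<p}. \<zero>)"
    unfolding frob_cross_def using x by (intro finsum_cong') (auto simp: nat_pow_zero)
  then show ?thesis by simp
qed

end

lemma (in ring_hom_cring) hom_add_pow: "x \<in> carrier R \<Longrightarrow> h ([(n::nat)] \<cdot> x) = [n] \<cdot>\<^bsub>S\<^esub> h x"
  by (induction n) auto

lemma (in ring_hom_cring) hom_frob_cross:
  "\<lbrakk>x \<in> carrier R; y \<in> carrier R\<rbrakk> \<Longrightarrow> h (frob_cross R p x y) = frob_cross S p (h x) (h y)"
  by (simp add: frob_cross_def hom_finsum Pi_def hom_add_pow o_def cong: S.finsum_cong)

lemma zero_FactRing: "\<zero>\<^bsub>R Quot I\<^esub> = I"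
  by (simp add: FactRing_def)

text \<open>Each monomial of the cross term contains a positive power of its second argument. In R/I
  that argument becomes 0, and the cross term with it.\<close>

lemma ideal_frob_cross:
  assumes R: "cring R" and I: "ideal I R" and b: "b \<in> carrier R" and c: "c \<in> I"
  shows "frob_cross R p b c \<in> I"
proof -
  interpret I: ideal I R by (rule I)
  interpret q: ring_hom_cring R "R Quot I" "(+>\<^bsub>R\<^esub>) I"
    by (rule I.rcos_ring_hom_cring) (rule R)
  have cR: "c \<in> carrier R" using c by simp
  have "I +>\<^bsub>R\<^esub> c = I +>\<^bsub>R\<^esub> \<zero>\<^bsub>R\<^esub>" using I.a_rcos_const[OF c] I.a_rcos_const[OF additive_subgroup.zero_closed[OF ideal.axioms(1)[OF I]]] by (rule trans[OF _ sym])
  also have "\<dots> = \<zero>\<^bsub>R Quot I\<^esub>" by (rule q.hom_zero)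
  finally have c0: "I +>\<^bsub>R\<^esub> c = \<zero>\<^bsub>R Quot I\<^esub>" .
  have "I +>\<^bsub>R\<^esub> frob_cross R p b c = frob_cross (R Quot I) p (I +>\<^bsub>R\<^esub> b) (I +>\<^bsub>R\<^esub> c)"
    by (rule q.hom_frob_cross[OF b cR])
  also have "\<dots> = \<zero>\<^bsub>R Quot I\<^esub>"
    unfolding c0 by (rule q.S.frob_cross_zero[OF q.hom_closed[OF b]])
  also have "\<dots> = I" by (rule zero_FactRing)
  finally show ?thesis by (rule I.rcos_const_imp_mem[OF cring.frob_cross_closed[OF R b cR]])
qed

text \<open>The map keeps its values in R instead of R/I, so that one and the same map can be tested
  modulo every ideal of a filtration.\<close>

definition hom_mod :: "('a, 'm) ring_scheme \<Rightarrow> ('b, 'n) ring_scheme \<Rightarrow> 'b set \<Rightarrow> ('a \<Rightarrow> 'b) set" where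
  "hom_mod S R I = {h \<in> carrier S \<rightarrow> carrier R. (\<lambda>x. I +>\<^bsub>R\<^esub> h x) \<in> ring_hom S (R Quot I)}"

text \<open>The expressions are the polynomials that give \<delta> of a sum and of a product, with u
  and v in the place of \<delta> x and \<delta> y; the third claim serves \<delta> 1 = 0. Being
  polynomials, they are respected by any map that is a homomorphism modulo I.\<close>

lemma hom_mod_cong:
  assumes S: "cring S" and R: "cring R" and I: "ideal I R" and h: "h \<in> hom_mod S R I"
    and el: "x \<in> carrier S" "y \<in> carrier S" "u \<in> carrier S" "v \<in> carrier S"
  shows "h (u \<oplus>\<^bsub>S\<^esub> v \<ominus>\<^bsub>S\<^esub> frob_cross S p x y) \<ominus>\<^bsub>R\<^esub> (h u \<oplus>\<^bsub>R\<^esub> h v \<ominus>\<^bsub>R\<^esub> frob_cross R p (h x) (h y)) \<in> I"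
    and "h (x [^]\<^bsub>S\<^esub> p \<otimes>\<^bsub>S\<^esub> v \<oplus>\<^bsub>S\<^esub> u \<otimes>\<^bsub>S\<^esub> (y [^]\<^bsub>S\<^esub> p \<oplus>\<^bsub>S\<^esub> [p] \<cdot>\<^bsub>S\<^esub> v)) \<ominus>\<^bsub>R\<^esub>
      (h x [^]\<^bsub>R\<^esub> p \<otimes>\<^bsub>R\<^esub> h v \<oplus>\<^bsub>R\<^esub> h u \<otimes>\<^bsub>R\<^esub> (h y [^]\<^bsub>R\<^esub> p \<oplus>\<^bsub>R\<^esub> [p] \<cdot>\<^bsub>R\<^esub> h v)) \<in> I"
    and "h \<zero>\<^bsub>S\<^esub> \<in> I"
proof -
  interpret R: cring R by (rule R)
  interpret S: cring S by (rule S)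
  interpret I: ideal I R by (rule I)
  interpret q: ring_hom_cring R "R Quot I" "(+>\<^bsub>R\<^esub>) I"
    by (rule I.rcos_ring_hom_cring) (rule R)
  interpret k: ring_hom_cring S "R Quot I" "\<lambda>x. I +>\<^bsub>R\<^esub> h x"
    by (unfold_locales) (use h in \<open>simp add: hom_mod_def\<close>)
  have hc: "h z \<in> carrier R" if "z \<in> carrier S" for z using h that by (auto simp: hom_mod_def)
  show "h (u \<oplus>\<^bsub>S\<^esub> v \<ominus>\<^bsub>S\<^esub> frob_cross S p x y) \<ominus>\<^bsub>R\<^esub> (h u \<oplus>\<^bsub>R\<^esub> h v \<ominus>\<^bsub>R\<^esub> frob_cross R p (h x) (h y)) \<in> I"
    using el by (intro R.quotient_eq_iff_same_a_r_cos[OF I, THEN iffD2])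
      (simp_all add: hc S.minus_eq R.minus_eq k.hom_frob_cross q.hom_frob_cross)
  show "h (x [^]\<^bsub>S\<^esub> p \<otimes>\<^bsub>S\<^esub> v \<oplus>\<^bsub>S\<^esub> u \<otimes>\<^bsub>S\<^esub> (y [^]\<^bsub>S\<^esub> p \<oplus>\<^bsub>S\<^esub> [p] \<cdot>\<^bsub>S\<^esub> v)) \<ominus>\<^bsub>R\<^esub>
      (h x [^]\<^bsub>R\<^esub> p \<otimes>\<^bsub>R\<^esub> h v \<oplus>\<^bsub>R\<^esub> h u \<otimes>\<^bsub>R\<^esub> (h y [^]\<^bsub>R\<^esub> p \<oplus>\<^bsub>R\<^esub> [p] \<cdot>\<^bsub>R\<^esub> h v)) \<in> I"
    using el by (intro R.quotient_eq_iff_same_a_r_cos[OF I, THEN iffD2])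
      (simp_all add: hc S.minus_eq R.minus_eq k.hom_add_pow q.hom_add_pow k.ring.hom_nat_pow q.ring.hom_nat_pow)
  have "I +>\<^bsub>R\<^esub> h \<zero>\<^bsub>S\<^esub> = I +>\<^bsub>R\<^esub> \<zero>\<^bsub>R\<^esub>" by simp
  then show "h \<zero>\<^bsub>S\<^esub> \<in> I" using hc[of "\<zero>\<^bsub>S\<^esub>"]
    by (metis I.rcos_const_imp_mem I.a_rcos_const I.zero_closed S.zero_closed)
qed

lemma (in cring) hom_modI:
  assumes I: "ideal I R" and h: "\<And>x. x \<in> carrier S \<Longrightarrow> h x \<in> carrier R"
    and S: "cring S"
    and add: "\<And>x y. \<lbrakk>x \<in> carrier S; y \<in> carrier S\<rbrakk> \<Longrightarrow> h (x \<oplus>\<^bsub>S\<^esub> y) \<ominus> (h x \<oplus> h y) \<in> I"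
    and mult: "\<And>x y. \<lbrakk>x \<in> carrier S; y \<in> carrier S\<rbrakk> \<Longrightarrow> h (x \<otimes>\<^bsub>S\<^esub> y) \<ominus> (h x \<otimes> h y) \<in> I"
    and one: "h \<one>\<^bsub>S\<^esub> \<ominus> \<one> \<in> I"
  shows "h \<in> hom_mod S R I"
proof -
  interpret S: cring S by (rule S)
  interpret I: ideal I R by (rule I)
  note q = ring_hom_add[OF I.rcos_ring_hom, symmetric] ring_hom_mult[OF I.rcos_ring_hom, symmetric]
    ring_hom_one[OF I.rcos_ring_hom, symmetric] 
  have cl: "I +> x \<in> carrier (R Quot I)" if "x \<in> carrier R" for x
    using ring_hom_closed[OF I.rcos_ring_hom that] .
  show ?thesis unfolding hom_mod_def
    using assms by (auto intro!: ring_hom_memI cl simp: q quotient_eq_iff_same_a_r_cos[OF I])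
qed

lemma (in cring) hom_modD:
  assumes I: "ideal I R" and S: "cring S" and h: "h \<in> hom_mod S R I"
  shows "\<And>x. x \<in> carrier S \<Longrightarrow> h x \<in> carrier R"
    and "\<And>x y. \<lbrakk>x \<in> carrier S; y \<in> carrier S\<rbrakk> \<Longrightarrow> h (x \<oplus>\<^bsub>S\<^esub> y) \<ominus> (h x \<oplus> h y) \<in> I"
    and "\<And>x y. \<lbrakk>x \<in> carrier S; y \<in> carrier S\<rbrakk> \<Longrightarrow> h (x \<otimes>\<^bsub>S\<^esub> y) \<ominus> (h x \<otimes> h y) \<in> I"
    and "h \<one>\<^bsub>S\<^esub> \<ominus> \<one> \<in> I"
proof -
  interpret S: cring S by (rule S)
  interpret I: ideal I R by (rule I)
  have hc: "h x \<in> carrier R" if "x \<in> carrier S" for x using h that by (auto simp: hom_mod_def)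
  note q = ring_hom_add[OF I.rcos_ring_hom] ring_hom_mult[OF I.rcos_ring_hom]
    ring_hom_one[OF I.rcos_ring_hom] 
  have k: "(\<lambda>x. I +> h x) \<in> ring_hom S (R Quot I)" using h by (simp add: hom_mod_def)
  note k = ring_hom_add[OF k] ring_hom_mult[OF k] ring_hom_one[OF k]
  note e = quotient_eq_iff_same_a_r_cos[OF I, THEN iffD2]
  show "\<And>x. x \<in> carrier S \<Longrightarrow> h x \<in> carrier R" by (rule hc)
  show "\<And>x y. \<lbrakk>x \<in> carrier S; y \<in> carrier S\<rbrakk> \<Longrightarrow> h (x \<oplus>\<^bsub>S\<^esub> y) \<ominus> (h x \<oplus> h y) \<in> I"
    "\<And>x y. \<lbrakk>x \<in> carrier S; y \<in> carrier S\<rbrakk> \<Longrightarrow> h (x \<otimes>\<^bsub>S\<^esub> y) \<ominus> (h x \<otimes> h y) \<in> I"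
    "h \<one>\<^bsub>S\<^esub> \<ominus> \<one> \<in> I"
    by (auto intro!: e simp: hc q k)
qed

lemma p_torsion_freeD:
  "\<lbrakk>p_torsion_free p (add_monoid R); x \<in> carrier R; [p] \<cdot>\<^bsub>R\<^esub> x = \<zero>\<^bsub>R\<^esub>\<rbrakk> \<Longrightarrow> x = \<zero>\<^bsub>R\<^esub>"
  by (auto simp: p_torsion_free_def add_pow_def)

lemma multiples_add_monoid: "multiples q (add_monoid R) = (\<lambda>x. [q] \<cdot>\<^bsub>R\<^esub> x) ` carrier R"
  by (simp add: multiples_def add_pow_def)

lemma (in cring) add_pow_cancel:
  assumes "p_torsion_free p (add_monoid R)" "x \<in> carrier R" "y \<in> carrier R" "[p] \<cdot> x = [p] \<cdot> y"
  shows "x = y"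
proof -
  have "[p] \<cdot> (x \<ominus> y) = [p] \<cdot> x \<ominus> [p] \<cdot> y"
    using assms(2,3) by (simp add: minus_eq add.nat_pow_distrib add.nat_pow_inv)
  also have "\<dots> = \<zero>" using assms by (simp add: minus_eq r_neg)
  finally have "x \<ominus> y = \<zero>" using assms p_torsion_freeD by (metis minus_closed)
  then show ?thesis using assms(2,3) by simp
qed

section \<open>Frobenius lifts and their \<delta>-structure\<close>

locale frobenius_lift_ring = cring +
  fixes p :: nat and \<phi> :: "'a \<Rightarrow> 'a"
  assumes prime_p: "Factorial_Ring.prime p"
    and phi_hom: "\<phi> \<in> ring_hom R R"
    and torsion_free: "p_torsion_free p (add_monoid R)"
    and phi_lift: "x \<in> carrier R \<Longrightarrow> \<phi> x \<ominus> (x [^] p) \<in> multiples p (add_monoid R)"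
begin

abbreviation \<delta> where "\<delta> \<equiv> frobenius_delta p R \<phi>"

sublocale phi: ring_hom_cring R R \<phi>
  by unfold_locales (rule phi_hom)

lemma delta_closed [simp]: "x \<in> carrier R \<Longrightarrow> \<delta> x \<in> carrier R"
  and delta: "x \<in> carrier R \<Longrightarrow> \<phi> x = x [^] p \<oplus> [p] \<cdot> \<delta> x"
proof -
  assume x: "x \<in> carrier R"
  obtain y where y: "y \<in> carrier R" "[p] \<cdot> y = \<phi> x \<ominus> (x [^] p)"
    using phi_lift[OF x] by (auto simp: multiples_add_monoid)
  have "\<delta> x \<in> carrier R \<and> [p] \<cdot> \<delta> x = \<phi> x \<ominus> (x [^] p)"
    unfolding frobenius_delta_def
    by (rule theI[of _ y]) (use y add_pow_cancel[OF torsion_free] in auto)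
  then show "\<delta> x \<in> carrier R" "\<phi> x = x [^] p \<oplus> [p] \<cdot> \<delta> x"
    using x by (auto simp: minus_eq a_ac r_neg r_neg2)
qed

lemma delta_unique:
  "\<lbrakk>x \<in> carrier R; y \<in> carrier R; \<phi> x = x [^] p \<oplus> [p] \<cdot> y\<rbrakk> \<Longrightarrow> \<delta> x = y"
  using delta[of x] add_pow_cancel[OF torsion_free, of "\<delta> x" y] by simp

text \<open>\<phi> is additive and the p-th power is not; the defect is p times the cross term,
  which therefore enters \<delta> with a minus sign.\<close>

lemma delta_add:
  assumes x: "x \<in> carrier R" and y: "y \<in> carrier R"
  shows "\<delta> (x \<oplus> y) = \<delta> x \<oplus> \<delta> y \<ominus> frob_cross R p x y"
proof (rule delta_unique)
  have "[p] \<cdot> (\<delta> x \<oplus> \<delta> y \<ominus> frob_cross R p x y)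
      = [p] \<cdot> \<delta> x \<oplus> [p] \<cdot> \<delta> y \<ominus> [p] \<cdot> frob_cross R p x y"
    using x y by (simp add: minus_eq add.nat_pow_distrib add.nat_pow_inv)
  then show "\<phi> (x \<oplus> y) = (x \<oplus> y) [^] p \<oplus> [p] \<cdot> (\<delta> x \<oplus> \<delta> y \<ominus> frob_cross R p x y)"
    using x y by (simp add: delta[OF x] delta[OF y] freshman_pow prime_p minus_eq a_ac r_neg r_neg2)
qed (use x y in auto)

text \<open>The last factor is \<phi> y written out. In this form the right side involves only x, y,
  \<delta> x and \<delta> y, so it can be transported along a map that is not yet known to be
  compatible with \<phi>.\<close>

lemma delta_mult:
  assumes x: "x \<in> carrier R" and y: "y \<in> carrier R"
  shows "\<delta> (x \<otimes> y) = x [^] p \<otimes> \<delta> y \<oplus> \<delta> x \<otimes> (y [^] p \<oplus> [p] \<cdot> \<delta> y)"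
proof (rule delta_unique)
  show "\<phi> (x \<otimes> y) = (x \<otimes> y) [^] p \<oplus> [p] \<cdot> (x [^] p \<otimes> \<delta> y \<oplus> \<delta> x \<otimes> (y [^] p \<oplus> [p] \<cdot> \<delta> y))"
    using x y by (simp add: delta[OF x] delta[OF y] nat_pow_distrib l_distr r_distr add.nat_pow_distrib
      add_pow_ldistr add_pow_rdistr a_ac)
qed (use x y in auto)

lemma delta_one: "\<delta> \<one> = \<zero>"
  by (rule delta_unique) auto

end

text \<open>The degree 0 part of a strict Dieudonne algebra, where the standard filtration consists of the images
  of \<open>V ^^ r\<close>.\<close>
locale verschiebung_ring = cring +
  fixes p :: nat and F V :: "'a \<Rightarrow> 'a"
  assumes prime_p: "Factorial_Ring.prime p"
    and F_hom: "F \<in> ring_hom R R"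
    and F_inj: "inj_on F (carrier R)"
    and V_closed [simp]: "x \<in> carrier R \<Longrightarrow> V x \<in> carrier R"
    and F_V: "x \<in> carrier R \<Longrightarrow> F (V x) = [p] \<cdot> x"
    and F_lift: "x \<in> carrier R \<Longrightarrow> F x \<ominus> (x [^] p) \<in> multiples p (add_monoid R)"
    and V_separated: "\<lbrakk>x \<in> carrier R; \<And>r. x \<in> (V ^^ r) ` carrier R\<rbrakk> \<Longrightarrow> x = \<zero>"
    and V_complete: "\<lbrakk>\<And>r. s r \<in> carrier R; \<And>r. s (Suc r) \<ominus> s r \<in> (V ^^ r) ` carrier R\<rbrakk> \<Longrightarrow>
      \<exists>x\<in>carrier R. \<forall>r. s r \<ominus> x \<in> (V ^^ r) ` carrier R"
begin

sublocale F: ring_hom_cring R R F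
  by unfold_locales (rule F_hom)

lemma F_eqD: "\<lbrakk>x \<in> carrier R; y \<in> carrier R; F x = F y\<rbrakk> \<Longrightarrow> x = y"
  using F_inj by (auto dest: inj_onD)

lemma V_add: "\<lbrakk>x \<in> carrier R; y \<in> carrier R\<rbrakk> \<Longrightarrow> V (x \<oplus> y) = V x \<oplus> V y"
  by (rule F_eqD) (auto simp: F_V add.nat_pow_distrib)

text \<open>The projection formula: under the injective F both sides become p x F(y). It makes the
  images of the powers of V into ideals.\<close>

lemma V_mult: "\<lbrakk>x \<in> carrier R; y \<in> carrier R\<rbrakk> \<Longrightarrow> V x \<otimes> y = V (x \<otimes> F y)"
  by (rule F_eqD) (auto simp: F_V add_pow_ldistr)

lemma V_hom: "V \<in> hom (add_monoid R) (add_monoid R)"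
  by (rule homI) (auto simp: V_add)

lemma Vr_hom: "V ^^ r \<in> hom (add_monoid R) (add_monoid R)"
proof (induction r)
  case 0
  show ?case by (simp add: hom_def)
next
  case (Suc r)
  then show ?case using V_hom by (auto simp: hom_def Pi_def)
qed

lemma Vr_closed [simp]: "x \<in> carrier R \<Longrightarrow> (V ^^ r) x \<in> carrier R"
  using Vr_hom[of r] by (auto simp: hom_def)

lemma Fr_closed [simp]: "x \<in> carrier R \<Longrightarrow> (F ^^ r) x \<in> carrier R"
  by (induction r) auto

lemma Vr_mult: "\<lbrakk>x \<in> carrier R; y \<in> carrier R\<rbrakk> \<Longrightarrow> (V ^^ r) x \<otimes> y = (V ^^ r) (x \<otimes> (F ^^ r) y)"
proof (induction r arbitrary: x y)
  case (Suc r)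
  then have "(V ^^ Suc r) x \<otimes> y = (V ^^ Suc r) (x \<otimes> (F ^^ r) (F y))" by (simp add: V_mult)
  then show ?case by (simp add: funpow_swap1)
qed simp

definition vfil :: "nat \<Rightarrow> 'a set" where "vfil r = (V ^^ r) ` carrier R"

lemma vfil_ideal: "ideal (vfil r) R"
proof (rule idealI)
  interpret group_hom "add_monoid R" "add_monoid R" "V ^^ r"
    by unfold_locales (rule Vr_hom)
  show "subgroup (vfil r) (add_monoid R)"
    using img_is_subgroup by (simp add: vfil_def)
  show "a \<otimes> x \<in> vfil r" "x \<otimes> a \<in> vfil r" if "a \<in> vfil r" "x \<in> carrier R" for a x
    using that by (auto simp: vfil_def Vr_mult m_comm[of x])
qed (rule ring_axioms)

sublocale vfil: ideal "vfil r" R for r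
  by (rule vfil_ideal)

lemma vfil_Suc_subset: "vfil (Suc r) \<subseteq> vfil r"
  by (auto simp: vfil_def funpow_swap1)

lemma V_vfil: "x \<in> vfil r \<Longrightarrow> V x \<in> vfil (Suc r)"
  by (auto simp: vfil_def)

text \<open>F x = p w = F (V w) forces x = V w. Every gain of one level in the filtration is
  obtained in this way: an estimate modulo p V^r after applying F is one modulo V^(r+1)
  before.\<close>

lemma vfil_SucI: "\<lbrakk>x \<in> carrier R; w \<in> vfil r; F x = [p] \<cdot> w\<rbrakk> \<Longrightarrow> x \<in> vfil (Suc r)"
  using F_V[of w] F_eqD[of x "V w"] V_vfil[of w r] by auto


lemma Vr_add_pow: "x \<in> carrier R \<Longrightarrow> (V ^^ r) ([(n::nat)] \<cdot> x) = [n] \<cdot> (V ^^ r) x"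
proof -
  interpret group_hom "add_monoid R" "add_monoid R" "V ^^ r"
    by unfold_locales (rule Vr_hom)
  show "x \<in> carrier R \<Longrightarrow> ?thesis" using hom_nat_pow[of x n] by (simp add: add_pow_def)
qed

lemma Fr_add_pow: "x \<in> carrier R \<Longrightarrow> (F ^^ r) ([(n::nat)] \<cdot> x) = [n] \<cdot> (F ^^ r) x"
  by (induction r) (auto simp: F.hom_add_pow)

lemma Fr_Vr: "x \<in> carrier R \<Longrightarrow> (F ^^ r) ((V ^^ r) x) = [(p ^ r)] \<cdot> x"
proof (induction r)
  case (Suc r)
  have "(F ^^ Suc r) ((V ^^ Suc r) x) = (F ^^ r) (F (V ((V ^^ r) x)))"
    by (simp add: funpow_swap1)
  then show ?case using Suc by (simp add: F_V Fr_add_pow add.nat_pow_pow mult.commute)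
qed simp

text \<open>The projection formula and F^r V^r = p^r give (V^r z)^2 = p^r V^r (z^2). One factor p
  can be split off only for r at least 1.\<close>

lemma vfil_square:
  assumes "c \<in> vfil r" "1 \<le> r" shows "\<exists>w\<in>vfil r. c \<otimes> c = [p] \<cdot> w"
proof -
  obtain z where z: "z \<in> carrier R" "c = (V ^^ r) z" using assms(1) by (auto simp: vfil_def)
  have "c \<otimes> c = (V ^^ r) ([(p ^ r)] \<cdot> (z \<otimes> z))"
    using z by (simp add: Vr_mult Fr_Vr add_pow_rdistr)
  also have "[(p ^ r)] \<cdot> (z \<otimes> z) = [p] \<cdot> ([(p ^ (r - 1))] \<cdot> (z \<otimes> z))"
    using z assms(2) by (cases r) (simp_all add: add.nat_pow_pow mult.commute)
  finally have "c \<otimes> c = [p] \<cdot> (V ^^ r) ([(p ^ (r - 1))] \<cdot> (z \<otimes> z))"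
    using z by (simp add: Vr_add_pow)
  then show ?thesis using z by (auto simp: vfil_def)
qed

text \<open>In (b + c)^p = b^p + c^p + p (cross term) the cross term lies in the ideal with c, and
  c^p is a multiple of c^2, as p is at least 2, which is itself p times an element of the
  ideal.\<close>

lemma pow_cong:
  assumes b: "b \<in> carrier R" and c: "c \<in> vfil r" and r: "1 \<le> r"
  shows "\<exists>w\<in>vfil r. (b \<oplus> c) [^] p = b [^] p \<oplus> [p] \<cdot> w"
proof -
  have p: "2 \<le> p" using prime_p prime_ge_2_nat by blast
  have c': "c \<in> carrier R" using c by simp
  obtain w where w: "w \<in> vfil r" "c \<otimes> c = [p] \<cdot> w" using vfil_square[OF c r] by auto
  have "c [^] p = c [^] (p - 2) \<otimes> (c \<otimes> c)"
  proof -
    obtain q where "p = Suc (Suc q)" using p by (metis add_2_eq_Suc le_Suc_ex)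
    then show ?thesis using c' by (simp add: m_assoc)
  qed
  also have "\<dots> = [p] \<cdot> (c [^] (p - 2) \<otimes> w)" using w c' by (simp add: add_pow_rdistr)
  finally have "(b \<oplus> c) [^] p = b [^] p \<oplus> [p] \<cdot> (c [^] (p - 2) \<otimes> w \<oplus> frob_cross R p b c)"
    using b c' w by (simp add: freshman_pow prime_p add.nat_pow_distrib a_ac)
  moreover have "c [^] (p - 2) \<otimes> w \<oplus> frob_cross R p b c \<in> vfil r"
    using b c w c' ideal_frob_cross[OF is_cring vfil_ideal] by (simp add: vfil.I_l_closed)
  ultimately show ?thesis by blast
qed

text \<open>If F x - x^p = p w, then p w = F (V w), so x - V w is the preimage of x^p. The second
  conjunct records that this preimage is congruent to x modulo V.\<close>

lemma pow_in_image: "x \<in> carrier R \<Longrightarrow> \<exists>y\<in>carrier R. F y = x [^] p \<and> (\<exists>z\<in>carrier R. x = y \<oplus> V z)"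
proof -
  assume x: "x \<in> carrier R"
  obtain w where w: "w \<in> carrier R" "F x \<ominus> (x [^] p) = [p] \<cdot> w"
    using F_lift[OF x] by (auto simp: multiples_add_monoid)
  have "x [^] p = F x \<ominus> (F x \<ominus> (x [^] p))" using x by (simp add: minus_eq minus_add r_neg2)
  then have "x [^] p = F (x \<ominus> V w)" using x w by (simp add: F_V minus_eq)
  moreover have "x = (x \<ominus> V w) \<oplus> V w" using x w by (simp add: minus_eq a_assoc l_neg)
  ultimately show ?thesis using x w by (metis V_closed minus_closed)
qed

definition pth :: "'a \<Rightarrow> 'a" where "pth x = inv_into (carrier R) F (x [^] p)"

lemma pth_closed [simp]: "x \<in> carrier R \<Longrightarrow> pth x \<in> carrier R"
  and F_pth: "x \<in> carrier R \<Longrightarrow> F (pth x) = x [^] p"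
  unfolding pth_def using pow_in_image by (metis image_eqI inv_into_into f_inv_into_f)+

text \<open>This starts the iteration towards a fixed point: replacing x by F^-1 (x^p) does not
  change it modulo V.\<close>

lemma pth_cong: "x \<in> carrier R \<Longrightarrow> \<exists>w\<in>vfil 1. x = pth x \<oplus> w"
proof -
  assume x: "x \<in> carrier R"
  then obtain y z where "y \<in> carrier R" "F y = x [^] p" "z \<in> carrier R" "x = y \<oplus> V z"
    using pow_in_image by blast
  moreover from this have "pth x = y" using F_eqD[of "pth x" y] x by (simp add: F_pth)
  ultimately show ?thesis by (auto simp: vfil_def)
qed

text \<open>\<open>x = witt_step a e\<close> is the solution of \<open>F x = a ^ p + p e\<close>, the equation that a homomorphism
  compatible with the Frobenius lifts satisfies for \<open>a = x\<close>.\<close>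
definition witt_step :: "'a \<Rightarrow> 'a \<Rightarrow> 'a" where "witt_step a e = pth a \<oplus> V e"

lemma witt_step_closed [simp]: "\<lbrakk>a \<in> carrier R; e \<in> carrier R\<rbrakk> \<Longrightarrow> witt_step a e \<in> carrier R"
  by (simp add: witt_step_def)

lemma F_witt_step: "\<lbrakk>a \<in> carrier R; e \<in> carrier R\<rbrakk> \<Longrightarrow> F (witt_step a e) = a [^] p \<oplus> [p] \<cdot> e"
  by (simp add: witt_step_def F_pth F_V)

lemma minus_inE:
  assumes "a \<ominus> b \<in> vfil r" "a \<in> carrier R" "b \<in> carrier R"
  obtains w where "w \<in> vfil r" "a = b \<oplus> w"
  using assms by (intro that[of "a \<ominus> b"]) (simp_all add: minus_eq a_ac r_neg r_neg2)

lemma add_minus_cancel: "\<lbrakk>a \<in> carrier R; w \<in> carrier R\<rbrakk> \<Longrightarrow> (a \<oplus> w) \<ominus> a = w"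
  by (simp add: minus_eq a_comm[of a w] a_assoc r_neg)

text \<open>F of the difference is the difference of p-th powers plus p (e - e'). By
  \<open>pow_cong\<close> this is p times an element of level r, and removing F gains one
  level.\<close>

lemma witt_step_contracts:
  assumes "a \<in> carrier R" "e \<in> carrier R" "a' \<in> carrier R" "e' \<in> carrier R" "1 \<le> r"
    and a: "a \<ominus> a' \<in> vfil r" and e: "e \<ominus> e' \<in> vfil r"
  shows "witt_step a e \<ominus> witt_step a' e' \<in> vfil (Suc r)"
proof -
  obtain c where c: "c \<in> vfil r" "a = a' \<oplus> c" using a assms by (auto elim: minus_inE)
  obtain d where d: "d \<in> vfil r" "e = e' \<oplus> d" using e assms by (auto elim: minus_inE)
  obtain w where w: "w \<in> vfil r" "a [^] p = a' [^] p \<oplus> [p] \<cdot> w"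
    using pow_cong[of a' c r] c assms by auto
  have wd: "w \<oplus> d \<in> vfil r" using w d by simp
  have "F (witt_step a e) = F (witt_step a' e') \<oplus> [p] \<cdot> (w \<oplus> d)"
    using assms(1-4) w d(1) by (simp add: F_witt_step) (simp add: d(2) add.nat_pow_distrib a_ac)
  then have "F (witt_step a e \<ominus> witt_step a' e') = [p] \<cdot> (w \<oplus> d)"
    using assms(1-4) w d(1) add_minus_cancel[of "F (witt_step a' e')" "[p] \<cdot> (w \<oplus> d)"]
    by (simp add: minus_eq)
  with wd show ?thesis using assms(1-4) by (intro vfil_SucI) auto
qed

text \<open>Level 0 is the whole ring and can be left out, which matters because the estimates are
  available only from level 1 on.\<close>

lemma vfil_separated: "\<lbrakk>x \<in> carrier R; \<And>r. 1 \<le> r \<Longrightarrow> x \<in> vfil r\<rbrakk> \<Longrightarrow> x = \<zero>"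
proof (rule V_separated)
  fix r assume x: "x \<in> carrier R" "\<And>r. 1 \<le> r \<Longrightarrow> x \<in> vfil r"
  show "x \<in> (V ^^ r) ` carrier R" using x by (cases r) (auto simp del: funpow.simps simp flip: vfil_def)
qed

lemma vfil_trans: "\<lbrakk>a \<ominus> b \<in> vfil r; b \<ominus> c \<in> vfil r; a \<in> carrier R; b \<in> carrier R; c \<in> carrier R\<rbrakk> \<Longrightarrow> a \<ominus> c \<in> vfil r"
proof -
  assume *: "a \<ominus> b \<in> vfil r" "b \<ominus> c \<in> vfil r" "a \<in> carrier R" "b \<in> carrier R" "c \<in> carrier R"
  then have "a \<ominus> c = (a \<ominus> b) \<oplus> (b \<ominus> c)" by (simp add: minus_eq a_assoc r_neg1)
  then show ?thesis using * by simp
qed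

lemma vfil_sym: "\<lbrakk>a \<ominus> b \<in> vfil r; a \<in> carrier R; b \<in> carrier R\<rbrakk> \<Longrightarrow> b \<ominus> a \<in> vfil r"
  using vfil.a_inv_closed[of "a \<ominus> b" r] by (simp add: minus_eq minus_add a_comm)

end

section \<open>Existence and uniqueness of the lift to a homomorphism compatible with
  Frobenius\<close>

locale frobenius_lifting = S: frobenius_lift_ring S p \<phi> + verschiebung_ring R p F V
  for S :: "('s, 'k) ring_scheme" (structure) and R :: "('r, 'l) ring_scheme" (structure)
    and p :: nat and \<phi> F V
begin

lemma fixpoint_iff:
  assumes "h x \<in> carrier R" "h (S.\<delta> x) \<in> carrier R"
  shows "h x = witt_step (h x) (h (S.\<delta> x)) \<longleftrightarrow> F (h x) = h x [^]\<^bsub>R\<^esub> p \<oplus>\<^bsub>R\<^esub> [p] \<cdot>\<^bsub>R\<^esub> h (S.\<delta> x)"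
  using assms F_eqD[of "h x" "witt_step (h x) (h (S.\<delta> x))"] F_witt_step[OF assms]
  by (metis witt_step_closed)

text \<open>Apply h to \<phi> x = x^p + p \<delta> x. For homomorphisms the fixed point equation and
  compatibility with Frobenius are thus the same condition.\<close>

lemma hom_fixpoint:
  assumes h: "h \<in> ring_hom S R" "\<And>x. x \<in> carrier S \<Longrightarrow> F (h x) = h (\<phi> x)" and x: "x \<in> carrier S"
  shows "h x = witt_step (h x) (h (S.\<delta> x))"
proof -
  interpret h: ring_hom_cring S R h
    by unfold_locales (rule h)
  have "F (h x) = h (x [^]\<^bsub>S\<^esub> p \<oplus>\<^bsub>S\<^esub> [p] \<cdot>\<^bsub>S\<^esub> S.\<delta> x)" using h(2) x by (simp only: S.delta)
  then show ?thesis using x by (simp add: fixpoint_iff h.hom_add_pow h.ring.hom_nat_pow)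
qed

text \<open>The fixed point equation at x involves the value at \<delta> x, so agreement has to be
  improved from one level to the next for all arguments simultaneously.\<close>

lemma fixpoint_unique:
  assumes h: "\<And>x. x \<in> carrier S \<Longrightarrow> h x \<in> carrier R" "\<And>x. x \<in> carrier S \<Longrightarrow> h x = witt_step (h x) (h (S.\<delta> x))"
    and h': "\<And>x. x \<in> carrier S \<Longrightarrow> h' x \<in> carrier R" "\<And>x. x \<in> carrier S \<Longrightarrow> h' x = witt_step (h' x) (h' (S.\<delta> x))"
    and 1: "\<And>x. x \<in> carrier S \<Longrightarrow> h x \<ominus>\<^bsub>R\<^esub> h' x \<in> vfil 1"
    and x: "x \<in> carrier S"
  shows "h x = h' x"
proof -
  have "h x \<ominus>\<^bsub>R\<^esub> h' x \<in> vfil r" if "1 \<le> r" "x \<in> carrier S" for r x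
    using that
  proof (induction r arbitrary: x rule: dec_induct)
    case base
    then show ?case using 1 by simp
  next
    case (step r)
    then have "witt_step (h x) (h (S.\<delta> x)) \<ominus>\<^bsub>R\<^esub> witt_step (h' x) (h' (S.\<delta> x)) \<in> vfil (Suc r)"
      by (intro witt_step_contracts) (simp_all add: h(1) h'(1))
    then show ?case using h(2)[of x] h'(2)[of x] step by simp
  qed
  then have "h x \<ominus>\<^bsub>R\<^esub> h' x = \<zero>\<^bsub>R\<^esub>"
    using x by (intro vfil_separated) (simp_all add: h(1) h'(1))
  then show ?thesis using h(1) h'(1) x by simp
qed

theorem lift_unique:
  assumes "h \<in> ring_hom S R" "\<And>x. x \<in> carrier S \<Longrightarrow> F (h x) = h (\<phi> x)"
    and "h' \<in> ring_hom S R" "\<And>x. x \<in> carrier S \<Longrightarrow> F (h' x) = h' (\<phi> x)"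
    and "\<And>x. x \<in> carrier S \<Longrightarrow> h x \<ominus>\<^bsub>R\<^esub> h' x \<in> vfil 1" "x \<in> carrier S"
  shows "h x = h' x"
  using assms by (intro fixpoint_unique[of h h'] hom_fixpoint) (auto intro: ring_hom_closed)

text \<open>\<open>witt_step\<close> contracts the \<open>V\<close>-adic topology, so iterating it from any set-theoretic lift converges.\<close>
lemma fixpoint_exists:
  assumes f: "\<And>x. x \<in> carrier S \<Longrightarrow> f x \<in> carrier R"
  obtains h where "\<And>x. x \<in> carrier S \<Longrightarrow> h x \<in> carrier R"
    "\<And>x. x \<in> carrier S \<Longrightarrow> h x = witt_step (h x) (h (S.\<delta> x))"
    "\<And>x. x \<in> carrier S \<Longrightarrow> h x \<ominus>\<^bsub>R\<^esub> f x \<in> vfil 1"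
proof -
  define s where "s = rec_nat f (\<lambda>_ g x. witt_step (g x) (g (S.\<delta> x)))"
  have s0: "s 0 = f" and sS: "s (Suc n) x = witt_step (s n x) (s n (S.\<delta> x))" for n x
    by (simp_all add: s_def)
  have sc: "s n x \<in> carrier R" if "x \<in> carrier S" for n x
    using that by (induction n arbitrary: x) (auto simp: s0 sS f)
  have step: "s (Suc n) x \<ominus>\<^bsub>R\<^esub> s n x \<in> vfil (Suc n)" if "x \<in> carrier S" for n x
    using that
  proof (induction n arbitrary: x)
    case 0
    \<comment> \<open>At the start there is no congruence to contract, and nothing is known about f
      as a map. The first difference lies in V because both \<open>s 1 x\<close> and
      \<open>s 0 x\<close> differ from \<open>pth (f x)\<close> by an element of V.\<close>
    obtain w where w: "w \<in> vfil 1" "f x = pth (f x) \<oplus>\<^bsub>R\<^esub> w" using pth_cong[of "f x"] f 0 by auto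
    have V: "V (f (S.\<delta> x)) \<in> vfil 1" using f 0 by (auto simp: vfil_def)
    have "s 1 x = pth (f x) \<oplus>\<^bsub>R\<^esub> V (f (S.\<delta> x))" "s 0 x = pth (f x) \<oplus>\<^bsub>R\<^esub> w"
      using w(2) by (simp_all add: s0 sS witt_step_def)
    then have "s 1 x \<ominus>\<^bsub>R\<^esub> s 0 x = V (f (S.\<delta> x)) \<oplus>\<^bsub>R\<^esub> \<ominus>\<^bsub>R\<^esub> w"
      using f 0 w(1) by (simp add: a_comm[of "pth (f x)" "V _"] minus_eq minus_add a_assoc r_neg2)
    then show ?case using V w by simp
  next
    case (Suc n)
    then show ?case
      unfolding sS[of "Suc n"] sS[of n x] by (intro witt_step_contracts) (auto simp: sc simp flip: sS)
  qed
  have "\<exists>a\<in>carrier R. \<forall>r. s r x \<ominus>\<^bsub>R\<^esub> a \<in> (V ^^ r) ` carrier R" if "x \<in> carrier S" for x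
    using that step[of x] vfil_Suc_subset sc by (intro V_complete) (auto simp flip: vfil_def)
  then obtain h where h: "\<And>x. x \<in> carrier S \<Longrightarrow> h x \<in> carrier R"
    and lim: "\<And>x r. x \<in> carrier S \<Longrightarrow> s r x \<ominus>\<^bsub>R\<^esub> h x \<in> vfil r"
    unfolding vfil_def by metis
  have fixp: "h x = witt_step (h x) (h (S.\<delta> x))" if x: "x \<in> carrier S" for x
  proof -
    have "h x \<ominus>\<^bsub>R\<^esub> witt_step (h x) (h (S.\<delta> x)) \<in> vfil r" if r: "1 \<le> r" for r
    proof -
      \<comment> \<open>\<open>s (Suc r)\<close> is the step applied to \<open>s r\<close>, and
        \<open>s r\<close> agrees with the limit to level r; the contraction moves this agreement to
        level \<open>Suc r\<close>.\<close>
      have 1: "s (Suc r) x \<ominus>\<^bsub>R\<^esub> witt_step (h x) (h (S.\<delta> x)) \<in> vfil (Suc r)"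
        unfolding sS using x r by (intro witt_step_contracts lim) (auto simp: h sc)
      have "h x \<ominus>\<^bsub>R\<^esub> s (Suc r) x \<in> vfil (Suc r)" using x by (rule vfil_sym[OF lim]) (auto simp: h sc x)
      from vfil_trans[OF this 1] x vfil_Suc_subset show ?thesis by (auto simp: h sc)
    qed
    then have "h x \<ominus>\<^bsub>R\<^esub> witt_step (h x) (h (S.\<delta> x)) = \<zero>\<^bsub>R\<^esub>"
      using x by (intro vfil_separated) (auto simp: h)
    then show ?thesis using x h by simp
  qed
  have "h x \<ominus>\<^bsub>R\<^esub> f x \<in> vfil 1" if x: "x \<in> carrier S" for x
  proof -
    have "h x \<ominus>\<^bsub>R\<^esub> s 1 x \<in> vfil 1" using x by (rule vfil_sym[OF lim]) (auto simp: h sc x)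
    from vfil_trans[OF this, of "f x"] step[of x 0] x show ?thesis by (auto simp: h sc s0 f)
  qed
  with h fixp show thesis by (rule that)
qed

text \<open>Apply F to h (x + y) and to h (x y) and use the fixed point equation. The p-th power is
  then known modulo p V^r by \<open>pow_cong\<close>, and the term with \<delta> is multiplied by p,
  so a congruence modulo V^r suffices for it. Removing F gives the next level.\<close>

lemma fixpoint_hom_mod_Suc:
  assumes h: "\<And>x. x \<in> carrier S \<Longrightarrow> h x \<in> carrier R"
      "\<And>x. x \<in> carrier S \<Longrightarrow> F (h x) = h x [^]\<^bsub>R\<^esub> p \<oplus>\<^bsub>R\<^esub> [p] \<cdot>\<^bsub>R\<^esub> h (S.\<delta> x)"
    and r: "1 \<le> r" and hom: "h \<in> hom_mod S R (vfil r)"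
  shows "h \<in> hom_mod S R (vfil (Suc r))"
proof (rule hom_modI[OF vfil_ideal h(1) S.is_cring])
  note D = hom_modD[OF vfil_ideal S.is_cring hom]
  note C = hom_mod_cong[OF S.is_cring is_cring vfil_ideal hom]
  note v = vfil.a_Hcarr
  fix x y assume x: "x \<in> carrier S" and y: "y \<in> carrier S"
  note xy = h(1)[OF x] h(1)[OF y] h(1)[OF S.delta_closed[OF x]] h(1)[OF S.delta_closed[OF y]]
  show "h (x \<oplus>\<^bsub>S\<^esub> y) \<ominus>\<^bsub>R\<^esub> (h x \<oplus>\<^bsub>R\<^esub> h y) \<in> vfil (Suc r)"
  proof -
    obtain c where c: "c \<in> vfil r" "h (x \<oplus>\<^bsub>S\<^esub> y) = (h x \<oplus>\<^bsub>R\<^esub> h y) \<oplus>\<^bsub>R\<^esub> c"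
      using D(2)[OF x y] x y xy by (auto simp: h elim!: minus_inE)
    obtain w where w: "w \<in> vfil r" "h (x \<oplus>\<^bsub>S\<^esub> y) [^]\<^bsub>R\<^esub> p = (h x \<oplus>\<^bsub>R\<^esub> h y) [^]\<^bsub>R\<^esub> p \<oplus>\<^bsub>R\<^esub> [p] \<cdot>\<^bsub>R\<^esub> w"
      using pow_cong[of "h x \<oplus>\<^bsub>R\<^esub> h y" c r] c r xy by auto
    obtain d where d: "d \<in> vfil r"
      "h (S.\<delta> (x \<oplus>\<^bsub>S\<^esub> y)) = (h (S.\<delta> x) \<oplus>\<^bsub>R\<^esub> h (S.\<delta> y) \<ominus>\<^bsub>R\<^esub> frob_cross R p (h x) (h y)) \<oplus>\<^bsub>R\<^esub> d"
      using C(1)[OF x y S.delta_closed[OF x] S.delta_closed[OF y], of p] x y xy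
      by (auto simp: S.delta_add h elim!: minus_inE)
    have "F (h (x \<oplus>\<^bsub>S\<^esub> y)) = F (h x \<oplus>\<^bsub>R\<^esub> h y) \<oplus>\<^bsub>R\<^esub> [p] \<cdot>\<^bsub>R\<^esub> (w \<oplus>\<^bsub>R\<^esub> d)"
    proof -
      \<comment> \<open>The cross term occurs twice with opposite signs: from the p-th power of h x
        + h y, and from \<delta> of a sum.\<close>
      let ?Q = "[p] \<cdot>\<^bsub>R\<^esub> frob_cross R p (h x) (h y)"
      have Q: "?Q \<in> carrier R" using xy by simp
      have "F (h (x \<oplus>\<^bsub>S\<^esub> y)) = (h x [^]\<^bsub>R\<^esub> p \<oplus>\<^bsub>R\<^esub> h y [^]\<^bsub>R\<^esub> p \<oplus>\<^bsub>R\<^esub> ?Q \<oplus>\<^bsub>R\<^esub> [p] \<cdot>\<^bsub>R\<^esub> w) \<oplus>\<^bsub>R\<^esub>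
        ([p] \<cdot>\<^bsub>R\<^esub> h (S.\<delta> x) \<oplus>\<^bsub>R\<^esub> [p] \<cdot>\<^bsub>R\<^esub> h (S.\<delta> y) \<ominus>\<^bsub>R\<^esub> ?Q \<oplus>\<^bsub>R\<^esub> [p] \<cdot>\<^bsub>R\<^esub> d)"
        using x y xy v[OF w(1)] v[OF d(1)]
        by (simp add: h(2) w(2) d(2) freshman_pow prime_p add.nat_pow_distrib add.nat_pow_inv minus_eq)
      also have "\<dots> = (h x [^]\<^bsub>R\<^esub> p \<oplus>\<^bsub>R\<^esub> h y [^]\<^bsub>R\<^esub> p \<oplus>\<^bsub>R\<^esub> [p] \<cdot>\<^bsub>R\<^esub> w \<oplus>\<^bsub>R\<^esub>
        [p] \<cdot>\<^bsub>R\<^esub> h (S.\<delta> x) \<oplus>\<^bsub>R\<^esub> [p] \<cdot>\<^bsub>R\<^esub> h (S.\<delta> y) \<oplus>\<^bsub>R\<^esub> [p] \<cdot>\<^bsub>R\<^esub> d) \<oplus>\<^bsub>R\<^esub> (?Q \<ominus>\<^bsub>R\<^esub> ?Q)"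
        using xy v[OF w(1)] v[OF d(1)] Q by (simp add: minus_eq a_ac)
      finally show ?thesis
        using x y xy v[OF w(1)] v[OF d(1)] Q
        by (simp add: h(2) minus_eq r_neg add.nat_pow_distrib a_ac)
    qed
    then show ?thesis using w d x y xy add_minus_cancel[of "F (h x \<oplus>\<^bsub>R\<^esub> h y)" "[p] \<cdot>\<^bsub>R\<^esub> (w \<oplus>\<^bsub>R\<^esub> d)"]
      by (intro vfil_SucI[of _ "w \<oplus>\<^bsub>R\<^esub> d"]) (auto simp: h(1) minus_eq)
  qed
  show "h (x \<otimes>\<^bsub>S\<^esub> y) \<ominus>\<^bsub>R\<^esub> (h x \<otimes>\<^bsub>R\<^esub> h y) \<in> vfil (Suc r)"
  proof -
    obtain c where c: "c \<in> vfil r" "h (x \<otimes>\<^bsub>S\<^esub> y) = (h x \<otimes>\<^bsub>R\<^esub> h y) \<oplus>\<^bsub>R\<^esub> c"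
      using D(3)[OF x y] x y xy by (auto simp: h elim!: minus_inE)
    obtain w where w: "w \<in> vfil r" "h (x \<otimes>\<^bsub>S\<^esub> y) [^]\<^bsub>R\<^esub> p = (h x \<otimes>\<^bsub>R\<^esub> h y) [^]\<^bsub>R\<^esub> p \<oplus>\<^bsub>R\<^esub> [p] \<cdot>\<^bsub>R\<^esub> w"
      using pow_cong[of "h x \<otimes>\<^bsub>R\<^esub> h y" c r] c r xy by auto
    obtain d where d: "d \<in> vfil r"
      "h (S.\<delta> (x \<otimes>\<^bsub>S\<^esub> y)) = (h x [^]\<^bsub>R\<^esub> p \<otimes>\<^bsub>R\<^esub> h (S.\<delta> y) \<oplus>\<^bsub>R\<^esub>
        h (S.\<delta> x) \<otimes>\<^bsub>R\<^esub> (h y [^]\<^bsub>R\<^esub> p \<oplus>\<^bsub>R\<^esub> [p] \<cdot>\<^bsub>R\<^esub> h (S.\<delta> y))) \<oplus>\<^bsub>R\<^esub> d"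
      using C(2)[OF x y S.delta_closed[OF x] S.delta_closed[OF y], of p] x y xy
      by (auto simp: S.delta_mult h elim!: minus_inE)
    \<comment> \<open>Up to the errors w and d this is the identity behind
      \<open>S.delta_mult\<close>, read in R with F (h y) = h(y)^p + p h(\<delta> y) in the role of
      \<phi> y.\<close>
    have "F (h (x \<otimes>\<^bsub>S\<^esub> y)) = F (h x \<otimes>\<^bsub>R\<^esub> h y) \<oplus>\<^bsub>R\<^esub> [p] \<cdot>\<^bsub>R\<^esub> (w \<oplus>\<^bsub>R\<^esub> d)"
      using x y xy v[OF w(1)] v[OF d(1)]
      by (simp add: h(2) w(2) d(2) nat_pow_distrib l_distr r_distr add.nat_pow_distrib
        add_pow_ldistr add_pow_rdistr a_ac)
    then show ?thesis using w d x y xy add_minus_cancel[of "F (h x \<otimes>\<^bsub>R\<^esub> h y)" "[p] \<cdot>\<^bsub>R\<^esub> (w \<oplus>\<^bsub>R\<^esub> d)"]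
      by (intro vfil_SucI[of _ "w \<oplus>\<^bsub>R\<^esub> d"]) (auto simp: h(1) minus_eq)
  qed
next
  note D = hom_modD[OF vfil_ideal S.is_cring hom]
  note C = hom_mod_cong[OF S.is_cring is_cring vfil_ideal hom]
  note v = vfil.a_Hcarr
  obtain c where c: "c \<in> vfil r" "h \<one>\<^bsub>S\<^esub> = \<one>\<^bsub>R\<^esub> \<oplus>\<^bsub>R\<^esub> c"
    using D(4) by (auto simp: h elim!: minus_inE)
  obtain w where w: "w \<in> vfil r" "h \<one>\<^bsub>S\<^esub> [^]\<^bsub>R\<^esub> p = \<one>\<^bsub>R\<^esub> [^]\<^bsub>R\<^esub> p \<oplus>\<^bsub>R\<^esub> [p] \<cdot>\<^bsub>R\<^esub> w"
    using pow_cong[of "\<one>\<^bsub>R\<^esub>" c r] c r by auto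
  \<comment> \<open>By \<delta> 1 = 0 the fixed point equation at 1 contains h 0, which at this
    stage is known to vanish only modulo V^r.\<close>
  have d: "h \<zero>\<^bsub>S\<^esub> \<in> vfil r" by (rule C(3)) auto
  have "F (h \<one>\<^bsub>S\<^esub>) = \<one>\<^bsub>R\<^esub> \<oplus>\<^bsub>R\<^esub> [p] \<cdot>\<^bsub>R\<^esub> (w \<oplus>\<^bsub>R\<^esub> h \<zero>\<^bsub>S\<^esub>)"
    using v[OF w(1)] v[OF d] by (simp add: h(2) w(2) S.delta_one add.nat_pow_distrib a_assoc)
  then show "h \<one>\<^bsub>S\<^esub> \<ominus>\<^bsub>R\<^esub> \<one>\<^bsub>R\<^esub> \<in> vfil (Suc r)"
    using w d add_minus_cancel[of "\<one>\<^bsub>R\<^esub>" "[p] \<cdot>\<^bsub>R\<^esub> (w \<oplus>\<^bsub>R\<^esub> h \<zero>\<^bsub>S\<^esub>)"]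
      by (intro vfil_SucI[of _ "w \<oplus>\<^bsub>R\<^esub> h \<zero>\<^bsub>S\<^esub>"]) (auto simp: h(1) minus_eq)
qed

text \<open>Level 1 is inherited from f, all higher levels follow by induction, and separatedness
  turns the congruences into equalities.\<close>

theorem lift_exists:
  assumes f: "f \<in> hom_mod S R (vfil 1)"
  obtains h where "h \<in> ring_hom S R" "\<And>x. x \<in> carrier S \<Longrightarrow> F (h x) = h (\<phi> x)"
    "\<And>x. x \<in> carrier S \<Longrightarrow> h x \<ominus>\<^bsub>R\<^esub> f x \<in> vfil 1"
proof -
  note fD = hom_modD[OF vfil_ideal S.is_cring f]
  obtain h where h: "\<And>x. x \<in> carrier S \<Longrightarrow> h x \<in> carrier R"
    "\<And>x. x \<in> carrier S \<Longrightarrow> h x = witt_step (h x) (h (S.\<delta> x))"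
    and hf: "\<And>x. x \<in> carrier S \<Longrightarrow> h x \<ominus>\<^bsub>R\<^esub> f x \<in> vfil 1"
    using fixpoint_exists[of f] fD(1) by blast
  have hF: "F (h x) = h x [^]\<^bsub>R\<^esub> p \<oplus>\<^bsub>R\<^esub> [p] \<cdot>\<^bsub>R\<^esub> h (S.\<delta> x)" if "x \<in> carrier S" for x
    using fixpoint_iff[of h x] h that by auto
  have "vfil 1 +>\<^bsub>R\<^esub> h x = vfil 1 +>\<^bsub>R\<^esub> f x" if "x \<in> carrier S" for x
    using quotient_eq_iff_same_a_r_cos[OF vfil_ideal] hf h fD(1) that by metis
  then have base: "h \<in> hom_mod S R (vfil 1)"
    using f h by (auto simp: hom_mod_def ring_hom_def Pi_def)
  have mod: "h \<in> hom_mod S R (vfil r)" if "1 \<le> r" for r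
    using that by (induction r rule: dec_induct) (auto intro: base[simplified] fixpoint_hom_mod_Suc h(1) hF)
  note D = hom_modD[OF vfil_ideal S.is_cring mod]
  have hom: "h \<in> ring_hom S R"
  proof (rule ring_hom_memI)
    fix x y assume x: "x \<in> carrier S" and y: "y \<in> carrier S"
    have "h (x \<oplus>\<^bsub>S\<^esub> y) \<ominus>\<^bsub>R\<^esub> (h x \<oplus>\<^bsub>R\<^esub> h y) = \<zero>\<^bsub>R\<^esub>"
      using D(2)[OF _ x y] x y by (intro vfil_separated) (auto simp: h(1))
    then show "h (x \<oplus>\<^bsub>S\<^esub> y) = h x \<oplus>\<^bsub>R\<^esub> h y" using x y h(1) by simp
    have "h (x \<otimes>\<^bsub>S\<^esub> y) \<ominus>\<^bsub>R\<^esub> (h x \<otimes>\<^bsub>R\<^esub> h y) = \<zero>\<^bsub>R\<^esub>"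
      using D(3)[OF _ x y] x y by (intro vfil_separated) (auto simp: h(1))
    then show "h (x \<otimes>\<^bsub>S\<^esub> y) = h x \<otimes>\<^bsub>R\<^esub> h y" using x y h(1) by simp
  next
    have "h \<one>\<^bsub>S\<^esub> \<ominus>\<^bsub>R\<^esub> \<one>\<^bsub>R\<^esub> = \<zero>\<^bsub>R\<^esub>"
      using D(4) by (intro vfil_separated) (auto simp: h(1))
    then show "h \<one>\<^bsub>S\<^esub> = \<one>\<^bsub>R\<^esub>" using h(1) by simp
  qed (rule h(1))
  interpret h: ring_hom_cring S R h
    by unfold_locales (rule hom)
  \<comment> \<open>As h now respects sums and products, the right side of the fixed point equation
    is h (x^p + p \<delta> x).\<close>
  have "F (h x) = h (\<phi> x)" if "x \<in> carrier S" for x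
    using that by (simp add: hF S.delta h.hom_add_pow h.ring.hom_nat_pow)
  with hom hf show thesis using that by blast
qed

end

section \<open>The standard filtration of a strict Dieudonne algebra\<close>

context cochain_complex
begin

sublocale Gr: comm_group "Gr M n" for n
  by (rule comm_group_Gr)

sublocale Diff: group_hom "Gr M n" "Gr M (n + 1)" "Diff M n" for n
  by unfold_locales (rule Diff_hom)

end

sublocale dieudonne_complex \<subseteq> F: group_hom "Gr M n" "Gr M n" "F n" for n
  by unfold_locales (rule F_hom)

lemma (in comm_group) multiples_subgroup: "subgroup (multiples q G) G"
proof -
  interpret group_hom G G "\<lambda>x. x [^] q"
    by unfold_locales (auto simp: hom_def nat_pow_distrib)
  show ?thesis using img_is_subgroup by (simp add: multiples_def)
qed

lemma (in comm_group) p_torsion_free_cancel: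
  assumes "p_torsion_free p G" "x \<in> carrier G" "y \<in> carrier G" "x [^] p = y [^] p"
  shows "x = y"
proof -
  have "(x \<otimes> inv y) [^] p = \<one>" using assms by (simp add: nat_pow_distrib nat_pow_inv)
  then have "x \<otimes> inv y = \<one>" using assms by (simp add: p_torsion_free_def)
  then show ?thesis using assms by (simp add: inv_solve_right')
qed

lemma (in comm_group) rcos_eq_iff:
  assumes "subgroup N G" "x \<in> carrier G" "y \<in> carrier G"
  shows "N #> x = N #> y \<longleftrightarrow> x \<otimes> inv y \<in> N"
proof
  assume "N #> x = N #> y"
  then have "x \<in> N #> y" using rcos_self[OF assms(2,1)] by simp
  then show "x \<otimes> inv y \<in> N" using subgroup.rcos_module[OF assms(1) is_group assms(3,2)] by simp
next
  assume "x \<otimes> inv y \<in> N"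
  then have "x \<in> N #> y" using subgroup.rcos_module[OF assms(1) is_group assms(3,2)] by simp
  then show "N #> x = N #> y" using repr_independence[OF _ assms(3,1)] by simp
qed

context saturated_dieudonne_complex
begin

abbreviation V where "V \<equiv> verschiebung M p F"

lemma F_eqD: "\<lbrakk>x \<in> carrier (Gr M n); y \<in> carrier (Gr M n); F n x = F n y\<rbrakk> \<Longrightarrow> x = y"
  using F_bij[of n] by (auto simp: bij_betw_def dest: inj_onD)

lemma pow_cancel:
  "\<lbrakk>x [^]\<^bsub>Gr M n\<^esub> p = y [^]\<^bsub>Gr M n\<^esub> p; x \<in> carrier (Gr M n); y \<in> carrier (Gr M n)\<rbrakk> \<Longrightarrow> x = y"
  using Gr.p_torsion_free_cancel[OF torsion_free] by blast

lemma F_image: "\<lbrakk>x \<in> carrier (Gr M n); Diff M n x \<in> multiples p (Gr M (n + 1))\<rbrakk> \<Longrightarrow>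
    \<exists>y\<in>carrier (Gr M n). F n y = x"
  using bij_betw_imp_surj_on[OF F_bij[of n]] by (metis (no_types, lifting) imageE mem_Collect_eq)

text \<open>Since d (p x) = p d x, the multiple p x satisfies the condition that describes the image
  of F in a saturated complex; injectivity of F makes its preimage unique.\<close>

lemma V_closed [simp]: "x \<in> carrier (Gr M n) \<Longrightarrow> V n x \<in> carrier (Gr M n)"
  and F_V: "x \<in> carrier (Gr M n) \<Longrightarrow> F n (V n x) = x [^]\<^bsub>Gr M n\<^esub> p"
proof -
  assume x: "x \<in> carrier (Gr M n)"
  have "Diff M n (x [^]\<^bsub>Gr M n\<^esub> p) \<in> multiples p (Gr M (n + 1))"
    using x by (auto simp: multiples_def Diff.hom_nat_pow)
  then obtain y where y: "y \<in> carrier (Gr M n)" "F n y = x [^]\<^bsub>Gr M n\<^esub> p" using F_image x by blast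
  have "V n x \<in> carrier (Gr M n) \<and> F n (V n x) = x [^]\<^bsub>Gr M n\<^esub> p"
    unfolding verschiebung_def by (rule theI[of _ y]) (use y F_eqD in auto)
  then show "V n x \<in> carrier (Gr M n)" "F n (V n x) = x [^]\<^bsub>Gr M n\<^esub> p" by auto
qed

lemma V_F: "x \<in> carrier (Gr M n) \<Longrightarrow> V n (F n x) = x [^]\<^bsub>Gr M n\<^esub> p"
  by (rule F_eqD[of _ n]) (simp_all add: F_V F.hom_nat_pow)

lemma V_hom: "V n \<in> hom (Gr M n) (Gr M n)"
proof (rule homI)
  show "V n (x \<otimes>\<^bsub>Gr M n\<^esub> y) = V n x \<otimes>\<^bsub>Gr M n\<^esub> V n y"
    if "x \<in> carrier (Gr M n)" "y \<in> carrier (Gr M n)" for x y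
    using that by - (rule F_eqD[of _ n], simp_all add: F_V Gr.nat_pow_distrib)
qed simp

lemma Vr_hom: "V n ^^ r \<in> hom (Gr M n) (Gr M n)"
proof (induction r)
  case 0
  show ?case by (simp add: hom_def)
next
  case (Suc r)
  then show ?case using V_hom by (auto simp: hom_def Pi_def)
qed

sublocale Vr: group_hom "Gr M n" "Gr M n" "V n ^^ r" for n r
  by unfold_locales (rule Vr_hom)

lemma Fr_closed [simp]: "x \<in> carrier (Gr M n) \<Longrightarrow> (F n ^^ r) x \<in> carrier (Gr M n)"
  by (induction r) auto

lemma Vr_Fr: "x \<in> carrier (Gr M n) \<Longrightarrow> (V n ^^ r) ((F n ^^ r) x) = x [^]\<^bsub>Gr M n\<^esub> (p ^ r)"
proof (induction r)
  case (Suc r)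
  have "(V n ^^ Suc r) ((F n ^^ Suc r) x) = (V n ^^ r) (V n (F n ((F n ^^ r) x)))"
    by (simp add: funpow_swap1)
  then show ?case using Suc by (simp add: V_F Vr.hom_nat_pow Gr.nat_pow_pow mult.commute)
qed simp

abbreviation Fil where "Fil \<equiv> standard_filtration M p F"

lemma dVr_hom: "(\<lambda>y. Diff M (n - 1) ((V (n - 1) ^^ r) y)) \<in> hom (Gr M (n - 1)) (Gr M n)"
  using Diff.homh[of "n - 1"] Vr_hom[where n = "n - 1" and r = r] by (auto simp: hom_def Pi_def)

lemma Fil_eq: "Fil n r = (V n ^^ r) ` carrier (Gr M n) <#>\<^bsub>Gr M n\<^esub>
    (\<lambda>y. Diff M (n - 1) ((V (n - 1) ^^ r) y)) ` carrier (Gr M (n - 1))"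
  by (simp add: standard_filtration_def image_image)

lemma Fil_subgroup: "subgroup (Fil n r) (Gr M n)"
proof -
  interpret dV: group_hom "Gr M (n - 1)" "Gr M n" "\<lambda>y. Diff M (n - 1) ((V (n - 1) ^^ r) y)"
    by unfold_locales (rule dVr_hom)
  show ?thesis unfolding Fil_eq
    by (rule Gr.mult_subgroups[OF Vr.img_is_subgroup dV.img_is_subgroup])
qed

lemma Fil_carrier: "x \<in> Fil n r \<Longrightarrow> x \<in> carrier (Gr M n)"
  using Fil_subgroup subgroup.mem_carrier by fast

lemmas Fil_one = subgroup.one_closed[OF Fil_subgroup]
  and Fil_mult = subgroup.m_closed[OF Fil_subgroup]
  and Fil_inv = subgroup.m_inv_closed[OF Fil_subgroup]

lemma FilE:
  assumes "x \<in> Fil n r"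
  obtains a b where "a \<in> carrier (Gr M n)" "b \<in> carrier (Gr M (n - 1))"
    "x = (V n ^^ r) a \<otimes>\<^bsub>Gr M n\<^esub> Diff M (n - 1) ((V (n - 1) ^^ r) b)"
  using assms unfolding Fil_eq set_mult_def by blast

lemma FilI: "\<lbrakk>a \<in> carrier (Gr M n); b \<in> carrier (Gr M (n - 1))\<rbrakk> \<Longrightarrow>
    (V n ^^ r) a \<otimes>\<^bsub>Gr M n\<^esub> Diff M (n - 1) ((V (n - 1) ^^ r) b) \<in> Fil n r"
  unfolding Fil_eq set_mult_def by blast

lemma Vr_in_Fil: "x \<in> carrier (Gr M n) \<Longrightarrow> (V n ^^ r) x \<in> Fil n r"
  using FilI[of x n "\<one>\<^bsub>Gr M (n - 1)\<^esub>" r] Diff.hom_one[of "n - 1"] by simp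

lemma dVr_in_Fil: "x \<in> carrier (Gr M n) \<Longrightarrow> Diff M n ((V n ^^ r) x) \<in> Fil (n + 1) r"
  using FilI[of "\<one>\<^bsub>Gr M (n + 1)\<^esub>" "n + 1" x r] Diff.hom_closed[of "(V n ^^ r) x" n] by simp

lemma Fil_Suc_subset: "Fil n (Suc r) \<subseteq> Fil n r"
proof
  fix x assume "x \<in> Fil n (Suc r)"
  then obtain a b where ab: "a \<in> carrier (Gr M n)" "b \<in> carrier (Gr M (n - 1))"
    "x = (V n ^^ Suc r) a \<otimes>\<^bsub>Gr M n\<^esub> Diff M (n - 1) ((V (n - 1) ^^ Suc r) b)" by (rule FilE)
  have "(V n ^^ Suc r) a = (V n ^^ r) (V n a)" "(V (n - 1) ^^ Suc r) b = (V (n - 1) ^^ r) (V (n - 1) b)"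
    by (simp_all add: funpow_swap1)
  then show "x \<in> Fil n r" using FilI[of "V n a" n "V (n - 1) b" r] ab by simp
qed

text \<open>p^r x = V^r (F^r x). Hence additive maps into the complex carry p-adic congruences to
  congruences for the standard filtration, and elements divisible by all powers of p vanish once the
  filtration is separated.\<close>

lemma multiples_subset_Fil: "multiples (p ^ r) (Gr M n) \<subseteq> Fil n r"
proof
  fix x assume "x \<in> multiples (p ^ r) (Gr M n)"
  then obtain y where "y \<in> carrier (Gr M n)" "x = y [^]\<^bsub>Gr M n\<^esub> (p ^ r)" by (auto simp: multiples_def)
  then show "x \<in> Fil n r" using Vr_in_Fil[of "(F n ^^ r) y" n r] Vr_Fr[of y n r] by simp
qed

text \<open>d kills the summand dV^r b and turns V^r a into dV^r a. The second summand of the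
  filtration is what makes it stable under d.\<close>

lemma Diff_Fil: "x \<in> Fil n r \<Longrightarrow> Diff M n x \<in> Fil (n + 1) r"
proof -
  assume "x \<in> Fil n r"
  then obtain a b where ab: "a \<in> carrier (Gr M n)" "b \<in> carrier (Gr M (n - 1))"
    "x = (V n ^^ r) a \<otimes>\<^bsub>Gr M n\<^esub> Diff M (n - 1) ((V (n - 1) ^^ r) b)" by (rule FilE)
  have "Diff M n (Diff M (n - 1) ((V (n - 1) ^^ r) b)) = \<one>\<^bsub>Gr M (n + 1)\<^esub>"
    using Diff_Diff[of "(V (n - 1) ^^ r) b" "n - 1"] ab by (simp add: add.commute)
  moreover have "Diff M (n - 1) ((V (n - 1) ^^ r) b) \<in> carrier (Gr M n)"
    using Diff.hom_closed[of "(V (n - 1) ^^ r) b" "n - 1"] ab by simp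
  ultimately show ?thesis using ab dVr_in_Fil[of a n r] by simp
qed

end

context strict_dieudonne_complex
begin

text \<open>This is the injectivity half of strictness.\<close>

lemma Fil_separated:
  assumes x: "x \<in> carrier (Gr M n)" and all: "\<And>r. x \<in> Fil n r"
  shows "x = \<one>\<^bsub>Gr M n\<^esub>"
proof -
  have "inj_on (to_completion (Gr M n) (Fil n)) (carrier (Gr M n))"
    using strict by (auto simp: iso_def bij_betw_def)
  moreover have "to_completion (Gr M n) (Fil n) x = to_completion (Gr M n) (Fil n) \<one>\<^bsub>Gr M n\<^esub>"
    unfolding to_completion_def
    by (rule ext, rule Gr.rcos_eq_iff[OF Fil_subgroup, THEN iffD2]) (use x all in auto)
  ultimately show ?thesis using x by (auto dest: inj_onD)
qed

lemma Fil_separated_eq: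
  assumes "x \<in> carrier (Gr M n)" "y \<in> carrier (Gr M n)" "\<And>r. x \<otimes>\<^bsub>Gr M n\<^esub> inv\<^bsub>Gr M n\<^esub> y \<in> Fil n r"
  shows "x = y"
proof -
  have "x \<otimes>\<^bsub>Gr M n\<^esub> inv\<^bsub>Gr M n\<^esub> y = \<one>\<^bsub>Gr M n\<^esub>" using assms by (intro Fil_separated) auto
  then show ?thesis using assms by (simp add: Gr.inv_solve_right')
qed

text \<open>This is the surjectivity half of strictness: the cosets of the \<open>s r\<close> form a
  compatible family, and a preimage of that family is the limit.\<close>

lemma Fil_complete:
  assumes s: "\<And>r. s r \<in> carrier (Gr M n)"
    and step: "\<And>r. s (Suc r) \<otimes>\<^bsub>Gr M n\<^esub> inv\<^bsub>Gr M n\<^esub> s r \<in> Fil n r"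
  shows "\<exists>x\<in>carrier (Gr M n). \<forall>r. s r \<otimes>\<^bsub>Gr M n\<^esub> inv\<^bsub>Gr M n\<^esub> x \<in> Fil n r"
proof -
  let ?X = "\<lambda>r. Fil n r #>\<^bsub>Gr M n\<^esub> s r"
  have "?X (Suc r) \<subseteq> ?X r" for r
  proof -
    have "?X (Suc r) \<subseteq> Fil n r #>\<^bsub>Gr M n\<^esub> s (Suc r)"
      using Fil_Suc_subset by (auto simp: r_coset_def)
    also have "\<dots> = ?X r" using s step by (simp add: Gr.rcos_eq_iff Fil_subgroup)
    finally show ?thesis .
  qed
  then have "?X \<in> carrier (completion (Gr M n) (Fil n))"
    using s by (auto simp: completion_def carrier_FactGroup)
  then have "?X \<in> to_completion (Gr M n) (Fil n) ` carrier (Gr M n)"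
    using strict[of n] by (simp add: iso_def bij_betw_def)
  then obtain x where x: "?X = to_completion (Gr M n) (Fil n) x" "x \<in> carrier (Gr M n)"
    by (rule imageE)
  have "s r \<otimes>\<^bsub>Gr M n\<^esub> inv\<^bsub>Gr M n\<^esub> x \<in> Fil n r" for r
    using fun_cong[OF x(1), of r] x(2) s Gr.rcos_eq_iff[OF Fil_subgroup, of "s r" n x r]
    by (simp add: to_completion_def)
  with x(2) show ?thesis by blast
qed

end

section \<open>Products and the filtration; the ring in degree 0\<close>

context cdga
begin

lemma GMult_l_hom: "y \<in> carrier (Gr A n) \<Longrightarrow> group_hom (Gr A m) (Gr A (m + n)) (\<lambda>x. GMult A m n x y)"
  by unfold_locales (auto simp: hom_def GMult_closed GMult_l_distr)

lemma GMult_r_hom: "x \<in> carrier (Gr A m) \<Longrightarrow> group_hom (Gr A n) (Gr A (m + n)) (GMult A m n x)"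
  by unfold_locales (auto simp: hom_def GMult_closed GMult_r_distr)

lemmas GMult_l_zero = group_hom.hom_one[OF GMult_l_hom]
  and GMult_r_zero = group_hom.hom_one[OF GMult_r_hom]
  and GMult_l_inv = group_hom.hom_inv[OF GMult_l_hom]
  and GMult_r_inv = group_hom.hom_inv[OF GMult_r_hom]
  and GMult_l_pow = group_hom.hom_nat_pow[OF GMult_l_hom]
  and GMult_r_pow = group_hom.hom_nat_pow[OF GMult_r_hom]

lemma carrier_deg0 [simp]: "carrier (deg0_ring A) = carrier (Gr A 0)"
  and mult_deg0 [simp]: "mult (deg0_ring A) = GMult A 0 0"
  and one_deg0 [simp]: "one (deg0_ring A) = GOne A"
  and zero_deg0 [simp]: "zero (deg0_ring A) = \<one>\<^bsub>Gr A 0\<^esub>"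
  and add_deg0 [simp]: "add (deg0_ring A) = mult (Gr A 0)"
  by (simp_all add: deg0_ring_def)

lemma add_monoid_deg0 [simp]:
  "\<lparr>carrier = carrier (Gr A 0), monoid.mult = mult (Gr A 0), one = \<one>\<^bsub>Gr A 0\<^esub>\<rparr> = Gr A 0"
  by simp

lemma a_inv_deg0 [simp]: "a_inv (deg0_ring A) = m_inv (Gr A 0)"
  and add_pow_deg0 [simp]: "add_pow (deg0_ring A) (q::nat) x = x [^]\<^bsub>Gr A 0\<^esub> q"
  and minus_deg0 [simp]: "a_minus (deg0_ring A) x y = x \<otimes>\<^bsub>Gr A 0\<^esub> inv\<^bsub>Gr A 0\<^esub> y"
  by (auto simp: a_inv_def add_pow_def a_minus_def)

lemma deg0_cring: "cring (deg0_ring A)"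
proof (rule cringI)
  show "abelian_group (deg0_ring A)"
    by (rule comm_group_abelian_groupI) (simp add: comm_group_Gr)
  show "comm_monoid (deg0_ring A)"
  proof (rule comm_monoidI)
    fix x y assume "x \<in> carrier (deg0_ring A)" "y \<in> carrier (deg0_ring A)"
    then show "x \<otimes>\<^bsub>deg0_ring A\<^esub> y = y \<otimes>\<^bsub>deg0_ring A\<^esub> x"
      using GMult_comm[of x 0 y 0] by (simp add: signed_def)
  qed (use GMult_closed[of _ 0 _ 0] GMult_assoc[of _ 0 _ 0 _ 0] GMult_l_one[of _ 0] GOne_closed in auto)
qed (use GMult_l_distr[of _ 0 _ _ 0] in auto)

end

lemma (in comm_group) signed_closed [simp]: "x \<in> carrier G \<Longrightarrow> signed G k x \<in> carrier G"
  by (simp add: signed_def)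

lemma (in comm_group) subgroup_signed: "\<lbrakk>subgroup N G; x \<in> N\<rbrakk> \<Longrightarrow> signed G k x \<in> N"
  by (simp add: signed_def subgroup.m_inv_closed)

lemma graded_ring_homD:
  assumes "g \<in> graded_ring_hom A B"
  shows "g n \<in> hom (Gr A n) (Gr B n)"
    and "x \<in> carrier (Gr A n) \<Longrightarrow> g n x \<in> carrier (Gr B n)"
    and "\<lbrakk>x \<in> carrier (Gr A n); y \<in> carrier (Gr A n)\<rbrakk> \<Longrightarrow>
      g n (x \<otimes>\<^bsub>Gr A n\<^esub> y) = g n x \<otimes>\<^bsub>Gr B n\<^esub> g n y"
    and "\<lbrakk>x \<in> carrier (Gr A m); y \<in> carrier (Gr A n)\<rbrakk> \<Longrightarrow>
      g (m + n) (GMult A m n x y) = GMult B m n (g m x) (g n y)"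
    and "g 0 (GOne A) = GOne B"
  using assms by (auto simp: graded_ring_hom_def hom_def Pi_def)

context strict_dieudonne_algebra
begin

lemma F_mult: "\<lbrakk>x \<in> carrier (Gr A m); y \<in> carrier (Gr A n)\<rbrakk> \<Longrightarrow>
    F (m + n) (GMult A m n x y) = GMult A m n (F m x) (F n y)"
  using graded_ring_homD(4)[OF F_ring_hom] .

lemma V_mult:
  assumes x: "x \<in> carrier (Gr A m)" and y: "y \<in> carrier (Gr A n)"
  shows "GMult A m n (V m x) y = V (m + n) (GMult A m n x (F n y))"
  by (rule F_eqD[of _ "m + n"])
    (use x y in \<open>simp_all add: GMult_closed F_mult F_V GMult_l_pow\<close>)

lemma Vr_mult:
  assumes "x \<in> carrier (Gr A m)" and "y \<in> carrier (Gr A n)"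
  shows "GMult A m n ((V m ^^ r) x) y = (V (m + n) ^^ r) (GMult A m n x ((F n ^^ r) y))"
  using assms
proof (induction r arbitrary: y)
  case (Suc r)
  then have "GMult A m n ((V m ^^ Suc r) x) y = (V (m + n) ^^ Suc r) (GMult A m n x ((F n ^^ r) (F n y)))"
    by (simp add: V_mult)
  then show ?case by (simp add: funpow_swap1)
qed simp

text \<open>The summand V^r a is handled by the projection formula. For the other, Leibniz writes
  d(V^r b) y as d(V^r b y) up to a signed term V^r b dy, and the projection formula applies to both
  products.\<close>

lemma Fil_ideal_r:
  assumes z: "z \<in> Fil m r" and y: "y \<in> carrier (Gr A n)"
  shows "GMult A m n z y \<in> Fil (m + n) r"
proof -
  obtain a b where a: "a \<in> carrier (Gr A m)" and b: "b \<in> carrier (Gr A (m - 1))"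
    and z: "z = (V m ^^ r) a \<otimes>\<^bsub>Gr A m\<^esub> Diff A (m - 1) ((V (m - 1) ^^ r) b)" using z by (rule FilE)
  have 1: "GMult A m n ((V m ^^ r) a) y \<in> Fil (m + n) r"
    using a y by (simp add: Vr_mult Vr_in_Fil GMult_closed)
  let ?c = "(V (m - 1) ^^ r) b"
  have c: "?c \<in> carrier (Gr A (m - 1))" using b by simp
  have e: "m - 1 + n + 1 = m + n" "m - 1 + (n + 1) = m + n" "m - 1 + 1 = m" by simp_all
  have dc: "Diff A (m - 1) ?c \<in> carrier (Gr A m)" using Diff.hom_closed[OF c] by (simp only: e)
  have dy: "Diff A n y \<in> carrier (Gr A (n + 1))" using y by simp
  have L: "Diff A (m - 1 + n) (GMult A (m - 1) n ?c y) = GMult A m n (Diff A (m - 1) ?c) y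
      \<otimes>\<^bsub>Gr A (m + n)\<^esub> signed (Gr A (m + n)) (m - 1) (GMult A (m - 1) (n + 1) ?c (Diff A n y))"
    using Leibniz[OF c y] by (simp only: e)
  have l: "Diff A (m - 1 + n) (GMult A (m - 1) n ?c y) \<in> Fil (m + n) r"
    using dVr_in_Fil[of "GMult A (m - 1) n b ((F n ^^ r) y)" "m - 1 + n" r] b y
    by (simp only: e Vr_mult[OF b y] GMult_closed Fr_closed)
  have "GMult A (m - 1) (n + 1) ?c (Diff A n y) \<in> Fil (m - 1 + (n + 1)) r"
    using b dy by (simp only: Vr_mult Vr_in_Fil GMult_closed Fr_closed)
  then have s: "signed (Gr A (m + n)) (m - 1) (GMult A (m - 1) (n + 1) ?c (Diff A n y)) \<in> Fil (m + n) r"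
    unfolding e by (rule Gr.subgroup_signed[OF Fil_subgroup])
  have "GMult A m n (Diff A (m - 1) ?c) y = Diff A (m - 1 + n) (GMult A (m - 1) n ?c y) \<otimes>\<^bsub>Gr A (m + n)\<^esub>
      inv\<^bsub>Gr A (m + n)\<^esub> signed (Gr A (m + n)) (m - 1) (GMult A (m - 1) (n + 1) ?c (Diff A n y))"
    using GMult_closed[OF dc y] Fil_carrier[OF s] by (simp add: L Gr.m_assoc)
  then have "GMult A m n (Diff A (m - 1) ?c) y \<in> Fil (m + n) r"
    using l s by (simp add: Fil_mult Fil_inv)
  then show ?thesis using 1 a dc y unfolding z by (simp add: GMult_l_distr Fil_mult)
qed

lemma Fil_ideal_l:
  assumes "z \<in> Fil n r" and "y \<in> carrier (Gr A m)"
  shows "GMult A m n y z \<in> Fil (m + n) r"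
  using Fil_ideal_r[OF assms] GMult_comm[OF assms(2) Fil_carrier[OF assms(1)]]
  by (simp add: Gr.subgroup_signed Fil_subgroup add.commute)

text \<open>The part of degree -1 is trivial, so there is no contribution from dV^r.\<close>

lemma Fil_0: "Fil 0 r = (V 0 ^^ r) ` carrier (Gr A 0)"
proof
  show "(V 0 ^^ r) ` carrier (Gr A 0) \<subseteq> Fil 0 r" using Vr_in_Fil[of _ 0 r] by auto
  show "Fil 0 r \<subseteq> (V 0 ^^ r) ` carrier (Gr A 0)"
  proof
    fix x assume "x \<in> Fil 0 r"
    then obtain a b where ab: "a \<in> carrier (Gr A 0)" "b \<in> carrier (Gr A (0 - 1))"
      "x = (V 0 ^^ r) a \<otimes>\<^bsub>Gr A 0\<^esub> Diff A (0 - 1) ((V (0 - 1) ^^ r) b)" by (rule FilE)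
    then have "b = \<one>\<^bsub>Gr A (- 1)\<^esub>" using nonneg[of "-1"] by auto
    then have "x = (V 0 ^^ r) a" using ab Diff.hom_one[of "- 1"] by simp
    then show "x \<in> (V 0 ^^ r) ` carrier (Gr A 0)" using ab by simp
  qed
qed

lemma deg0_verschiebung_ring: "verschiebung_ring (deg0_ring A) p (F 0) (V 0)"
proof (intro verschiebung_ring.intro verschiebung_ring_axioms.intro deg0_cring prime_p)
  show "F 0 \<in> ring_hom (deg0_ring A) (deg0_ring A)"
    using F_mult[of _ 0 _ 0] graded_ring_homD(5)[OF F_ring_hom] by (intro ring_hom_memI) auto
  show "inj_on (F 0) (carrier (deg0_ring A))"
    using F_bij[of 0] by (simp add: bij_betw_def)
  show "F 0 x \<ominus>\<^bsub>deg0_ring A\<^esub> (x [^]\<^bsub>deg0_ring A\<^esub> p) \<in> multiples p (add_monoid (deg0_ring A))"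
    if "x \<in> carrier (deg0_ring A)" for x
    using F_lifts_power[of x] that by simp
  show "x = \<zero>\<^bsub>deg0_ring A\<^esub>"
    if "x \<in> carrier (deg0_ring A)" "\<And>r. x \<in> (V 0 ^^ r) ` carrier (deg0_ring A)" for x
    using Fil_separated[of x 0] that by (simp add: Fil_0)
  show "\<exists>x\<in>carrier (deg0_ring A). \<forall>r. s r \<ominus>\<^bsub>deg0_ring A\<^esub> x \<in> (V 0 ^^ r) ` carrier (deg0_ring A)"
    if "\<And>r. s r \<in> carrier (deg0_ring A)"
      "\<And>r. s (Suc r) \<ominus>\<^bsub>deg0_ring A\<^esub> s r \<in> (V 0 ^^ r) ` carrier (deg0_ring A)" for s
    using Fil_complete[of s 0] that by (simp add: Fil_0)
qed (auto simp: F_V)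

end

section \<open>Maps out of the de Rham complex\<close>

lemma (in comm_group) rcos_sum':
  "\<lbrakk>subgroup N G; x \<in> carrier G; y \<in> carrier G\<rbrakk> \<Longrightarrow> (N #> x) <#> (N #> y) = N #> (x \<otimes> y)"
  using normal.rcos_sum[OF subgroup_imp_normal] by blast

lemma (in comm_group) rcos_mult_cong:
  assumes "subgroup N G" "n \<in> N" "x \<in> carrier G"
  shows "N #> (n \<otimes> x) = N #> x"
  using coset_mult_assoc[of N n x] subgroup.rcos_const[OF assms(1) is_group assms(2)] assms
    subgroup.subset[OF assms(1)] by auto

text \<open>Operations on quotients and completions are encoded as unions of cosets over all
  representatives. Such a union collapses to the coset of the image of any one
  representative.\<close>

lemma coset_map:
  assumes G: "comm_group G" "subgroup N G" and H: "comm_group H" "subgroup N' H"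
    and f: "f \<in> hom G H" "\<And>n. n \<in> N \<Longrightarrow> f n \<in> N'" and x: "x \<in> carrier G"
  shows "(\<Union>v\<in>N #>\<^bsub>G\<^esub> x. N' #>\<^bsub>H\<^esub> f v) = N' #>\<^bsub>H\<^esub> f x"
proof -
  interpret G: comm_group G by (rule G)
  interpret H: comm_group H by (rule H)
  have "N' #>\<^bsub>H\<^esub> f v = N' #>\<^bsub>H\<^esub> f x" if "v \<in> N #>\<^bsub>G\<^esub> x" for v
  proof -
    obtain n where n: "n \<in> N" "v = n \<otimes>\<^bsub>G\<^esub> x" using \<open>v \<in> N #>\<^bsub>G\<^esub> x\<close> by (auto simp: r_coset_def)
    then have "f v = f n \<otimes>\<^bsub>H\<^esub> f x"
      using f x subgroup.mem_carrier[OF G(2)] by (simp add: hom_mult)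
    then show ?thesis
      using H.rcos_mult_cong[OF H(2) f(2)[OF n(1)], of "f x"] f x by (simp add: hom_in_carrier)
  qed
  then have "(\<Union>v\<in>N #>\<^bsub>G\<^esub> x. N' #>\<^bsub>H\<^esub> f v) = (\<Union>v\<in>N #>\<^bsub>G\<^esub> x. N' #>\<^bsub>H\<^esub> f x)"
    by (rule SUP_cong[OF refl])
  also have "\<dots> = N' #>\<^bsub>H\<^esub> f x" using G.rcos_self[OF x G(2)] by blast
  finally show ?thesis .
qed

lemma coset_map2:
  assumes G: "comm_group G" "subgroup N G" and K: "comm_group K" "subgroup L K"
    and H: "comm_group H" "subgroup N' H"
    and f: "\<And>y. y \<in> carrier K \<Longrightarrow> (\<lambda>x. f x y) \<in> hom G H" "\<And>x. x \<in> carrier G \<Longrightarrow> f x \<in> hom K H"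
      "\<And>n y. \<lbrakk>n \<in> N; y \<in> carrier K\<rbrakk> \<Longrightarrow> f n y \<in> N'" "\<And>x l. \<lbrakk>x \<in> carrier G; l \<in> L\<rbrakk> \<Longrightarrow> f x l \<in> N'"
    and x: "x \<in> carrier G" and y: "y \<in> carrier K"
  shows "(\<Union>v\<in>N #>\<^bsub>G\<^esub> x. \<Union>w\<in>L #>\<^bsub>K\<^esub> y. N' #>\<^bsub>H\<^esub> f v w) = N' #>\<^bsub>H\<^esub> f x y"
proof -
  interpret G: comm_group G by (rule G)
  have "(\<Union>w\<in>L #>\<^bsub>K\<^esub> y. N' #>\<^bsub>H\<^esub> f v w) = N' #>\<^bsub>H\<^esub> f v y" if "v \<in> N #>\<^bsub>G\<^esub> x" for v
  proof (rule coset_map[OF K H])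
    have "v \<in> carrier G" using that subgroup.elemrcos_carrier[OF G(2) G.is_group x] by blast
    then show "f v \<in> hom K H" "\<And>n. n \<in> L \<Longrightarrow> f v n \<in> N'" using f by auto
  qed (rule y)
  then have "(\<Union>v\<in>N #>\<^bsub>G\<^esub> x. \<Union>w\<in>L #>\<^bsub>K\<^esub> y. N' #>\<^bsub>H\<^esub> f v w) = (\<Union>v\<in>N #>\<^bsub>G\<^esub> x. N' #>\<^bsub>H\<^esub> f v y)" by simp
  also have "\<dots> = N' #>\<^bsub>H\<^esub> f x y"
    using coset_map[OF G H f(1)[OF y]] f(3) x y by blast
  finally show ?thesis .
qed

lemma hom_generate_subset:
  assumes G: "group G" and H: "group H" and f: "f \<in> hom G H" and X: "X \<subseteq> carrier G"
    and N: "subgroup N H" and fX: "\<And>x. x \<in> X \<Longrightarrow> f x \<in> N" and x: "x \<in> generate G X"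
  shows "f x \<in> N"
proof -
  interpret group_hom G H f by (intro group_hom.intro G H group_hom_axioms.intro f)
  show ?thesis using x
  proof (induction x rule: generate.induct)
    case (eng a b)
    then show ?case using G.generate_in_carrier[OF X] subgroup.m_closed[OF N] by simp
  next
    case (inv a)
    then show ?case using X fX subgroup.m_inv_closed[OF N, of "f a"] by (auto simp: subset_iff)
  qed (use fX N in \<open>auto intro: subgroup.one_closed\<close>)
qed

lemma frag_extend_fun_add: "frag_extend (\<lambda>x. f x + g x) c = frag_extend f c + frag_extend g c"
  by (simp add: frag_extend_def frag_cmul_distrib2 sum.distrib)

lemma derham_mult_add_left: "derham_mult S (v + v') w = derham_mult S v w + derham_mult S v' w"
  by (simp add: derham_mult_def frag_extend_add)

lemma derham_mult_add_right: "derham_mult S v (w + w') = derham_mult S v w + derham_mult S v w'"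
  by (simp add: derham_mult_def frag_extend_add case_prod_unfold flip: frag_extend_fun_add)

lemma derham_mult_diff_left: "derham_mult S (v - v') w = derham_mult S v w - derham_mult S v' w"
  by (simp add: derham_mult_def frag_extend_diff)

lemma derham_mult_diff_right: "derham_mult S v (w - w') = derham_mult S v w - derham_mult S v w'"
  using derham_mult_add_right[of S v "w - w'" w'] by simp

lemma derham_mult_zero [simp]: "derham_mult S 0 w = 0" "derham_mult S v 0 = 0"
  using derham_mult_add_right[of S v 0 0] by (simp_all add: derham_mult_def)

lemma derham_mult_of [simp]:
  "derham_mult S (frag_of (a, bs)) (frag_of (c, ds)) = frag_of (a \<otimes>\<^bsub>S\<^esub> c, bs @ ds)"
  by (simp add: derham_mult_def)

lemma derham_diff_of [simp]: "derham_diff S (frag_of (a, bs)) = frag_of (\<one>\<^bsub>S\<^esub>, a # bs)"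
  by (simp add: derham_diff_def)

lemma derham_diff_add: "derham_diff S (v + w) = derham_diff S v + derham_diff S w"
  and derham_diff_diff: "derham_diff S (v - w) = derham_diff S v - derham_diff S w"
  by (simp_all add: derham_diff_def frag_extend_add frag_extend_diff)

lemmas frag_gens_induct = free_Abelian_group_induct[consumes 1, case_names zero diff frag]

abbreviation derham_free :: "('a, 'm) ring_scheme \<Rightarrow> int \<Rightarrow> (('a \<times> 'a list) \<Rightarrow>\<^sub>0 int) monoid" where
  "derham_free S n \<equiv> free_Abelian_group (derham_gens S n)"

lemma keys_frag_of_diff3:
  "\<lbrakk>x \<in> G; y \<in> G; z \<in> G\<rbrakk> \<Longrightarrow> Poly_Mapping.keys (frag_of x - frag_of y - frag_of z) \<subseteq> G"
  using keys_diff[of "frag_of x - frag_of y" "frag_of z"] keys_diff[of "frag_of x" "frag_of y"]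
  by (auto simp: keys_frag_of)

section \<open>The de Rham complex by generators and relations: differential, product and generation
  by one-forms\<close>

locale derham_ring = cring S for S :: "('a, 'm) ring_scheme" (structure)
begin

abbreviation gens where "gens \<equiv> derham_gens S"
abbreviation null where "null \<equiv> derham_null S"
abbreviation rels where "rels \<equiv> derham_rels S"

lemma gens_iff: "(a, bs) \<in> gens n \<longleftrightarrow> a \<in> carrier S \<and> set bs \<subseteq> carrier S \<and> int (length bs) = n"
  by (simp add: derham_gens_def)

lemma rels_carrier: "rels n \<subseteq> carrier (derham_free S n)"
proof
  fix x assume "x \<in> rels n"
  then show "x \<in> carrier (derham_free S n)"
    by cases (simp_all add: gens_iff keys_frag_of keys_frag_of_diff3)
qed

lemma null_subgroup: "subgroup (null n) (derham_free S n)"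
  unfolding derham_null_def by (rule group.generate_is_subgroup[OF _ rels_carrier]) simp

lemma null_carrier: "v \<in> null n \<Longrightarrow> Poly_Mapping.keys v \<subseteq> gens n"
  using subgroup.mem_carrier[OF null_subgroup] by fastforce

lemma null_zero: "0 \<in> null n"
  using subgroup.one_closed[OF null_subgroup[of n]] by simp

lemma null_add: "\<lbrakk>v \<in> null n; w \<in> null n\<rbrakk> \<Longrightarrow> v + w \<in> null n"
  using subgroup.m_closed[OF null_subgroup[of n]] by fastforce

lemma null_minus: "v \<in> null n \<Longrightarrow> - v \<in> null n"
  using subgroup.m_inv_closed[OF null_subgroup[of n]] null_carrier by fastforce

lemma null_diff: "\<lbrakk>v \<in> null n; w \<in> null n\<rbrakk> \<Longrightarrow> v - w \<in> null n"
  using null_add[of v n "- w"] null_minus by simp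

lemma rels_null: "v \<in> rels n \<Longrightarrow> v \<in> null n"
  unfolding derham_null_def by (rule generate.incl)

lemma null_hom:
  assumes "f \<in> hom (derham_free S n) H" "group H" "subgroup N H" "\<And>v. v \<in> rels n \<Longrightarrow> f v \<in> N"
    and "v \<in> null n"
  shows "f v \<in> N"
  using hom_generate_subset[OF group_free_Abelian_group assms(2,1) rels_carrier assms(3,4)] assms(5)
  by (simp add: derham_null_def)

text \<open>Polarisation: expand d(b + b') d(b + b') = 0 in both slots and discard the two
  squares.\<close>

lemma null_swap_adjacent:
  assumes "a \<in> carrier S" "set us \<subseteq> carrier S" "b \<in> carrier S" "b' \<in> carrier S" "set vs \<subseteq> carrier S"
    "int (length (us @ [b, b'] @ vs)) = n"
  shows "frag_of (a, us @ [b, b'] @ vs) + frag_of (a, us @ [b', b] @ vs) \<in> null n"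
proof -
  let ?s = "b \<oplus> b'"
  let ?f = "\<lambda>x y. frag_of (a, us @ [x, y] @ vs)"
  have alt: "?f x x \<in> null n" if "x \<in> carrier S" for x
    using derham_rels.alternating[of a us x vs S n] that assms by (intro rels_null) (auto simp: gens_iff)
  have l: "?f ?s y - ?f b y - ?f b' y \<in> null n" if "y \<in> carrier S" for y
    using derham_rels.d_add[of a us b "y # vs" S n b'] that assms by (intro rels_null) (auto simp: gens_iff)
  have r: "?f x ?s - ?f x b - ?f x b' \<in> null n" if "x \<in> carrier S" for x
    using derham_rels.d_add[of a "us @ [x]" b vs S n b'] that assms by (intro rels_null) (auto simp: gens_iff)
  have "?f b b' + ?f b' b = ?f ?s ?s - (?f ?s ?s - ?f b ?s - ?f b' ?s) - (?f b ?s - ?f b b - ?f b b')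
      - (?f b' ?s - ?f b' b - ?f b' b') - ?f b b - ?f b' b'"
    by (simp add: algebra_simps)
  also have "\<dots> \<in> null n" using assms(3,4) by (intro null_diff alt l r) auto
  finally show ?thesis .
qed

lemma null_swap:
  assumes "a \<in> carrier S" "set pre \<subseteq> carrier S" "set us \<subseteq> carrier S" "b \<in> carrier S" "b' \<in> carrier S"
    "set vs \<subseteq> carrier S" "int (length (pre @ [b] @ us @ [b'] @ vs)) = n"
  shows "frag_of (a, pre @ [b] @ us @ [b'] @ vs) + frag_of (a, pre @ [b'] @ us @ [b] @ vs) \<in> null n"
  using assms
proof (induction us arbitrary: pre)
  case Nil
  then show ?case using null_swap_adjacent[of a pre b b' vs n] by auto
next
  case (Cons u us)
  let ?f = "\<lambda>xs. frag_of (a, pre @ xs @ vs)"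
  \<comment> \<open>The exchange of b and b' across u is a product of three exchanges: b with u, b
    with b' across the shorter list, and u with b'. Three sign changes amount to one.\<close>
  have 1: "?f ([b, u] @ us @ [b']) + ?f ([u, b] @ us @ [b']) \<in> null n"
    using null_swap_adjacent[of a pre b u "us @ [b'] @ vs" n] Cons.prems by auto
  have 2: "?f ([u, b] @ us @ [b']) + ?f ([u, b'] @ us @ [b]) \<in> null n"
    using Cons.IH[of "pre @ [u]"] Cons.prems by auto
  have 3: "?f ([u, b'] @ us @ [b]) + ?f ([b', u] @ us @ [b]) \<in> null n"
    using null_swap_adjacent[of a pre u b' "us @ [b] @ vs" n] Cons.prems by auto
  have "?f ([b, u] @ us @ [b']) + ?f ([b', u] @ us @ [b]) =
      (?f ([b, u] @ us @ [b']) + ?f ([u, b] @ us @ [b'])) -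
      (?f ([u, b] @ us @ [b']) + ?f ([u, b'] @ us @ [b])) +
      (?f ([u, b'] @ us @ [b]) + ?f ([b', u] @ us @ [b]))" by simp
  also have "\<dots> \<in> null n" by (intro null_add null_diff 1 2 3)
  finally show ?case by simp
qed

lemma derham_diff_closed: "Poly_Mapping.keys v \<subseteq> gens n \<Longrightarrow> Poly_Mapping.keys (derham_diff S v) \<subseteq> gens (n + 1)"
  unfolding derham_diff_def
  by (rule order.trans[OF keys_frag_extend]) (auto simp: gens_iff keys_frag_of)

lemma derham_diff_hom: "derham_diff S \<in> hom (derham_free S n) (derham_free S (n + 1))"
  by (rule homI) (auto simp: derham_diff_add dest: derham_diff_closed[THEN subsetD])

text \<open>d turns the coefficient into a new first differential. A relation between coefficients
  thus becomes additivity in the first slot, and the relations in the later slots keep their shape,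
  except for the product rule.\<close>

lemma derham_diff_rels:
  assumes "v \<in> rels n" shows "derham_diff S v \<in> null (n + 1)"
  using assms
proof cases
  case (coeff_add a bs a')
  then have "frag_of (\<one>, [] @ [a \<oplus> a'] @ bs) - frag_of (\<one>, [] @ [a] @ bs) - frag_of (\<one>, [] @ [a'] @ bs) \<in> rels (n + 1)"
    by (intro derham_rels.d_add) (auto simp: gens_iff)
  then show ?thesis using coeff_add rels_null by (simp add: derham_diff_diff)
next
  case (d_add a us b vs b')
  then have "frag_of (\<one>, (a # us) @ [b \<oplus> b'] @ vs) - frag_of (\<one>, (a # us) @ [b] @ vs)
      - frag_of (\<one>, (a # us) @ [b'] @ vs) \<in> rels (n + 1)"
    by (intro derham_rels.d_add) (auto simp: gens_iff)
  then show ?thesis using d_add rels_null by (simp add: derham_diff_diff)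
next
  \<comment> \<open>\<open>d (bb') = b db' + b' db\<close> is preserved by \<open>d\<close> because \<open>db db' + db' db = 0\<close>\<close>
  case (d_mult a us b vs b')
  let ?f = "\<lambda>c xs. frag_of (c, xs @ vs)"
  note g = d_mult(2,3)[unfolded gens_iff, simplified]
  have 1: "?f \<one> ((a # us) @ [b \<otimes> b']) - ?f b ((a # us) @ [b']) - ?f b' ((a # us) @ [b]) \<in> null (n + 1)"
    using derham_rels.d_mult[of \<one> "a # us" b vs S "n + 1" b'] g by (intro rels_null) (auto simp: gens_iff)
  have 2: "?f \<one> ([a \<otimes> c] @ us @ [c']) - ?f a ([c] @ us @ [c']) - ?f c ([a] @ us @ [c']) \<in> null (n + 1)"
    if "c \<in> carrier S" "c' \<in> carrier S" for c c'
    using derham_rels.d_mult[of \<one> "[]" a "us @ [c'] @ vs" S "n + 1" c] g that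
    by (intro rels_null) (auto simp: gens_iff)
  have 3: "?f a ([b] @ us @ [b']) + ?f a ([b'] @ us @ [b]) \<in> null (n + 1)"
    using null_swap[of a "[]" us b b' vs "n + 1"] g by auto
  have "derham_diff S v = (?f \<one> ((a # us) @ [b \<otimes> b']) - ?f b ((a # us) @ [b']) - ?f b' ((a # us) @ [b]))
     - (?f \<one> ([a \<otimes> b] @ us @ [b']) - ?f a ([b] @ us @ [b']) - ?f b ([a] @ us @ [b']))
     - (?f \<one> ([a \<otimes> b'] @ us @ [b]) - ?f a ([b'] @ us @ [b]) - ?f b' ([a] @ us @ [b]))
     - (?f a ([b] @ us @ [b']) + ?f a ([b'] @ us @ [b]))"
    unfolding d_mult(1) by (simp add: derham_diff_diff)
  also have "\<dots> \<in> null (n + 1)" using g by (intro null_diff 1 2 3) auto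
  finally show ?thesis .
next
  case (alternating a us b vs)
  then have "frag_of (\<one>, (a # us) @ [b, b] @ vs) \<in> rels (n + 1)"
    by (intro derham_rels.alternating) (auto simp: gens_iff)
  then show ?thesis using alternating rels_null by simp
qed

lemma derham_diff_null: "v \<in> null n \<Longrightarrow> derham_diff S v \<in> null (n + 1)"
  using null_hom[OF derham_diff_hom group_free_Abelian_group null_subgroup] derham_diff_rels by blast

lemma derham_mult_closed:
  assumes "Poly_Mapping.keys v \<subseteq> gens m" "Poly_Mapping.keys w \<subseteq> gens n"
  shows "Poly_Mapping.keys (derham_mult S v w) \<subseteq> gens (m + n)"
  using assms(1)
proof (induction v rule: frag_gens_induct)
  case (frag x)
  obtain a bs where x: "x = (a, bs)" by fastforce
  show ?case using assms(2)
  proof (induction w rule: frag_gens_induct)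
    case (frag y)
    then show ?case using \<open>x \<in> gens m\<close> by (cases y) (auto simp: x gens_iff keys_frag_of)
  next
    case (diff u w)
    then show ?case unfolding derham_mult_diff_right by (meson Un_least keys_diff order.trans)
  qed simp
next
  case (diff u w)
  then show ?case unfolding derham_mult_diff_left by (meson Un_least keys_diff order.trans)
qed simp

lemma derham_mult_l_hom:
  "w \<in> carrier (derham_free S n) \<Longrightarrow> (\<lambda>v. derham_mult S v w) \<in> hom (derham_free S m) (derham_free S (m + n))"
  by (rule homI) (auto simp: derham_mult_add_left dest: derham_mult_closed[THEN subsetD])

lemma derham_mult_r_hom:
  "v \<in> carrier (derham_free S m) \<Longrightarrow> derham_mult S v \<in> hom (derham_free S n) (derham_free S (m + n))"
  by (rule homI) (auto simp: derham_mult_add_right dest: derham_mult_closed[THEN subsetD])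

lemma derham_mult_rels_left:
  assumes "v \<in> rels m" "(c, ds) \<in> gens n" shows "derham_mult S v (frag_of (c, ds)) \<in> null (m + n)"
proof -
  have c: "c \<in> carrier S" "set ds \<subseteq> carrier S" "int (length ds) = n" using assms(2) by (auto simp: gens_iff)
  from assms(1) show ?thesis
  proof cases
    case (coeff_add a bs a')
    then have "frag_of (a \<otimes> c \<oplus> a' \<otimes> c, bs @ ds) - frag_of (a \<otimes> c, bs @ ds) - frag_of (a' \<otimes> c, bs @ ds) \<in> rels (m + n)"
      using c by (intro derham_rels.coeff_add) (auto simp: gens_iff)
    then show ?thesis using coeff_add rels_null c by (simp add: derham_mult_diff_left gens_iff l_distr)
  next
    case (d_add a us b vs b')
    then have "frag_of (a \<otimes> c, us @ [b \<oplus> b'] @ vs @ ds) - frag_of (a \<otimes> c, us @ [b] @ vs @ ds)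
        - frag_of (a \<otimes> c, us @ [b'] @ vs @ ds) \<in> rels (m + n)"
      using c by (intro derham_rels.d_add) (auto simp: gens_iff)
    then show ?thesis using d_add rels_null by (simp add: derham_mult_diff_left)
  next
    case (d_mult a us b vs b')
    then have "frag_of (a \<otimes> c, us @ [b \<otimes> b'] @ vs @ ds) - frag_of (a \<otimes> c \<otimes> b, us @ [b'] @ vs @ ds)
        - frag_of (a \<otimes> c \<otimes> b', us @ [b] @ vs @ ds) \<in> rels (m + n)"
      using c by (intro derham_rels.d_mult) (auto simp: gens_iff)
    then show ?thesis using d_mult rels_null c by (simp add: derham_mult_diff_left gens_iff m_ac)
  next
    case (alternating a us b vs)
    then have "frag_of (a \<otimes> c, us @ [b, b] @ vs @ ds) \<in> rels (m + n)"
      using c by (intro derham_rels.alternating) (auto simp: gens_iff)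
    then show ?thesis using alternating rels_null by simp
  qed
qed

lemma derham_mult_rels_right:
  assumes "v \<in> rels n" "(c, ds) \<in> gens m" shows "derham_mult S (frag_of (c, ds)) v \<in> null (m + n)"
proof -
  have c: "c \<in> carrier S" "set ds \<subseteq> carrier S" "int (length ds) = m" using assms(2) by (auto simp: gens_iff)
  from assms(1) show ?thesis
  proof cases
    case (coeff_add a bs a')
    then have "frag_of (c \<otimes> a \<oplus> c \<otimes> a', ds @ bs) - frag_of (c \<otimes> a, ds @ bs) - frag_of (c \<otimes> a', ds @ bs) \<in> rels (m + n)"
      using c by (intro derham_rels.coeff_add) (auto simp: gens_iff)
    then show ?thesis using coeff_add rels_null c by (simp add: derham_mult_diff_right gens_iff r_distr)
  next
    case (d_add a us b vs b')
    then have "frag_of (c \<otimes> a, (ds @ us) @ [b \<oplus> b'] @ vs) - frag_of (c \<otimes> a, (ds @ us) @ [b] @ vs)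
        - frag_of (c \<otimes> a, (ds @ us) @ [b'] @ vs) \<in> rels (m + n)"
      using c by (intro derham_rels.d_add) (auto simp: gens_iff)
    then show ?thesis using d_add rels_null by (simp add: derham_mult_diff_right)
  next
    case (d_mult a us b vs b')
    then have "frag_of (c \<otimes> a, (ds @ us) @ [b \<otimes> b'] @ vs) - frag_of (c \<otimes> a \<otimes> b, (ds @ us) @ [b'] @ vs)
        - frag_of (c \<otimes> a \<otimes> b', (ds @ us) @ [b] @ vs) \<in> rels (m + n)"
      using c by (intro derham_rels.d_mult) (auto simp: gens_iff)
    then show ?thesis using d_mult rels_null c by (simp add: derham_mult_diff_right gens_iff m_assoc)
  next
    case (alternating a us b vs)
    then have "frag_of (c \<otimes> a, (ds @ us) @ [b, b] @ vs) \<in> rels (m + n)"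
      using c by (intro derham_rels.alternating) (auto simp: gens_iff)
    then show ?thesis using alternating rels_null by simp
  qed
qed

lemma derham_mult_null_left:
  assumes v: "v \<in> null m" and w: "Poly_Mapping.keys w \<subseteq> gens n"
  shows "derham_mult S v w \<in> null (m + n)"
  using w
proof (induction w rule: frag_gens_induct)
  case (frag y)
  obtain c ds where y: "y = (c, ds)" by fastforce
  have "(\<lambda>v. derham_mult S v (frag_of y)) v \<in> null (m + n)"
    using frag by (intro null_hom[OF derham_mult_l_hom _ null_subgroup _ v, of "frag_of y" n])
      (auto simp: y intro: derham_mult_rels_left)
  then show ?case .
qed (auto simp: derham_mult_diff_right null_zero null_diff)

lemma derham_mult_null_right:
  assumes v: "v \<in> null n" and w: "Poly_Mapping.keys w \<subseteq> gens m"
  shows "derham_mult S w v \<in> null (m + n)"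
  using w
proof (induction w rule: frag_gens_induct)
  case (frag y)
  obtain c ds where y: "y = (c, ds)" by fastforce
  show ?case
    using frag by (intro null_hom[OF derham_mult_r_hom _ null_subgroup _ v, of "frag_of y" m])
      (auto simp: y intro: derham_mult_rels_right)
qed (auto simp: derham_mult_diff_left null_zero null_diff)

abbreviation cls where "cls \<equiv> derham_class S"

lemma Gr_derham: "Gr (derham S) n = derham_free S n Mod null n"
  by (simp add: derham_def)

lemma Gr_derham_group: "comm_group (Gr (derham S) n)"
  unfolding Gr_derham
  by (rule comm_group.abelian_FactGroup[OF abelian_free_Abelian_group null_subgroup])

lemma carrier_Gr_derham: "carrier (Gr (derham S) n) = cls n ` carrier (derham_free S n)"
  by (simp add: Gr_derham carrier_FactGroup derham_class_def)

lemma cls_hom: "cls n \<in> hom (derham_free S n) (Gr (derham S) n)"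
  unfolding Gr_derham derham_class_def
  by (rule normal.r_coset_hom_Mod, rule comm_group.subgroup_imp_normal)
    (rule abelian_free_Abelian_group, rule null_subgroup)

lemma Diff_cls: "v \<in> carrier (derham_free S n) \<Longrightarrow> Diff (derham S) n (cls n v) = cls (n + 1) (derham_diff S v)"
  using coset_map[OF abelian_free_Abelian_group null_subgroup abelian_free_Abelian_group null_subgroup
    derham_diff_hom derham_diff_null]
  by (simp add: derham_def derham_class_def)

lemma GMult_cls:
  "\<lbrakk>v \<in> carrier (derham_free S m); w \<in> carrier (derham_free S n)\<rbrakk> \<Longrightarrow>
    GMult (derham S) m n (cls m v) (cls n w) = cls (m + n) (derham_mult S v w)"
  using coset_map2[OF abelian_free_Abelian_group null_subgroup abelian_free_Abelian_group null_subgroup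
    abelian_free_Abelian_group null_subgroup derham_mult_l_hom derham_mult_r_hom
    derham_mult_null_left derham_mult_null_right]
  by (simp add: derham_def derham_class_def)

lemma GOne_cls: "GOne (derham S) = cls 0 (frag_of (\<one>, []))"
  by (simp add: derham_def)

end

lemma graded_ring_hom_deg0:
  "\<lbrakk>g \<in> graded_ring_hom A B; x \<in> carrier (Gr A 0); y \<in> carrier (Gr A n)\<rbrakk> \<Longrightarrow>
    g n (GMult A 0 n x y) = GMult B 0 n (g 0 x) (g n y)"
  using graded_ring_homD(4)[of g A B x 0 y n] by simp

lemma hom_free_Abelian_group_diff:
  assumes f: "f \<in> hom (free_Abelian_group X) H" and H: "group H"
    and u: "Poly_Mapping.keys u \<subseteq> X" and v: "Poly_Mapping.keys v \<subseteq> X"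
  shows "f (u - v) = f u \<otimes>\<^bsub>H\<^esub> inv\<^bsub>H\<^esub> f v"
proof -
  interpret group_hom "free_Abelian_group X" H f
    by (intro group_hom.intro group_hom_axioms.intro f H) simp
  have v': "v \<in> carrier (free_Abelian_group X)" and u': "u \<in> carrier (free_Abelian_group X)"
    using u v by auto
  have "u - v = u \<otimes>\<^bsub>free_Abelian_group X\<^esub> inv\<^bsub>free_Abelian_group X\<^esub> v" using v by simp
  then show ?thesis using hom_mult[OF u' G.inv_closed[OF v']] hom_inv[OF v'] by (simp only:)
qed

context derham_ring
begin

text \<open>A generator is the product of its coefficient and of exact one-forms. Values on exact
  one-forms are compared separately instead of assuming compatibility with d, because the lemma has
  to apply to composites with Frobenius, which satisfies d F = p F d.\<close>

lemma derham_hom_ext: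
  assumes g: "g \<in> graded_ring_hom (derham S) A" and g': "g' \<in> graded_ring_hom (derham S) A"
    and A: "\<And>n. comm_group (Gr A n)"
    and 0: "\<And>x. x \<in> carrier S \<Longrightarrow> g 0 (cls 0 (frag_of (x, []))) = g' 0 (cls 0 (frag_of (x, [])))"
    and 1: "\<And>x. x \<in> carrier S \<Longrightarrow> g 1 (Diff (derham S) 0 (cls 0 (frag_of (x, [])))) =
      g' 1 (Diff (derham S) 0 (cls 0 (frag_of (x, []))))"
    and X: "X \<in> carrier (Gr (derham S) n)"
  shows "g n X = g' n X"
proof -
  have m: "GMult (derham S) m n (cls m (frag_of (a, bs))) (cls n (frag_of (c, ds))) =
      cls (m + n) (frag_of (a \<otimes> c, bs @ ds))" if "(a, bs) \<in> gens m" "(c, ds) \<in> gens n" for a bs c ds m n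
    using that by (simp add: GMult_cls)
  have d: "g 1 (cls 1 (frag_of (\<one>, [b]))) = g' 1 (cls 1 (frag_of (\<one>, [b])))" if "b \<in> carrier S" for b
    using 1[OF that] that Diff_cls[of "frag_of (b, [])" 0] by (simp add: keys_frag_of gens_iff)
  have c: "cls n (frag_of (a, bs)) \<in> carrier (Gr (derham S) n)" if "(a, bs) \<in> gens n" for a bs n
    using that by (auto simp: carrier_Gr_derham keys_frag_of)
  have w: "g (int (length bs)) (cls (int (length bs)) (frag_of (\<one>, bs))) =
      g' (int (length bs)) (cls (int (length bs)) (frag_of (\<one>, bs)))" if "set bs \<subseteq> carrier S" for bs
    using that
  proof (induction bs)
    case Nil
    then show ?case using 0 by simp
  next
    case (Cons b bs)
    let ?k = "int (length bs)"
    have "cls (1 + ?k) (frag_of (\<one>, b # bs)) = GMult (derham S) 1 ?k (cls 1 (frag_of (\<one>, [b]))) (cls ?k (frag_of (\<one>, bs)))"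
      using Cons.prems by (subst m) (auto simp: gens_iff)
    moreover have "cls 1 (frag_of (\<one>, [b])) \<in> carrier (Gr (derham S) 1)"
      "cls ?k (frag_of (\<one>, bs)) \<in> carrier (Gr (derham S) ?k)"
      using Cons.prems by (auto intro!: c simp: gens_iff)
    ultimately have "g (1 + ?k) (cls (1 + ?k) (frag_of (\<one>, b # bs))) = g' (1 + ?k) (cls (1 + ?k) (frag_of (\<one>, b # bs)))"
      using Cons graded_ring_homD(4)[OF g] graded_ring_homD(4)[OF g'] d by simp
    then show ?case by (simp add: add.commute)
  qed
  have e: "g n (cls n (frag_of x)) = g' n (cls n (frag_of x))" if "x \<in> gens n" for x
  proof -
    obtain a bs where x: "x = (a, bs)" by fastforce
    with that have ab: "a \<in> carrier S" "set bs \<subseteq> carrier S" "n = int (length bs)" by (auto simp: gens_iff)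
    then have "cls (0 + n) (frag_of (a, bs)) = GMult (derham S) 0 n (cls 0 (frag_of (a, []))) (cls n (frag_of (\<one>, bs)))"
      by (subst m) (auto simp: gens_iff)
    moreover have "cls 0 (frag_of (a, [])) \<in> carrier (Gr (derham S) 0)"
      "cls n (frag_of (\<one>, bs)) \<in> carrier (Gr (derham S) n)"
      using ab by (auto intro!: c simp: gens_iff)
    ultimately have "g (0 + n) (cls (0 + n) (frag_of (a, bs))) = g' (0 + n) (cls (0 + n) (frag_of (a, bs)))"
      using ab w[of bs] 0 graded_ring_hom_deg0[OF g] graded_ring_hom_deg0[OF g'] by simp
    then show ?thesis by (simp add: x)
  qed
  have gh: "g n \<circ> cls n \<in> hom (derham_free S n) (Gr A n)" and gh': "g' n \<circ> cls n \<in> hom (derham_free S n) (Gr A n)"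
    by (rule hom_compose[OF cls_hom graded_ring_homD(1)], rule g g')+
  have gr: "group (Gr A n)" by (rule comm_group.axioms(2)[OF A])
  obtain v where v: "X = cls n v" "Poly_Mapping.keys v \<subseteq> gens n" using X by (auto simp: carrier_Gr_derham)
  have "(g n \<circ> cls n) v = (g' n \<circ> cls n) v"
    using v(2)
  proof (induction v rule: frag_gens_induct)
    case zero
    then show ?case using hom_one[OF gh _ gr] hom_one[OF gh' _ gr] by simp
  next
    case (diff u w)
    then show ?case
      using hom_free_Abelian_group_diff[OF gh gr] hom_free_Abelian_group_diff[OF gh' gr] by simp
  next
    case (frag a)
    then show ?case using e by simp
  qed
  then show ?thesis by (simp add: v(1))
qed

end

section \<open>The map out of the de Rham complex determined by a ring homomorphism into degree
  0\<close>

primrec wedge :: "('b, 'm) dga_scheme \<Rightarrow> ('a \<Rightarrow> 'b) \<Rightarrow> 'a list \<Rightarrow> 'b" where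
  "wedge A h [] = GOne A"
| "wedge A h (b # bs) = GMult A 1 (int (length bs)) (Diff A 0 (h b)) (wedge A h bs)"

context cdga
begin

lemma GMult_deg0_comm: "\<lbrakk>c \<in> carrier (Gr A 0); x \<in> carrier (Gr A n)\<rbrakk> \<Longrightarrow> GMult A n 0 x c = GMult A 0 n c x"
  using GMult_comm[of x n c 0] by (simp add: signed_def)

lemma GMult_deg0_assoc:
  assumes "c \<in> carrier (Gr A 0)" "x \<in> carrier (Gr A m)" "y \<in> carrier (Gr A n)"
  shows "GMult A m n (GMult A 0 m c x) y = GMult A 0 (m + n) c (GMult A m n x y)"
  using GMult_assoc[OF assms] by simp

lemma GMult_deg0_left_comm:
  assumes "c \<in> carrier (Gr A 0)" "x \<in> carrier (Gr A m)" "y \<in> carrier (Gr A n)"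
  shows "GMult A m n x (GMult A 0 n c y) = GMult A 0 (m + n) c (GMult A m n x y)"
  using GMult_assoc[OF assms(2,1,3)] GMult_deg0_comm[OF assms(1,2)] GMult_deg0_assoc[OF assms] by simp

lemma GMult_deg0_deg0:
  assumes "c \<in> carrier (Gr A 0)" "c' \<in> carrier (Gr A 0)" "y \<in> carrier (Gr A n)"
  shows "GMult A 0 n c (GMult A 0 n c' y) = GMult A 0 n (GMult A 0 0 c c') y"
  using GMult_deg0_assoc[OF assms] by simp

lemma GMult_closed': "\<lbrakk>x \<in> carrier (Gr A m); y \<in> carrier (Gr A n); k = m + n\<rbrakk> \<Longrightarrow> GMult A m n x y \<in> carrier (Gr A k)"
  using GMult_closed by simp

lemma Diff_closed1: "x \<in> carrier (Gr A 0) \<Longrightarrow> Diff A 0 x \<in> carrier (Gr A 1)"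
  using Diff.hom_closed[of x 0] by simp

text \<open>Leibniz for 1 = 1 1 gives d 1 = d 1 + d 1.\<close>

lemma Diff_GOne: "Diff A 0 (GOne A) = \<one>\<^bsub>Gr A 1\<^esub>"
proof -
  let ?d = "Diff A 0 (GOne A)"
  have d: "?d \<in> carrier (Gr A 1)" using Diff_closed1 GOne_closed by simp
  have "?d = ?d \<otimes>\<^bsub>Gr A 1\<^esub> ?d"
    using Leibniz[OF GOne_closed GOne_closed] d GOne_closed by (simp add: GMult_l_one GMult_r_one signed_def)
  then show ?thesis using d by simp
qed

lemma Diff_deg0_mult:
  assumes "x \<in> carrier (Gr A 0)" "y \<in> carrier (Gr A 0)"
  shows "Diff A 0 (GMult A 0 0 x y) = GMult A 0 1 y (Diff A 0 x) \<otimes>\<^bsub>Gr A 1\<^esub> GMult A 0 1 x (Diff A 0 y)"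
  using Leibniz[OF assms] GMult_deg0_comm[OF assms(2) Diff_closed1[OF assms(1)]] by (simp add: signed_def)

end

locale derham_to_cdga = derham_ring S + A: cdga A
  for S :: "('a, 'm) ring_scheme" (structure) and A :: "('b, 'n) dga_scheme" +
  fixes h assumes h: "h \<in> ring_hom S (deg0_ring A)"
begin

abbreviation w where "w \<equiv> wedge A h"
abbreviation len :: "'a list \<Rightarrow> int" where "len bs \<equiv> int (length bs)"

lemma h_closed [simp]: "x \<in> carrier S \<Longrightarrow> h x \<in> carrier (Gr A 0)"
  using ring_hom_closed[OF h] by simp

lemma h_add: "\<lbrakk>x \<in> carrier S; y \<in> carrier S\<rbrakk> \<Longrightarrow> h (x \<oplus> y) = h x \<otimes>\<^bsub>Gr A 0\<^esub> h y"
  and h_mult: "\<lbrakk>x \<in> carrier S; y \<in> carrier S\<rbrakk> \<Longrightarrow> h (x \<otimes> y) = GMult A 0 0 (h x) (h y)"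
  and h_one: "h \<one> = GOne A"
  using ring_hom_add[OF h] ring_hom_mult[OF h] ring_hom_one[OF h] by simp_all

lemma dh_closed [simp]: "x \<in> carrier S \<Longrightarrow> Diff A 0 (h x) \<in> carrier (Gr A 1)"
  using A.Diff_closed1 by simp

lemma wedge_closed [simp]: "set bs \<subseteq> carrier S \<Longrightarrow> w bs \<in> carrier (Gr A (len bs))"
  by (induction bs) (auto simp: A.GOne_closed intro!: A.GMult_closed')

lemma wedge_append:
  "\<lbrakk>set us \<subseteq> carrier S; set vs \<subseteq> carrier S\<rbrakk> \<Longrightarrow> w (us @ vs) = GMult A (len us) (len vs) (w us) (w vs)"
proof (induction us)
  case (Cons b us)
  then show ?case using A.GMult_assoc[of "Diff A 0 (h b)" 1 "w us" "len us" "w vs" "len vs"] by (simp add: add.commute)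
qed (simp add: A.GMult_l_one)

lemma Diff_wedge: "set bs \<subseteq> carrier S \<Longrightarrow> Diff A (len bs) (w bs) = \<one>\<^bsub>Gr A (len bs + 1)\<^esub>"
proof (induction bs)
  case Nil
  then show ?case using A.Diff_GOne by simp
next
  case (Cons b bs)
  have b: "Diff A 0 (h b) \<in> carrier (Gr A 1)" and bs: "w bs \<in> carrier (Gr A (len bs))" using Cons.prems by auto
  have dd: "Diff A 1 (Diff A 0 (h b)) = \<one>\<^bsub>Gr A 2\<^esub>"
    using A.Diff_Diff[of "h b" 0] Cons.prems by simp
  have "Diff A (1 + len bs) (w (b # bs)) = \<one>\<^bsub>Gr A (1 + len bs + 1)\<^esub>"
    using A.Leibniz[OF b bs] Cons A.GMult_r_zero[OF b, of "len bs + 1"] A.GMult_l_zero[OF bs, of 2]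
    by (simp add: dd signed_def add.commute add.left_commute)
  then show ?case by (simp add: add.commute)
qed

lemma wedge_slot:
  assumes "set us \<subseteq> carrier S" "b \<in> carrier S" "set vs \<subseteq> carrier S"
  shows "w (us @ [b] @ vs) = GMult A (len us) (1 + len vs) (w us) (GMult A 1 (len vs) (Diff A 0 (h b)) (w vs))"
  using wedge_append[of us "b # vs"] assms by (simp add: add.commute)

definition wval :: "int \<Rightarrow> 'a \<times> 'a list \<Rightarrow> 'b" where
  "wval n = (\<lambda>(a, bs). GMult A 0 n (h a) (w bs))"

lemma wval_closed: "x \<in> gens n \<Longrightarrow> wval n x \<in> carrier (Gr A n)"
  by (cases x) (auto simp: wval_def gens_iff intro!: A.GMult_closed')

text \<open>The additive extension of \<open>wval\<close> to the free abelian group. It is chosen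
  with \<open>SOME\<close> since the universal property provides it only up to its values off the
  carrier.\<close>

definition ev :: "int \<Rightarrow> ('a \<times> 'a list \<Rightarrow>\<^sub>0 int) \<Rightarrow> 'b" where
  "ev n = (SOME g. g \<in> hom (derham_free S n) (Gr A n) \<and> (\<forall>x\<in>gens n. g (frag_of x) = wval n x))"

lemma ev_hom: "ev n \<in> hom (derham_free S n) (Gr A n)"
  and ev_of: "x \<in> gens n \<Longrightarrow> ev n (frag_of x) = wval n x"
proof -
  obtain g where "g \<in> hom (derham_free S n) (Gr A n)" "\<And>x. x \<in> gens n \<Longrightarrow> g (frag_of x) = wval n x"
    using A.Gr.free_Abelian_group_universal[of "wval n" "gens n" n] wval_closed by blast
  then have "\<exists>g. g \<in> hom (derham_free S n) (Gr A n) \<and> (\<forall>x\<in>gens n. g (frag_of x) = wval n x)" by blast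
  from someI_ex[OF this] show "ev n \<in> hom (derham_free S n) (Gr A n)" "x \<in> gens n \<Longrightarrow> ev n (frag_of x) = wval n x"
    unfolding ev_def by auto
qed

lemma ev_closed: "Poly_Mapping.keys v \<subseteq> gens n \<Longrightarrow> ev n v \<in> carrier (Gr A n)"
  using hom_in_carrier[OF ev_hom] by simp

lemma ev_zero: "ev n 0 = \<one>\<^bsub>Gr A n\<^esub>"
  using hom_one[OF ev_hom, of n] by simp

lemma ev_diff: "\<lbrakk>Poly_Mapping.keys u \<subseteq> gens n; Poly_Mapping.keys v \<subseteq> gens n\<rbrakk> \<Longrightarrow>
    ev n (u - v) = ev n u \<otimes>\<^bsub>Gr A n\<^esub> inv\<^bsub>Gr A n\<^esub> ev n v"
  by (rule hom_free_Abelian_group_diff[OF ev_hom A.Gr.is_group])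

end

context derham_to_cdga
begin

lemma wval_slot:
  assumes "(a, us @ [b] @ vs) \<in> gens n"
  shows "wval n (a, us @ [b] @ vs) =
    GMult A 0 n (h a) (GMult A (len us) (1 + len vs) (w us) (GMult A 1 (len vs) (Diff A 0 (h b)) (w vs)))"
    and "n = len us + (1 + len vs)" and "a \<in> carrier S" "b \<in> carrier S" "set us \<subseteq> carrier S" "set vs \<subseteq> carrier S"
  using assms wedge_slot[of us b vs] by (auto simp: wval_def gens_iff)

text \<open>The relations for sums and products alter a single differential, so they are checked
  through additivity in that slot, the other factors being fixed.\<close>

lemma slot_hom:
  assumes "a \<in> carrier S" "set us \<subseteq> carrier S" "set vs \<subseteq> carrier S" "n = len us + (1 + len vs)"
  shows "group_hom (Gr A 1) (Gr A n)
    (\<lambda>t. GMult A 0 n (h a) (GMult A (len us) (1 + len vs) (w us) (GMult A 1 (len vs) t (w vs))))"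
proof -
  have 1: "(\<lambda>t. GMult A 1 (len vs) t (w vs)) \<in> hom (Gr A 1) (Gr A (1 + len vs))"
    by (rule group_hom.homh[OF A.GMult_l_hom[OF wedge_closed[OF assms(3)]]])
  have 2: "GMult A (len us) (1 + len vs) (w us) \<in> hom (Gr A (1 + len vs)) (Gr A n)"
    unfolding assms(4) by (rule group_hom.homh[OF A.GMult_r_hom[OF wedge_closed[OF assms(2)]]])
  have 3: "GMult A 0 n (h a) \<in> hom (Gr A n) (Gr A n)"
    using group_hom.homh[OF A.GMult_r_hom[OF h_closed[OF assms(1)], of n]] by simp
  have "(\<lambda>t. GMult A 0 n (h a) (GMult A (len us) (1 + len vs) (w us) (GMult A 1 (len vs) t (w vs)))) \<in> hom (Gr A 1) (Gr A n)"
    using hom_compose[OF hom_compose[OF 1 2] 3] by (simp add: o_def)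
  then show ?thesis by (intro group_hom.intro group_hom_axioms.intro A.Gr.is_group)
qed

text \<open>A factor of degree 0 moves to the front past the preceding one-forms without a sign and
  merges with the coefficient.\<close>

lemma slot_scale:
  assumes a: "a \<in> carrier S" and us: "set us \<subseteq> carrier S" and vs: "set vs \<subseteq> carrier S"
    and n: "n = len us + (1 + len vs)" and c: "c \<in> carrier S" and t: "t \<in> carrier (Gr A 1)"
  shows "GMult A 0 n (h a) (GMult A (len us) (1 + len vs) (w us) (GMult A 1 (len vs) (GMult A 0 1 (h c) t) (w vs))) =
    GMult A 0 n (h (a \<otimes> c)) (GMult A (len us) (1 + len vs) (w us) (GMult A 1 (len vs) t (w vs)))"
proof -
  note cl = h_closed[OF a] h_closed[OF c] wedge_closed[OF us] wedge_closed[OF vs]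
  have tv: "GMult A 1 (len vs) t (w vs) \<in> carrier (Gr A (1 + len vs))" using t cl by (simp add: A.GMult_closed)
  have utv: "GMult A (len us) (1 + len vs) (w us) (GMult A 1 (len vs) t (w vs)) \<in> carrier (Gr A n)"
    unfolding n by (rule A.GMult_closed[OF cl(3) tv])
  show ?thesis
    using A.GMult_deg0_assoc[OF cl(2) t cl(4)] A.GMult_deg0_left_comm[OF cl(2,3) tv]
      A.GMult_deg0_deg0[OF cl(1,2) utv] h_mult[OF a c] n by simp
qed

lemma ev_diff3:
  assumes "x \<in> gens n" "y \<in> gens n" "z \<in> gens n" "wval n x = wval n y \<otimes>\<^bsub>Gr A n\<^esub> wval n z"
  shows "ev n (frag_of x - frag_of y - frag_of z) = \<one>\<^bsub>Gr A n\<^esub>"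
proof -
  have "Poly_Mapping.keys (frag_of x - frag_of y) \<subseteq> gens n"
    using keys_diff[of "frag_of x" "frag_of y"] assms by (auto simp: keys_frag_of)
  then have "ev n (frag_of x - frag_of y - frag_of z) =
      wval n x \<otimes>\<^bsub>Gr A n\<^esub> inv\<^bsub>Gr A n\<^esub> wval n y \<otimes>\<^bsub>Gr A n\<^esub> inv\<^bsub>Gr A n\<^esub> wval n z"
    using assms by (simp add: ev_diff ev_of keys_frag_of)
  also have "\<dots> = \<one>\<^bsub>Gr A n\<^esub>"
    using wval_closed[OF assms(2)] wval_closed[OF assms(3)]
    by (simp add: assms(4) A.Gr.m_comm[of "wval n y"] A.Gr.m_assoc)
  finally show ?thesis .
qed

text \<open>The four relations correspond to distributivity over the coefficient, additivity of d in
  one slot, the Leibniz rule in degree 0, and the vanishing of squares of elements of degree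
  1.\<close>

lemma ev_rels: "v \<in> rels n \<Longrightarrow> ev n v = \<one>\<^bsub>Gr A n\<^esub>"
proof (cases rule: derham_rels.cases)
  assume "v \<in> rels n" then show "v \<in> rels n" .
next
  fix a bs a'
  assume v: "v = frag_of (a \<oplus> a', bs) - frag_of (a, bs) - frag_of (a', bs)"
    and g: "(a, bs) \<in> gens n" "(a', bs) \<in> gens n"
  show ?thesis unfolding v
  proof (rule ev_diff3)
    show "(a \<oplus> a', bs) \<in> gens n" using g by (auto simp: gens_iff)
    show "wval n (a \<oplus> a', bs) = wval n (a, bs) \<otimes>\<^bsub>Gr A n\<^esub> wval n (a', bs)"
      using g A.GMult_l_distr[of "h a" 0 "h a'" "w bs" n] by (auto simp: wval_def gens_iff h_add)
  qed (rule g)+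
next
  fix a us b vs b'
  assume v: "v = frag_of (a, us @ [b \<oplus> b'] @ vs) - frag_of (a, us @ [b] @ vs) - frag_of (a, us @ [b'] @ vs)"
    and g: "(a, us @ [b] @ vs) \<in> gens n" "(a, us @ [b'] @ vs) \<in> gens n"
  have g3: "(a, us @ [b \<oplus> b'] @ vs) \<in> gens n" using g by (auto simp: gens_iff)
  note s = wval_slot[OF g(1)] and s' = wval_slot[OF g(2)]
  interpret t: group_hom "Gr A 1" "Gr A n"
    "\<lambda>t. GMult A 0 n (h a) (GMult A (len us) (1 + len vs) (w us) (GMult A 1 (len vs) t (w vs)))"
    using s by (intro slot_hom)
  have "Diff A 0 (h (b \<oplus> b')) = Diff A 0 (h b) \<otimes>\<^bsub>Gr A 1\<^esub> Diff A 0 (h b')"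
    using A.Diff.hom_mult[of "h b" 0 "h b'"] s(4) s'(4) by (simp add: h_add)
  then show ?thesis unfolding v using s(4) s'(4)
    by (intro ev_diff3 g g3) (simp only: s(1) s'(1) wval_slot(1)[OF g3] t.hom_mult dh_closed)
next
  fix a us b vs b'
  assume v: "v = frag_of (a, us @ [b \<otimes> b'] @ vs) - frag_of (a \<otimes> b, us @ [b'] @ vs) - frag_of (a \<otimes> b', us @ [b] @ vs)"
    and g: "(a, us @ [b] @ vs) \<in> gens n" "(a, us @ [b'] @ vs) \<in> gens n"
  have g3: "(a, us @ [b \<otimes> b'] @ vs) \<in> gens n" "(a \<otimes> b, us @ [b'] @ vs) \<in> gens n" "(a \<otimes> b', us @ [b] @ vs) \<in> gens n"
    using g by (auto simp: gens_iff)
  note s = wval_slot[OF g(1)] and s' = wval_slot[OF g(2)]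
  interpret t: group_hom "Gr A 1" "Gr A n"
    "\<lambda>t. GMult A 0 n (h a) (GMult A (len us) (1 + len vs) (w us) (GMult A 1 (len vs) t (w vs)))"
    using s by (intro slot_hom)
  have d: "Diff A 0 (h (b \<otimes> b')) = GMult A 0 1 (h b) (Diff A 0 (h b')) \<otimes>\<^bsub>Gr A 1\<^esub> GMult A 0 1 (h b') (Diff A 0 (h b))"
    using A.Diff_deg0_mult[of "h b" "h b'"] s(4) s'(4) A.GMult_closed[of "h b" 0 "Diff A 0 (h b')" 1]
      A.GMult_closed[of "h b'" 0 "Diff A 0 (h b)" 1] by (simp add: h_mult A.Gr.m_comm)
  have cl: "GMult A 0 1 (h b) (Diff A 0 (h b')) \<in> carrier (Gr A 1)" "GMult A 0 1 (h b') (Diff A 0 (h b)) \<in> carrier (Gr A 1)"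
    using s(4) s'(4) by (auto intro!: A.GMult_closed')
  show ?thesis unfolding v
  proof (intro ev_diff3 g3)
    show "wval n (a, us @ [b \<otimes> b'] @ vs) = wval n (a \<otimes> b, us @ [b'] @ vs) \<otimes>\<^bsub>Gr A n\<^esub> wval n (a \<otimes> b', us @ [b] @ vs)"
      unfolding wval_slot(1)[OF g3(1)] wval_slot(1)[OF g3(2)] wval_slot(1)[OF g3(3)] d t.hom_mult[OF cl]
        slot_scale[OF s(3,5,6,2) s(4) dh_closed[OF s'(4)]] slot_scale[OF s(3,5,6,2) s'(4) dh_closed[OF s(4)]] ..
  qed
next
  fix a us b vs
  assume v: "v = frag_of (a, us @ [b, b] @ vs)" and g: "(a, us @ [b, b] @ vs) \<in> gens n"
  have a: "a \<in> carrier S" and us: "set us \<subseteq> carrier S" and b: "b \<in> carrier S" and vs: "set vs \<subseteq> carrier S"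
    and n: "n = len us + (1 + (1 + len vs))" using g by (auto simp: gens_iff)
  have "w ([b] @ [b] @ vs) = GMult A 1 (1 + len vs) (Diff A 0 (h b)) (GMult A 1 (len vs) (Diff A 0 (h b)) (w vs))"
    by (simp add: add.commute)
  also have "\<dots> = GMult A (1 + 1) (len vs) (GMult A 1 1 (Diff A 0 (h b)) (Diff A 0 (h b))) (w vs)"
    using A.GMult_assoc[OF dh_closed[OF b] dh_closed[OF b] wedge_closed[OF vs]] by simp
  also have "\<dots> = \<one>\<^bsub>Gr A (1 + 1 + len vs)\<^esub>"
    using A.GMult_odd_square[OF _ dh_closed[OF b]] A.GMult_l_zero[OF wedge_closed[OF vs], of "1 + 1"] by simp
  finally have "w (us @ [b, b] @ vs) = \<one>\<^bsub>Gr A n\<^esub>"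
    using wedge_append[of us "[b] @ [b] @ vs"] us b vs n A.GMult_r_zero[OF wedge_closed[OF us], of "1 + 1 + len vs"]
    by (simp add: add.commute add.left_commute)
  then show ?thesis using g a A.GMult_r_zero[OF h_closed[OF a], of n] by (simp add: v ev_of wval_def)
qed

lemma ev_null: "v \<in> null n \<Longrightarrow> ev n v = \<one>\<^bsub>Gr A n\<^esub>"
  using null_hom[OF ev_hom A.Gr.is_group A.Gr.triv_subgroup[of n], of v] ev_rels by simp

lemma ev_mult:
  assumes "Poly_Mapping.keys u \<subseteq> gens m" "Poly_Mapping.keys v \<subseteq> gens n"
  shows "ev (m + n) (derham_mult S u v) = GMult A m n (ev m u) (ev n v)"
  using assms(1)
proof (induction u rule: frag_gens_induct)
  case zero
  show ?case using A.GMult_l_zero[OF ev_closed[OF assms(2)]] by (simp add: ev_zero)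
next
  case (diff u u')
  interpret t: group_hom "Gr A m" "Gr A (m + n)" "\<lambda>x. GMult A m n x (ev n v)"
    by (rule A.GMult_l_hom[OF ev_closed[OF assms(2)]])
  show ?case using diff assms(2)
    by (simp add: derham_mult_diff_left ev_diff derham_mult_closed ev_closed)
next
  case (frag x)
  obtain a bs where x: "x = (a, bs)" by fastforce
  show ?case using assms(2)
  proof (induction v rule: frag_gens_induct)
    case zero
    show ?case using A.GMult_r_zero[OF ev_closed, of "frag_of x" m n] frag by (simp add: ev_zero keys_frag_of)
  next
    case (diff v v')
    have fx: "Poly_Mapping.keys (frag_of x) \<subseteq> gens m" using frag by (simp add: keys_frag_of)
    interpret t: group_hom "Gr A n" "Gr A (m + n)" "GMult A m n (ev m (frag_of x))"
      by (rule A.GMult_r_hom[OF ev_closed[OF fx]])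
    show ?case using diff fx
      by (simp add: derham_mult_diff_right ev_diff derham_mult_closed ev_closed)
  next
    case (frag y)
    obtain c ds where y: "y = (c, ds)" by fastforce
    have ab: "a \<in> carrier S" "set bs \<subseteq> carrier S" "m = len bs" using \<open>x \<in> gens m\<close> by (auto simp: x gens_iff)
    have cd: "c \<in> carrier S" "set ds \<subseteq> carrier S" "n = len ds" using \<open>y \<in> gens n\<close> by (auto simp: y gens_iff)
    have g: "(a \<otimes> c, bs @ ds) \<in> gens (m + n)" using ab cd by (auto simp: gens_iff)
    note cl = h_closed[OF ab(1)] h_closed[OF cd(1)] wedge_closed[OF ab(2), folded ab(3)] wedge_closed[OF cd(2), folded cd(3)]
    have "ev (m + n) (derham_mult S (frag_of x) (frag_of y)) =
        GMult A 0 (m + n) (GMult A 0 0 (h a) (h c)) (GMult A m n (w bs) (w ds))"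
      using g ab cd by (simp add: x y ev_of wval_def h_mult wedge_append)
    also have "\<dots> = GMult A 0 (m + n) (h a) (GMult A 0 (m + n) (h c) (GMult A m n (w bs) (w ds)))"
      using A.GMult_deg0_deg0[OF cl(1,2) A.GMult_closed[OF cl(3,4)]] by simp
    also have "\<dots> = GMult A 0 (m + n) (h a) (GMult A m n (w bs) (GMult A 0 n (h c) (w ds)))"
      using A.GMult_deg0_left_comm[OF cl(2,3,4)] by simp
    also have "\<dots> = GMult A m n (GMult A 0 m (h a) (w bs)) (GMult A 0 n (h c) (w ds))"
      using A.GMult_deg0_assoc[OF cl(1,3) A.GMult_closed'[OF cl(2,4), of n]] by simp
    also have "\<dots> = GMult A m n (ev m (frag_of x)) (ev n (frag_of y))"
      using \<open>x \<in> gens m\<close> \<open>y \<in> gens n\<close> by (simp add: ev_of) (simp add: x y wval_def)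
    finally show ?case .
  qed
qed

text \<open>A wedge of exact one-forms is closed, so Leibniz leaves only the term in which d meets
  the coefficient.\<close>

lemma ev_Diff:
  assumes "Poly_Mapping.keys v \<subseteq> gens n"
  shows "ev (n + 1) (derham_diff S v) = Diff A n (ev n v)"
  using assms
proof (induction v rule: frag_gens_induct)
  case zero
  show ?case using derham_diff_diff[of S 0 0] by (simp add: ev_zero)
next
  case (diff u v)
  then show ?case by (simp add: derham_diff_diff ev_diff derham_diff_closed ev_closed)
next
  case (frag x)
  obtain a bs where x: "x = (a, bs)" by fastforce
  have ab: "a \<in> carrier S" "set bs \<subseteq> carrier S" "n = len bs" using frag by (auto simp: x gens_iff)
  have g: "(\<one>, a # bs) \<in> gens (n + 1)" using ab by (auto simp: gens_iff)
  note cl = h_closed[OF ab(1)] wedge_closed[OF ab(2), folded ab(3)]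
  have c: "w (a # bs) \<in> carrier (Gr A (n + 1))" using wedge_closed[of "a # bs"] ab by (simp add: add.commute)
  have "ev (n + 1) (derham_diff S (frag_of x)) = GMult A 1 n (Diff A 0 (h a)) (w bs)"
    using g c ab(3) A.GMult_l_one[OF c] by (simp add: x ev_of wval_def h_one)
  also have "\<dots> = Diff A (0 + n) (GMult A 0 n (h a) (w bs))"
    using A.Leibniz[OF cl] Diff_wedge[OF ab(2)] A.GMult_r_zero[OF cl(1), of "n + 1"]
      A.GMult_closed'[OF dh_closed[OF ab(1)] cl(2), of "n + 1"] ab(3) by (simp add: signed_def)
  also have "\<dots> = Diff A n (ev n (frag_of x))" using frag by (simp add: x ev_of wval_def)
  finally show ?case .
qed

lemma derham_universal:
  obtains g where "g \<in> graded_ring_hom (derham S) A"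
    "\<And>n X. X \<in> carrier (Gr (derham S) n) \<Longrightarrow> g (n + 1) (Diff (derham S) n X) = Diff A n (g n X)"
    "\<And>x. x \<in> carrier S \<Longrightarrow> g 0 (cls 0 (frag_of (x, []))) = h x"
proof -
  \<comment> \<open>Since \<open>ev\<close> kills the relations, its value depends only on the
    coset; this is what permits the descent to the quotient.\<close>
  have ev_cong: "ev n u = ev n v"
    if "u \<in> carrier (derham_free S n)" "v \<in> carrier (derham_free S n)"
      "null n #>\<^bsub>derham_free S n\<^esub> u = null n #>\<^bsub>derham_free S n\<^esub> v" for n u v
  proof -
    have "u - v \<in> null n"
      using that comm_group.rcos_eq_iff[OF abelian_free_Abelian_group null_subgroup that(1,2)] by simp
    then have "ev n u \<otimes>\<^bsub>Gr A n\<^esub> inv\<^bsub>Gr A n\<^esub> ev n v = \<one>\<^bsub>Gr A n\<^esub>"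
      using ev_null[of "u - v" n] that by (simp add: ev_diff)
    then show ?thesis using that by (simp add: A.Gr.inv_solve_right' ev_closed)
  qed
  have nm: "null n \<lhd> derham_free S n" for n
    by (rule comm_group.subgroup_imp_normal[OF abelian_free_Abelian_group null_subgroup])
  have "\<exists>g. g \<in> hom (Gr (derham S) n) (Gr A n) \<and> (\<forall>v\<in>carrier (derham_free S n). g (cls n v) = ev n v)" for n
    using FactGroup_universal[OF ev_hom nm ev_cong, of n] unfolding Gr_derham derham_class_def by metis
  then obtain g where g: "\<And>n. g n \<in> hom (Gr (derham S) n) (Gr A n)"
    and g_cls: "\<And>n v. Poly_Mapping.keys v \<subseteq> gens n \<Longrightarrow> g n (cls n v) = ev n v"
    by (metis carrier_free_Abelian_group_iff)
  show thesis
  proof (rule that)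
    show "g \<in> graded_ring_hom (derham S) A"
      unfolding graded_ring_hom_def mem_Collect_eq
    proof (intro conjI allI ballI)
      fix m n X Y assume "X \<in> carrier (Gr (derham S) m)" "Y \<in> carrier (Gr (derham S) n)"
      then show "g (m + n) (GMult (derham S) m n X Y) = GMult A m n (g m X) (g n Y)"
        by (auto simp: carrier_Gr_derham GMult_cls g_cls derham_mult_closed ev_mult)
    next
      show "g 0 (GOne (derham S)) = GOne A"
        by (simp add: GOne_cls g_cls keys_frag_of gens_iff ev_of wval_def h_one A.GMult_l_one A.GOne_closed)
    qed (rule g)
    show "g (n + 1) (Diff (derham S) n X) = Diff A n (g n X)" if "X \<in> carrier (Gr (derham S) n)" for n X
      using that by (auto simp: carrier_Gr_derham Diff_cls g_cls derham_diff_closed ev_Diff)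
    show "g 0 (cls 0 (frag_of (x, []))) = h x" if "x \<in> carrier S" for x
      using that by (simp add: g_cls keys_frag_of gens_iff ev_of wval_def A.GMult_r_one)
  qed
qed

end

section \<open>Extension to the completion\<close>

context comm_group
begin

lemma cong_sym:
  assumes "subgroup N G" "x \<in> carrier G" "y \<in> carrier G" "x \<otimes> inv y \<in> N"
  shows "y \<otimes> inv x \<in> N"
  using subgroup.m_inv_closed[OF assms(1,4)] assms(2,3) by (simp add: inv_mult m_comm)

lemma cong_trans:
  assumes N: "subgroup N G" and c: "x \<in> carrier G" "y \<in> carrier G" "z \<in> carrier G"
    and "x \<otimes> inv y \<in> N" "y \<otimes> inv z \<in> N"
  shows "x \<otimes> inv z \<in> N"
proof -
  have "inv y \<otimes> (y \<otimes> inv z) = inv z" using c by (simp flip: m_assoc)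
  then have "x \<otimes> inv z = (x \<otimes> inv y) \<otimes> (y \<otimes> inv z)" using c by (simp add: m_assoc)
  then show ?thesis using subgroup.m_closed[OF N assms(5,6)] by simp
qed

lemma cong_mult:
  assumes N: "subgroup N G" and c: "x \<in> carrier G" "y \<in> carrier G" "a \<in> carrier G" "b \<in> carrier G"
    and "x \<otimes> inv a \<in> N" "y \<otimes> inv b \<in> N"
  shows "(x \<otimes> y) \<otimes> inv (a \<otimes> b) \<in> N"
proof -
  have "(x \<otimes> y) \<otimes> inv (a \<otimes> b) = (x \<otimes> inv a) \<otimes> (y \<otimes> inv b)"
    using c by (simp add: inv_mult m_ac)
  then show ?thesis using subgroup.m_closed[OF N assms(6,7)] by simp
qed

end

lemma hom_multiples:
  assumes "f \<in> hom G H" "group G" "group H" "x \<in> multiples q G"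
  shows "f x \<in> multiples q H"
proof -
  interpret group_hom G H f by (intro group_hom.intro group_hom_axioms.intro assms)
  show ?thesis using assms(4) by (auto simp: multiples_def hom_nat_pow)
qed

lemma multiples_mult_subset: "comm_group G \<Longrightarrow> multiples (q * q') G \<subseteq> multiples q G"
  by (auto simp: multiples_def comm_group_def simp flip: group.is_monoid)
    (metis comm_group.axioms(1) comm_monoid.axioms(1) imageI monoid.nat_pow_closed monoid.nat_pow_pow mult.commute)

section \<open>Inverse limits along a descending filtration, and the p-adic case\<close>

locale descending_filtration = comm_group G for G :: "('a, 'm) monoid_scheme" (structure) +
  fixes N :: "nat \<Rightarrow> 'a set"
  assumes N_subgroup: "subgroup (N r) G" and N_Suc: "N (Suc r) \<subseteq> N r"
begin

abbreviation C where "C \<equiv> completion G N"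

lemma N_normal: "N r \<lhd> G"
  by (rule subgroup_imp_normal[OF N_subgroup])

lemma Mod_group: "group (G Mod N r)"
  by (rule normal.factorgroup_is_group[OF N_normal])

lemma coset_self: "x \<in> carrier G \<Longrightarrow> x \<in> N r #> x"
  by (rule rcos_self[OF _ N_subgroup])

lemma coset_eq: "\<lbrakk>y \<in> N r #> x; x \<in> carrier G\<rbrakk> \<Longrightarrow> N r #> x = N r #> y"
  by (rule repr_independence[OF _ _ N_subgroup])

lemma coset_carrier: "\<lbrakk>y \<in> N r #> x; x \<in> carrier G\<rbrakk> \<Longrightarrow> y \<in> carrier G"
  using subgroup.elemrcos_carrier[OF N_subgroup is_group] by blast

text \<open>A representative at level \<open>Suc r\<close> also represents level r. Having one
  representative for two consecutive levels makes compatibility of a new family a computation with a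
  single element.\<close>

lemma carrier_C_iff: "X \<in> carrier C \<longleftrightarrow> (\<forall>r. \<exists>x\<in>carrier G. X r = N r #> x \<and> X (Suc r) = N (Suc r) #> x)"
proof
  assume X: "X \<in> carrier C"
  show "\<forall>r. \<exists>x\<in>carrier G. X r = N r #> x \<and> X (Suc r) = N (Suc r) #> x"
  proof
    fix r
    have XM: "X s \<in> (#>) (N s) ` carrier G" for s
      using X by (simp add: completion_def carrier_FactGroup)
    obtain x where x: "x \<in> carrier G" "X (Suc r) = N (Suc r) #> x" using XM[of "Suc r"] by blast
    obtain y where y: "y \<in> carrier G" "X r = N r #> y" using XM[of r] by blast
    have "x \<in> X r" using X coset_self[OF x(1), of "Suc r"] x(2) by (auto simp: completion_def)
    then have "X r = N r #> x" using y coset_eq by simp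
    with x show "\<exists>x\<in>carrier G. X r = N r #> x \<and> X (Suc r) = N (Suc r) #> x" by blast
  qed
next
  assume *: "\<forall>r. \<exists>x\<in>carrier G. X r = N r #> x \<and> X (Suc r) = N (Suc r) #> x"
  have "X (Suc r) \<subseteq> X r \<and> X r \<in> carrier (G Mod N r)" for r
  proof -
    obtain x where "x \<in> carrier G" "X r = N r #> x" "X (Suc r) = N (Suc r) #> x" using * by blast
    then show ?thesis using N_Suc[of r] by (auto simp: r_coset_def carrier_FactGroup subset_iff)
  qed
  then show "X \<in> carrier C" by (simp add: completion_def)
qed

lemma C_coset: "\<lbrakk>X \<in> carrier C; x \<in> X r\<rbrakk> \<Longrightarrow> x \<in> carrier G \<and> X r = N r #> x"
  unfolding carrier_C_iff using coset_carrier coset_eq by metis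

lemma C_mono: "X \<in> carrier C \<Longrightarrow> X (r + s) \<subseteq> X r"
proof (induction s)
  case (Suc s)
  then show ?case by (auto simp: completion_def)
qed simp

lemma C_obtain:
  assumes "X \<in> carrier C" obtains x where "x \<in> X r" "x \<in> carrier G" "X r = N r #> x"
  using assms unfolding carrier_C_iff by (metis coset_self)

lemma mult_C: "(X \<otimes>\<^bsub>C\<^esub> Y) r = X r <#> Y r"
  by (simp add: completion_def)

lemma one_C: "\<one>\<^bsub>C\<^esub> r = N r"
  by (simp add: completion_def)

lemma one_coset: "N r = N r #> \<one>"
  using coset_mult_one[of "N r"] subgroup.subset[OF N_subgroup] by simp

lemma to_completion_closed: "x \<in> carrier G \<Longrightarrow> to_completion G N x \<in> carrier C"
  unfolding carrier_C_iff by (auto simp: to_completion_def)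

lemma to_completion_mult: "\<lbrakk>x \<in> carrier G; y \<in> carrier G\<rbrakk> \<Longrightarrow>
    to_completion G N (x \<otimes> y) = to_completion G N x \<otimes>\<^bsub>C\<^esub> to_completion G N y"
  by (rule ext) (simp add: mult_C to_completion_def rcos_sum'[OF N_subgroup])

lemma C_mult_closed: "\<lbrakk>X \<in> carrier C; Y \<in> carrier C\<rbrakk> \<Longrightarrow> X \<otimes>\<^bsub>C\<^esub> Y \<in> carrier C"
  unfolding carrier_C_iff mult_C by (metis m_closed rcos_sum'[OF N_subgroup])

lemma C_group: "group C"
proof (rule groupI)
  show "\<one>\<^bsub>C\<^esub> \<in> carrier C" unfolding carrier_C_iff one_C using one_coset by blast
  have Mod: "X r \<in> carrier (G Mod N r)" if "X \<in> carrier C" for X r using that by (simp add: completion_def)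
  show "X \<otimes>\<^bsub>C\<^esub> Y \<otimes>\<^bsub>C\<^esub> Z = X \<otimes>\<^bsub>C\<^esub> (Y \<otimes>\<^bsub>C\<^esub> Z)"
    if "X \<in> carrier C" "Y \<in> carrier C" "Z \<in> carrier C" for X Y Z
  proof (rule ext)
    fix r
    interpret q: group "G Mod N r" by (rule Mod_group)
    show "(X \<otimes>\<^bsub>C\<^esub> Y \<otimes>\<^bsub>C\<^esub> Z) r = (X \<otimes>\<^bsub>C\<^esub> (Y \<otimes>\<^bsub>C\<^esub> Z)) r"
      using q.m_assoc[OF that[THEN Mod]] by (simp add: mult_C)
  qed
  show "\<one>\<^bsub>C\<^esub> \<otimes>\<^bsub>C\<^esub> X = X" if "X \<in> carrier C" for X
  proof (rule ext)
    fix r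
    interpret q: group "G Mod N r" by (rule Mod_group)
    show "(\<one>\<^bsub>C\<^esub> \<otimes>\<^bsub>C\<^esub> X) r = X r"
      using q.l_one[OF Mod[OF that]] by (simp add: mult_C one_C)
  qed
  show "\<exists>Y\<in>carrier C. Y \<otimes>\<^bsub>C\<^esub> X = \<one>\<^bsub>C\<^esub>" if X: "X \<in> carrier C" for X
  proof
    let ?Y = "\<lambda>r. inv\<^bsub>G Mod N r\<^esub> X r"
    have inv: "inv\<^bsub>G Mod N r\<^esub> (N r #> x) = N r #> inv x" if "x \<in> carrier G" for x r
      using group_hom.hom_inv[of G "G Mod N r" "(#>) (N r)" x] normal.r_coset_hom_Mod[OF N_normal] Mod_group that
      by (simp add: group_hom_def group_hom_axioms_def is_group)
    show "?Y \<in> carrier C" using X unfolding carrier_C_iff by (metis inv inv_closed)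
    show "?Y \<otimes>\<^bsub>C\<^esub> X = \<one>\<^bsub>C\<^esub>"
    proof (rule ext)
      fix r
      interpret q: group "G Mod N r" by (rule Mod_group)
      show "(?Y \<otimes>\<^bsub>C\<^esub> X) r = \<one>\<^bsub>C\<^esub> r"
        using q.l_inv[OF Mod[OF X]] by (simp add: mult_C one_C)
    qed
  qed
qed (rule C_mult_closed)

lemma C_pow: "(X [^]\<^bsub>C\<^esub> (q::nat)) r = X r [^]\<^bsub>G Mod N r\<^esub> q"
  by (induction q) (simp_all add: mult_C one_C)

end

locale p_filtration = comm_group G for G :: "('a, 'm) monoid_scheme" (structure) + fixes p :: nat
begin

abbreviation pN where "pN \<equiv> \<lambda>r. multiples (p ^ r) G"

sublocale descending_filtration G pN
proof (intro descending_filtration.intro descending_filtration_axioms.intro comm_group_axioms)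
  show "multiples (p ^ Suc r) G \<subseteq> multiples (p ^ r) G" for r
    using multiples_mult_subset[OF comm_group_axioms, of "p ^ r" p] by (simp add: mult.commute)
qed (rule multiples_subgroup)

text \<open>The kernel of the projection to \<open>G / p\<^sup>r G\<close> consists of \<open>p\<^sup>r\<close>-multiples, so additive maps on the
  completion are automatically continuous.\<close>
lemma C_decompose:
  assumes X: "X \<in> carrier C"
  obtains x Y where "x \<in> carrier G" "Y \<in> carrier C" "X = to_completion G pN x \<otimes>\<^bsub>C\<^esub> Y [^]\<^bsub>C\<^esub> (p ^ r)"
proof -
  obtain x where x: "x \<in> X r" "x \<in> carrier G" "X r = pN r #> x" using C_obtain[OF X] by blast
  \<comment> \<open>Y is the quotient of X - x by p^r, found by successive approximation: the s-th
    approximation y satisfies x + p^r y = X modulo p^(r+s), and two consecutive ones may differ by a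
    multiple of p^s. The approximation for s = 0 is 0.\<close>
  let ?P = "\<lambda>s y. y \<in> carrier G \<and> x \<otimes> y [^] (p ^ r) \<in> X (r + s)"
  have "\<exists>f. \<forall>s. ?P s (f s) \<and> f (Suc s) \<otimes> inv f s \<in> pN s"
  proof (rule dependent_nat_choice)
    show "\<exists>y. ?P 0 y" using x by (intro exI[of _ \<one>]) simp
    fix y s assume y: "?P s y"
    let ?a = "x \<otimes> y [^] (p ^ r)"
    obtain z where z: "z \<in> X (r + Suc s)" using C_obtain[OF X] by blast
    then have "z \<in> X (r + s)" using C_mono[OF X, of "r + s" 1] by auto
    then have "z \<in> pN (r + s) #> ?a" using C_coset[OF X] y by blast
    then obtain u where u: "u \<in> carrier G" "z = u [^] (p ^ (r + s)) \<otimes> ?a"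
      by (auto simp: r_coset_def multiples_def)
    \<comment> \<open>The error p^(r+s) u is absorbed by adding p^s u to y.\<close>
    have "u [^] (p ^ (r + s)) = (u [^] (p ^ s)) [^] (p ^ r)"
      using u by (simp add: nat_pow_pow power_add mult.commute)
    then have "z = x \<otimes> (u [^] (p ^ s) \<otimes> y) [^] (p ^ r)"
      using u y x(2) by (simp add: nat_pow_distrib m_ac)
    moreover have "u [^] (p ^ s) \<otimes> y \<otimes> inv y \<in> pN s" using u y by (simp add: m_assoc multiples_def)
    ultimately show "\<exists>y'. ?P (Suc s) y' \<and> y' \<otimes> inv y \<in> pN s"
      using z u y by (intro exI[of _ "u [^] (p ^ s) \<otimes> y"]) simp
  qed
  then obtain f where f: "\<And>s. f s \<in> carrier G" "\<And>s. x \<otimes> f s [^] (p ^ r) \<in> X (r + s)"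
    "\<And>s. f (Suc s) \<otimes> inv f s \<in> pN s" by blast
  let ?Y = "\<lambda>s. pN s #> f s"
  have "?Y s = pN s #> f (Suc s)" for s
    using rcos_eq_iff[OF N_subgroup f(1) f(1), of s "Suc s" s] f(3) by simp
  then have Y: "?Y \<in> carrier C" unfolding carrier_C_iff using f(1) by blast
  have "X = to_completion G pN x \<otimes>\<^bsub>C\<^esub> ?Y [^]\<^bsub>C\<^esub> (p ^ r)"
  proof (rule ext)
    fix s
    have "x \<otimes> f s [^] (p ^ r) \<in> X s" using f(2)[of s] C_mono[OF X, of s r] by (auto simp: add.commute)
    then have "X s = pN s #> (x \<otimes> f s [^] (p ^ r))" using C_coset[OF X] by blast
    also have "\<dots> = (to_completion G pN x \<otimes>\<^bsub>C\<^esub> ?Y [^]\<^bsub>C\<^esub> (p ^ r)) s"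
      using x(2) f(1) by (simp add: mult_C C_pow to_completion_def normal.FactGroup_pow[OF N_normal]
        rcos_sum'[OF N_subgroup])
    finally show "X s = \<dots>" .
  qed
  with x(2) Y show thesis by (rule that)
qed

text \<open>Writing X as the image of an element of G plus p^r Y, the two values at X differ by p^r
  times the difference of the values at Y, for every r.\<close>

lemma completion_hom_ext:
  assumes H: "comm_group H" and sep: "\<And>a. \<lbrakk>a \<in> carrier H; \<And>r. a \<in> multiples (p ^ r) H\<rbrakk> \<Longrightarrow> a = \<one>\<^bsub>H\<^esub>"
    and u: "u \<in> hom C H" and u': "u' \<in> hom C H"
    and eq: "\<And>x. x \<in> carrier G \<Longrightarrow> u (to_completion G pN x) = u' (to_completion G pN x)"
    and X: "X \<in> carrier C"
  shows "u X = u' X"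
proof -
  interpret H: comm_group H by (rule H)
  interpret u: group_hom C H u by (intro group_hom.intro group_hom_axioms.intro u C_group H.is_group)
  interpret u': group_hom C H u' by (intro group_hom.intro group_hom_axioms.intro u' C_group H.is_group)
  have "u X \<otimes>\<^bsub>H\<^esub> inv\<^bsub>H\<^esub> u' X \<in> multiples (p ^ r) H" for r
  proof -
    obtain x Y where x: "x \<in> carrier G" and Y: "Y \<in> carrier C"
      and Xe: "X = to_completion G pN x \<otimes>\<^bsub>C\<^esub> Y [^]\<^bsub>C\<^esub> (p ^ r)" using C_decompose[OF X] by blast
    let ?t = "to_completion G pN x"
    have t: "?t \<in> carrier C" by (rule to_completion_closed[OF x])
    have Yp: "Y [^]\<^bsub>C\<^esub> (p ^ r) \<in> carrier C" using u.G.nat_pow_closed[OF Y] .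
    have 1: "u X = u ?t \<otimes>\<^bsub>H\<^esub> u Y [^]\<^bsub>H\<^esub> (p ^ r)"
      unfolding Xe using u.hom_mult[OF t Yp] u.hom_nat_pow[OF Y] by simp
    have 2: "u' X = u ?t \<otimes>\<^bsub>H\<^esub> u' Y [^]\<^bsub>H\<^esub> (p ^ r)"
      unfolding Xe using u'.hom_mult[OF t Yp] u'.hom_nat_pow[OF Y] eq[OF x] by simp
    have c: "u ?t \<in> carrier H" "u Y \<in> carrier H" "u' Y \<in> carrier H"
      using t Y by (auto intro: u.hom_closed u'.hom_closed)
    have "u X \<otimes>\<^bsub>H\<^esub> inv\<^bsub>H\<^esub> u' X = (u Y \<otimes>\<^bsub>H\<^esub> inv\<^bsub>H\<^esub> u' Y) [^]\<^bsub>H\<^esub> (p ^ r)"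
    proof -
      have "u X \<otimes>\<^bsub>H\<^esub> inv\<^bsub>H\<^esub> u' X = (u ?t \<otimes>\<^bsub>H\<^esub> inv\<^bsub>H\<^esub> u ?t) \<otimes>\<^bsub>H\<^esub>
          (u Y [^]\<^bsub>H\<^esub> (p ^ r) \<otimes>\<^bsub>H\<^esub> inv\<^bsub>H\<^esub> (u' Y [^]\<^bsub>H\<^esub> (p ^ r)))"
        unfolding 1 2 using c by (simp add: H.inv_mult H.m_ac del: H.r_inv)
      then show ?thesis using c by (simp add: H.nat_pow_distrib H.nat_pow_inv)
    qed
    then show ?thesis using c by (simp add: multiples_def)
  qed
  then have "u X \<otimes>\<^bsub>H\<^esub> inv\<^bsub>H\<^esub> u' X = \<one>\<^bsub>H\<^esub>" using X by (intro sep) (auto intro: u.hom_closed u'.hom_closed)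
  then show ?thesis using X u.hom_closed u'.hom_closed by (simp add: H.inv_solve_right')
qed

end

section \<open>The completed graded ring and the extension of maps into strict Dieudonne
  algebras\<close>

locale pre_dga =
  fixes D :: "('a, 'm) dga_scheme"
  assumes Gr_comm_group: "comm_group (Gr D n)"
    and Diff_hom: "Diff D n \<in> hom (Gr D n) (Gr D (n + 1))"
    and GMult_l_hom: "y \<in> carrier (Gr D n) \<Longrightarrow> (\<lambda>x. GMult D m n x y) \<in> hom (Gr D m) (Gr D (m + n))"
    and GMult_r_hom: "x \<in> carrier (Gr D m) \<Longrightarrow> GMult D m n x \<in> hom (Gr D n) (Gr D (m + n))"
    and GOne_closed: "GOne D \<in> carrier (Gr D 0)"
begin

lemma Diff_closed: "x \<in> carrier (Gr D n) \<Longrightarrow> Diff D n x \<in> carrier (Gr D (n + 1))"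
  by (rule hom_in_carrier[OF Diff_hom])

lemma GMult_closed: "\<lbrakk>x \<in> carrier (Gr D m); y \<in> carrier (Gr D n)\<rbrakk> \<Longrightarrow> GMult D m n x y \<in> carrier (Gr D (m + n))"
  by (rule hom_in_carrier[OF GMult_r_hom])

end

locale pre_dga_completion = pre_dga D for D :: "('a, 'm) dga_scheme" + fixes p :: nat
begin

sublocale Gr: p_filtration "Gr D n" p for n
  by (intro p_filtration.intro Gr_comm_group)

abbreviation N where "N n r \<equiv> multiples (p ^ r) (Gr D n)"
abbreviation PC where "PC \<equiv> p_completed p D"
abbreviation tc where "tc n \<equiv> to_completion (Gr D n) (N n)"

lemma Gr_PC: "Gr PC n = completion (Gr D n) (N n)"
  by (simp add: p_completed_def)

lemma Diff_PC:
  assumes "x \<in> carrier (Gr D n)" "X r = N n r #>\<^bsub>Gr D n\<^esub> x"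
  shows "Diff PC n X r = N (n + 1) r #>\<^bsub>Gr D (n + 1)\<^esub> Diff D n x"
  using coset_map[OF Gr_comm_group Gr.multiples_subgroup Gr_comm_group Gr.multiples_subgroup Diff_hom
      hom_multiples[OF Diff_hom Gr.is_group Gr.is_group] assms(1), of "p ^ r" "p ^ r"]
  by (simp add: p_completed_def assms(2))

lemma GMult_PC:
  assumes "x \<in> carrier (Gr D m)" "X r = N m r #>\<^bsub>Gr D m\<^esub> x" "y \<in> carrier (Gr D n)" "Y r = N n r #>\<^bsub>Gr D n\<^esub> y"
  shows "GMult PC m n X Y r = N (m + n) r #>\<^bsub>Gr D (m + n)\<^esub> GMult D m n x y"
  using coset_map2[where f = "GMult D m n", OF Gr_comm_group Gr.multiples_subgroup Gr_comm_group Gr.multiples_subgroup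
      Gr_comm_group Gr.multiples_subgroup GMult_l_hom GMult_r_hom
      hom_multiples[OF GMult_l_hom Gr.is_group Gr.is_group]
      hom_multiples[OF GMult_r_hom Gr.is_group Gr.is_group] assms(1,3), of "p ^ r" "p ^ r" "p ^ r"]
  by (simp add: p_completed_def assms(2,4))

lemma GOne_PC: "GOne PC = tc 0 (GOne D)"
  by (simp add: p_completed_def to_completion_def)

lemma Diff_PC_closed: "X \<in> carrier (Gr PC n) \<Longrightarrow> Diff PC n X \<in> carrier (Gr PC (n + 1))"
  unfolding Gr_PC Gr.carrier_C_iff by (metis Diff_PC Diff_closed)

lemma GMult_PC_closed:
  assumes X: "X \<in> carrier (Gr PC m)" and Y: "Y \<in> carrier (Gr PC n)"
  shows "GMult PC m n X Y \<in> carrier (Gr PC (m + n))"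
  unfolding Gr_PC Gr.carrier_C_iff
proof
  fix r
  obtain x where x: "x \<in> carrier (Gr D m)" "X r = N m r #>\<^bsub>Gr D m\<^esub> x" "X (Suc r) = N m (Suc r) #>\<^bsub>Gr D m\<^esub> x"
    using X unfolding Gr_PC Gr.carrier_C_iff by blast
  obtain y where y: "y \<in> carrier (Gr D n)" "Y r = N n r #>\<^bsub>Gr D n\<^esub> y" "Y (Suc r) = N n (Suc r) #>\<^bsub>Gr D n\<^esub> y"
    using Y unfolding Gr_PC Gr.carrier_C_iff by blast
  show "\<exists>z\<in>carrier (Gr D (m + n)). GMult PC m n X Y r = N (m + n) r #>\<^bsub>Gr D (m + n)\<^esub> z \<and>
      GMult PC m n X Y (Suc r) = N (m + n) (Suc r) #>\<^bsub>Gr D (m + n)\<^esub> z"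
    using GMult_PC[of x m X r y n Y] GMult_PC[of x m X "Suc r" y n Y] x y GMult_closed by blast
qed

lemma tc_closed: "x \<in> carrier (Gr D n) \<Longrightarrow> tc n x \<in> carrier (Gr PC n)"
  unfolding Gr_PC by (rule Gr.to_completion_closed)

lemma tc_graded_ring_hom: "tc \<in> graded_ring_hom D PC"
  unfolding graded_ring_hom_def mem_Collect_eq
proof (intro conjI allI ballI)
  show "tc n \<in> hom (Gr D n) (Gr PC n)" for n
    unfolding Gr_PC by (intro homI Gr.to_completion_closed Gr.to_completion_mult)
  show "tc (m + n) (GMult D m n x y) = GMult PC m n (tc m x) (tc n y)"
    if "x \<in> carrier (Gr D m)" "y \<in> carrier (Gr D n)" for m n x y
    by (rule ext, subst GMult_PC[OF that(1) _ that(2)]) (simp_all add: to_completion_def)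
qed (simp add: GOne_PC)

lemma Diff_tc: "x \<in> carrier (Gr D n) \<Longrightarrow> Diff PC n (tc n x) = tc (n + 1) (Diff D n x)"
  by (rule ext, subst Diff_PC) (simp_all add: to_completion_def)

end

locale pre_dga_extension = pre_dga_completion D p + A: strict_dieudonne_algebra A p F
  for D :: "('a, 'm) dga_scheme" and A :: "('b, 'n) dga_scheme" and p F +
  fixes g
  assumes g: "g \<in> graded_ring_hom D A"
    and g_Diff: "x \<in> carrier (Gr D n) \<Longrightarrow> g (n + 1) (Diff D n x) = Diff A n (g n x)"
begin

lemma g_closed [simp]: "x \<in> carrier (Gr D n) \<Longrightarrow> g n x \<in> carrier (Gr A n)"
  by (rule graded_ring_homD(2)[OF g])

text \<open>The comparison of topologies: g preserves multiples of p^r, and in the target these lie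
  in the standard filtration, where strictness provides limits.\<close>

lemma g_N: "x \<in> N n r \<Longrightarrow> g n x \<in> A.Fil n r"
  using hom_multiples[OF graded_ring_homD(1)[OF g] Gr.is_group A.Gr.is_group, of x "p ^ r" n]
    A.multiples_subset_Fil by blast

lemma g_cong:
  assumes "x \<in> carrier (Gr D n)" "y \<in> carrier (Gr D n)" "N n r #>\<^bsub>Gr D n\<^esub> x = N n r #>\<^bsub>Gr D n\<^esub> y"
  shows "g n x \<otimes>\<^bsub>Gr A n\<^esub> inv\<^bsub>Gr A n\<^esub> g n y \<in> A.Fil n r"
proof -
  interpret g: group_hom "Gr D n" "Gr A n" "g n"
    by (intro group_hom.intro group_hom_axioms.intro Gr.is_group A.Gr.is_group graded_ring_homD(1)[OF g])
  have "x \<otimes>\<^bsub>Gr D n\<^esub> inv\<^bsub>Gr D n\<^esub> y \<in> N n r"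
    using Gr.rcos_eq_iff[OF Gr.multiples_subgroup assms(1,2)] assms(3) by blast
  from g_N[OF this] show ?thesis using assms(1,2) by simp
qed

text \<open>\<open>a\<close> is the limit of the values of \<open>g\<close> at representatives of \<open>X\<close>.\<close>
definition is_value :: "int \<Rightarrow> (nat \<Rightarrow> 'a set) \<Rightarrow> 'b \<Rightarrow> bool" where
  "is_value n X a \<longleftrightarrow> a \<in> carrier (Gr A n) \<and> (\<forall>r. \<exists>x\<in>carrier (Gr D n).
     X r = N n r #>\<^bsub>Gr D n\<^esub> x \<and> g n x \<otimes>\<^bsub>Gr A n\<^esub> inv\<^bsub>Gr A n\<^esub> a \<in> A.Fil n r)"

lemma is_valueE:
  assumes "is_value n X a"
  obtains x where "x \<in> carrier (Gr D n)" "X r = N n r #>\<^bsub>Gr D n\<^esub> x"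
    "g n x \<otimes>\<^bsub>Gr A n\<^esub> inv\<^bsub>Gr A n\<^esub> a \<in> A.Fil n r"
  using assms unfolding is_value_def by blast

lemma is_value_unique:
  assumes a: "is_value n X a" and b: "is_value n X b"
  shows "a = b"
proof (rule A.Fil_separated_eq)
  show ac: "a \<in> carrier (Gr A n)" and bc: "b \<in> carrier (Gr A n)" using a b by (auto simp: is_value_def)
  fix r
  obtain x where x: "x \<in> carrier (Gr D n)" "X r = N n r #>\<^bsub>Gr D n\<^esub> x"
    "g n x \<otimes>\<^bsub>Gr A n\<^esub> inv\<^bsub>Gr A n\<^esub> a \<in> A.Fil n r" using a by (rule is_valueE)
  obtain y where y: "y \<in> carrier (Gr D n)" "X r = N n r #>\<^bsub>Gr D n\<^esub> y"
    "g n y \<otimes>\<^bsub>Gr A n\<^esub> inv\<^bsub>Gr A n\<^esub> b \<in> A.Fil n r" using b by (rule is_valueE)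
  have xy: "g n x \<otimes>\<^bsub>Gr A n\<^esub> inv\<^bsub>Gr A n\<^esub> g n y \<in> A.Fil n r" using x y by (intro g_cong) auto
  note S = A.Fil_subgroup[of n r]
  have "a \<otimes>\<^bsub>Gr A n\<^esub> inv\<^bsub>Gr A n\<^esub> g n x \<in> A.Fil n r"
    using A.Gr.cong_sym[OF S g_closed[OF x(1)] ac x(3)] .
  from A.Gr.cong_trans[OF S ac g_closed[OF x(1)] g_closed[OF y(1)] this xy]
  have "a \<otimes>\<^bsub>Gr A n\<^esub> inv\<^bsub>Gr A n\<^esub> g n y \<in> A.Fil n r" .
  from A.Gr.cong_trans[OF S ac g_closed[OF y(1)] bc this y(3)]
  show "a \<otimes>\<^bsub>Gr A n\<^esub> inv\<^bsub>Gr A n\<^esub> b \<in> A.Fil n r" .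
qed

lemma is_value_exists:
  assumes X: "X \<in> carrier (Gr PC n)"
  shows "\<exists>a. is_value n X a"
proof -
  have "\<forall>r. \<exists>x. x \<in> carrier (Gr D n) \<and> X r = N n r #>\<^bsub>Gr D n\<^esub> x \<and> X (Suc r) = N n (Suc r) #>\<^bsub>Gr D n\<^esub> x"
    using X unfolding Gr_PC Gr.carrier_C_iff by blast
  then obtain s where s: "\<And>r. s r \<in> carrier (Gr D n)" "\<And>r. X r = N n r #>\<^bsub>Gr D n\<^esub> s r"
    "\<And>r. X (Suc r) = N n (Suc r) #>\<^bsub>Gr D n\<^esub> s r" by metis
  have "g n (s (Suc r)) \<otimes>\<^bsub>Gr A n\<^esub> inv\<^bsub>Gr A n\<^esub> g n (s r) \<in> A.Fil n r" for r
  proof -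
    \<comment> \<open>\<open>s r\<close> was chosen to represent X at level \<open>Suc r\<close> as
      well, so both elements represent the same coset there.\<close>
    have "g n (s (Suc r)) \<otimes>\<^bsub>Gr A n\<^esub> inv\<^bsub>Gr A n\<^esub> g n (s r) \<in> A.Fil n (Suc r)"
      using s(2)[of "Suc r"] s(3)[of r] by (intro g_cong s(1)) simp
    then show ?thesis using A.Fil_Suc_subset by blast
  qed
  from A.Fil_complete[of "\<lambda>r. g n (s r)", OF g_closed[OF s(1)] this]
  obtain a where "a \<in> carrier (Gr A n)" "\<And>r. g n (s r) \<otimes>\<^bsub>Gr A n\<^esub> inv\<^bsub>Gr A n\<^esub> a \<in> A.Fil n r" by blast
  then have "is_value n X a" unfolding is_value_def using s(1,2) by blast
  then show ?thesis by blast
qed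

lemma is_value_add:
  assumes a: "is_value n X a" and b: "is_value n Y b"
  shows "is_value n (X \<otimes>\<^bsub>Gr PC n\<^esub> Y) (a \<otimes>\<^bsub>Gr A n\<^esub> b)"
  unfolding is_value_def
proof (intro conjI allI)
  have ac: "a \<in> carrier (Gr A n)" and bc: "b \<in> carrier (Gr A n)" using a b by (auto simp: is_value_def)
  then show "a \<otimes>\<^bsub>Gr A n\<^esub> b \<in> carrier (Gr A n)" by simp
  fix r
  obtain x where x: "x \<in> carrier (Gr D n)" "X r = N n r #>\<^bsub>Gr D n\<^esub> x"
    "g n x \<otimes>\<^bsub>Gr A n\<^esub> inv\<^bsub>Gr A n\<^esub> a \<in> A.Fil n r" using a by (rule is_valueE)
  obtain y where y: "y \<in> carrier (Gr D n)" "Y r = N n r #>\<^bsub>Gr D n\<^esub> y"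
    "g n y \<otimes>\<^bsub>Gr A n\<^esub> inv\<^bsub>Gr A n\<^esub> b \<in> A.Fil n r" using b by (rule is_valueE)
  have "g n (x \<otimes>\<^bsub>Gr D n\<^esub> y) \<otimes>\<^bsub>Gr A n\<^esub> inv\<^bsub>Gr A n\<^esub> (a \<otimes>\<^bsub>Gr A n\<^esub> b) \<in> A.Fil n r"
    unfolding graded_ring_homD(3)[OF g x(1) y(1)]
    by (rule A.Gr.cong_mult[OF A.Fil_subgroup g_closed[OF x(1)] g_closed[OF y(1)] ac bc x(3) y(3)])
  moreover have "(X \<otimes>\<^bsub>Gr PC n\<^esub> Y) r = N n r #>\<^bsub>Gr D n\<^esub> (x \<otimes>\<^bsub>Gr D n\<^esub> y)"
    unfolding Gr_PC Gr.mult_C x(2) y(2) by (rule Gr.rcos_sum'[OF Gr.multiples_subgroup x(1) y(1)])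
  ultimately show "\<exists>z\<in>carrier (Gr D n). (X \<otimes>\<^bsub>Gr PC n\<^esub> Y) r = N n r #>\<^bsub>Gr D n\<^esub> z \<and>
      g n z \<otimes>\<^bsub>Gr A n\<^esub> inv\<^bsub>Gr A n\<^esub> (a \<otimes>\<^bsub>Gr A n\<^esub> b) \<in> A.Fil n r" using x(1) y(1) by blast
qed

text \<open>g(x) g(y) - a b = (g(x) - a) g(y) + a (g(y) - b), and the filtration is an ideal on both
  sides.\<close>

lemma is_value_mult:
  assumes a: "is_value m X a" and b: "is_value n Y b"
  shows "is_value (m + n) (GMult PC m n X Y) (GMult A m n a b)"
  unfolding is_value_def
proof (intro conjI allI)
  have ac: "a \<in> carrier (Gr A m)" and bc: "b \<in> carrier (Gr A n)" using a b by (auto simp: is_value_def)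
  then show "GMult A m n a b \<in> carrier (Gr A (m + n))" by (rule A.GMult_closed)
  fix r
  obtain x where x: "x \<in> carrier (Gr D m)" "X r = N m r #>\<^bsub>Gr D m\<^esub> x"
    "g m x \<otimes>\<^bsub>Gr A m\<^esub> inv\<^bsub>Gr A m\<^esub> a \<in> A.Fil m r" using a by (rule is_valueE)
  obtain y where y: "y \<in> carrier (Gr D n)" "Y r = N n r #>\<^bsub>Gr D n\<^esub> y"
    "g n y \<otimes>\<^bsub>Gr A n\<^esub> inv\<^bsub>Gr A n\<^esub> b \<in> A.Fil n r" using b by (rule is_valueE)
  note gx = g_closed[OF x(1)] and gy = g_closed[OF y(1)]
  have "GMult A m n (g m x) (g n y) \<otimes>\<^bsub>Gr A (m + n)\<^esub> inv\<^bsub>Gr A (m + n)\<^esub> GMult A m n a (g n y) \<in> A.Fil (m + n) r"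
    using A.Fil_ideal_r[OF x(3) gy] ac gx gy by (simp add: A.GMult_l_distr A.GMult_l_inv)
  moreover have "GMult A m n a (g n y) \<otimes>\<^bsub>Gr A (m + n)\<^esub> inv\<^bsub>Gr A (m + n)\<^esub> GMult A m n a b \<in> A.Fil (m + n) r"
    using A.Fil_ideal_l[OF y(3) ac] ac bc gy by (simp add: A.GMult_r_distr A.GMult_r_inv)
  ultimately have "g (m + n) (GMult D m n x y) \<otimes>\<^bsub>Gr A (m + n)\<^esub> inv\<^bsub>Gr A (m + n)\<^esub> GMult A m n a b \<in> A.Fil (m + n) r"
    unfolding graded_ring_homD(4)[OF g x(1) y(1)]
    by (rule A.Gr.cong_trans[OF A.Fil_subgroup A.GMult_closed[OF gx gy] A.GMult_closed[OF ac gy] A.GMult_closed[OF ac bc]])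
  then show "\<exists>z\<in>carrier (Gr D (m + n)). GMult PC m n X Y r = N (m + n) r #>\<^bsub>Gr D (m + n)\<^esub> z \<and>
      g (m + n) z \<otimes>\<^bsub>Gr A (m + n)\<^esub> inv\<^bsub>Gr A (m + n)\<^esub> GMult A m n a b \<in> A.Fil (m + n) r"
    using GMult_PC[where X = X and Y = Y and r = r, OF x(1,2) y(1,2)] GMult_closed[OF x(1) y(1)] by blast
qed

lemma is_value_Diff:
  assumes a: "is_value n X a"
  shows "is_value (n + 1) (Diff PC n X) (Diff A n a)"
  unfolding is_value_def
proof (intro conjI allI)
  have ac: "a \<in> carrier (Gr A n)" using a by (auto simp: is_value_def)
  then show "Diff A n a \<in> carrier (Gr A (n + 1))" by simp
  fix r
  obtain x where x: "x \<in> carrier (Gr D n)" "X r = N n r #>\<^bsub>Gr D n\<^esub> x"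
    "g n x \<otimes>\<^bsub>Gr A n\<^esub> inv\<^bsub>Gr A n\<^esub> a \<in> A.Fil n r" using a by (rule is_valueE)
  have "g (n + 1) (Diff D n x) \<otimes>\<^bsub>Gr A (n + 1)\<^esub> inv\<^bsub>Gr A (n + 1)\<^esub> Diff A n a \<in> A.Fil (n + 1) r"
    using A.Diff_Fil[OF x(3)] ac g_closed[OF x(1)] by (simp add: g_Diff[OF x(1)])
  then show "\<exists>z\<in>carrier (Gr D (n + 1)). Diff PC n X r = N (n + 1) r #>\<^bsub>Gr D (n + 1)\<^esub> z \<and>
      g (n + 1) z \<otimes>\<^bsub>Gr A (n + 1)\<^esub> inv\<^bsub>Gr A (n + 1)\<^esub> Diff A n a \<in> A.Fil (n + 1) r"
    using Diff_PC[where X = X and r = r, OF x(1,2)] Diff_closed[OF x(1)] by blast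
qed

lemma is_value_tc: "x \<in> carrier (Gr D n) \<Longrightarrow> is_value n (tc n x) (g n x)"
  unfolding is_value_def by (auto simp: to_completion_def A.Fil_one intro!: bexI[of _ x])

lemma completion_extension:
  obtains G where "G \<in> graded_ring_hom PC A" "\<And>n. G n \<in> extensional (carrier (Gr PC n))"
    "\<And>n X. X \<in> carrier (Gr PC n) \<Longrightarrow> G (n + 1) (Diff PC n X) = Diff A n (G n X)"
    "\<And>n x. x \<in> carrier (Gr D n) \<Longrightarrow> G n (tc n x) = g n x"
proof -
  \<comment> \<open>The restriction supplies the normalisation off the carriers that equality of
    morphisms relies on.\<close>
  define G where "G n = restrict (\<lambda>X. THE a. is_value n X a) (carrier (Gr PC n))" for n
  have G: "is_value n X (G n X)" if "X \<in> carrier (Gr PC n)" for n X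
    using theI'[of "is_value n X"] is_value_exists[OF that] is_value_unique that unfolding G_def by auto
  have G_eq: "G n X = a" if "X \<in> carrier (Gr PC n)" "is_value n X a" for n X a
    using G is_value_unique that by blast
  have Gc: "G n X \<in> carrier (Gr A n)" if "X \<in> carrier (Gr PC n)" for n X
    using G[OF that] by (simp add: is_value_def)
  show thesis
  proof (rule that)
    show "G \<in> graded_ring_hom PC A"
      unfolding graded_ring_hom_def mem_Collect_eq
    proof (intro conjI allI ballI)
      show "G n \<in> hom (Gr PC n) (Gr A n)" for n
      proof (rule homI)
        show "G n (X \<otimes>\<^bsub>Gr PC n\<^esub> Y) = G n X \<otimes>\<^bsub>Gr A n\<^esub> G n Y"
          if "X \<in> carrier (Gr PC n)" "Y \<in> carrier (Gr PC n)" for X Y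
          using that Gr.C_mult_closed[of X n Y] by (intro G_eq is_value_add G) (auto simp: Gr_PC)
      qed (rule Gc)
      show "G (m + n) (GMult PC m n X Y) = GMult A m n (G m X) (G n Y)"
        if "X \<in> carrier (Gr PC m)" "Y \<in> carrier (Gr PC n)" for m n X Y
        using that by (intro G_eq is_value_mult G GMult_PC_closed)
      show "G 0 (GOne PC) = GOne A"
        using is_value_tc[OF GOne_closed] tc_closed[OF GOne_closed] graded_ring_homD(5)[OF g]
        by (simp add: GOne_PC G_eq)
    qed
    show "G n \<in> extensional (carrier (Gr PC n))" for n by (simp add: G_def)
    show "G (n + 1) (Diff PC n X) = Diff A n (G n X)" if "X \<in> carrier (Gr PC n)" for n X
      using that by (intro G_eq is_value_Diff G Diff_PC_closed)
    show "G n (tc n x) = g n x" if "x \<in> carrier (Gr D n)" for n x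
      using that by (intro G_eq is_value_tc tc_closed)
  qed
qed

end

lemma (in derham_ring) derham_pre_dga: "pre_dga (derham S)"
proof (rule pre_dga.intro)
  show "comm_group (Gr (derham S) n)" for n by (rule Gr_derham_group)
  interpret G: comm_group "Gr (derham S) n" for n by (rule Gr_derham_group)
  have c: "v \<in> carrier (derham_free S n) \<Longrightarrow> cls n v \<in> carrier (Gr (derham S) n)" for v n
    by (simp add: carrier_Gr_derham)
  have m: "cls n v \<otimes>\<^bsub>Gr (derham S) n\<^esub> cls n v' = cls n (v + v')"
    if "v \<in> carrier (derham_free S n)" "v' \<in> carrier (derham_free S n)" for v v' n
    using hom_mult[OF cls_hom that] by simp
  have k: "Poly_Mapping.keys (v + v') \<subseteq> gens n"
    if "Poly_Mapping.keys v \<subseteq> gens n" "Poly_Mapping.keys v' \<subseteq> gens n" for v v' n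
    using that keys_add[of v v'] by blast
  show "Diff (derham S) n \<in> hom (Gr (derham S) n) (Gr (derham S) (n + 1))" for n
    by (rule homI) (auto simp: carrier_Gr_derham Diff_cls m k derham_diff_closed derham_diff_add)
  show "(\<lambda>X. GMult (derham S) m n X Y) \<in> hom (Gr (derham S) m) (Gr (derham S) (m + n))"
    if "Y \<in> carrier (Gr (derham S) n)" for Y m n
    using that by (intro homI) (auto simp: carrier_Gr_derham GMult_cls m k derham_mult_closed derham_mult_add_left)
  show "GMult (derham S) m n X \<in> hom (Gr (derham S) n) (Gr (derham S) (m + n))"
    if "X \<in> carrier (Gr (derham S) m)" for X m n
    using that by (intro homI) (auto simp: carrier_Gr_derham GMult_cls m k derham_mult_closed derham_mult_add_right)
  show "GOne (derham S) \<in> carrier (Gr (derham S) 0)"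
    unfolding GOne_cls by (rule c) (simp add: keys_frag_of gens_iff)
qed

section \<open>The universal property\<close>

lemma (in cring) multiples_ideal: "ideal (multiples q (add_monoid R)) R"
proof (rule idealI[OF ring_axioms])
  show "subgroup (multiples q (add_monoid R)) (add_monoid R)"
    by (rule comm_group.multiples_subgroup[OF a_comm_group])
  show "a \<otimes> x \<in> multiples q (add_monoid R)" "x \<otimes> a \<in> multiples q (add_monoid R)"
    if "a \<in> multiples q (add_monoid R)" "x \<in> carrier R" for a x
    using that by (auto simp: multiples_add_monoid add_pow_ldistr add_pow_rdistr)
qed

lemma graded_ring_hom_compose:
  assumes a: "a \<in> graded_ring_hom A B" and b: "b \<in> graded_ring_hom B C"
  shows "(\<lambda>n x. b n (a n x)) \<in> graded_ring_hom A C"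
  unfolding graded_ring_hom_def mem_Collect_eq
proof (intro conjI allI ballI)
  show "(\<lambda>x. b n (a n x)) \<in> hom (Gr A n) (Gr C n)" for n
    using hom_compose[OF graded_ring_homD(1)[OF a] graded_ring_homD(1)[OF b]] by (simp add: o_def)
  show "b (m + n) (a (m + n) (GMult A m n x y)) = GMult C m n (b m (a m x)) (b n (a n y))"
    if "x \<in> carrier (Gr A m)" "y \<in> carrier (Gr A n)" for m n x y
    using that graded_ring_homD(2)[OF a]
    by (simp add: graded_ring_homD(4)[OF a] graded_ring_homD(4)[OF b])
qed (simp add: graded_ring_homD(5)[OF a] graded_ring_homD(5)[OF b])

lemma graded_ring_hom_cong:
  assumes a: "a \<in> graded_ring_hom A B" and eq: "\<And>n x. x \<in> carrier (Gr A n) \<Longrightarrow> b n x = a n x"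
    and cl: "\<And>n x y. \<lbrakk>x \<in> carrier (Gr A n); y \<in> carrier (Gr A n)\<rbrakk> \<Longrightarrow> x \<otimes>\<^bsub>Gr A n\<^esub> y \<in> carrier (Gr A n)"
      "\<And>m n x y. \<lbrakk>x \<in> carrier (Gr A m); y \<in> carrier (Gr A n)\<rbrakk> \<Longrightarrow> GMult A m n x y \<in> carrier (Gr A (m + n))"
      "GOne A \<in> carrier (Gr A 0)"
  shows "b \<in> graded_ring_hom A B"
  using graded_ring_homD[OF a] by (auto simp: graded_ring_hom_def hom_def Pi_def eq cl)

text \<open>In multiplicative notation, the power rule for a derivation. With \<open>Suc n\<close> =
  p it is the source of the term x^(p-1) dx in the Frobenius of dx.\<close>

lemma (in cdga) Diff_deg0_pow:
  assumes y: "y \<in> carrier (Gr A 0)"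
  shows "Diff A 0 (y [^]\<^bsub>deg0_ring A\<^esub> Suc n) =
    GMult A 0 1 (y [^]\<^bsub>deg0_ring A\<^esub> n) (Diff A 0 y) [^]\<^bsub>Gr A 1\<^esub> Suc n"
proof (induction n)
  case 0
  then show ?case using y Diff_closed1[OF y] by (simp add: GMult_l_one[of _ 0] GMult_l_one)
next
  case (Suc n)
  interpret R: cring "deg0_ring A" by (rule deg0_cring)
  have yn: "y [^]\<^bsub>deg0_ring A\<^esub> k \<in> carrier (Gr A 0)" for k :: nat
    using R.nat_pow_closed[of y k] y by simp
  let ?t = "GMult A 0 1 (y [^]\<^bsub>deg0_ring A\<^esub> n) (Diff A 0 y)"
  let ?u = "GMult A 0 1 (y [^]\<^bsub>deg0_ring A\<^esub> Suc n) (Diff A 0 y)"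
  have dy: "Diff A 0 y \<in> carrier (Gr A 1)" using Diff_closed1 y .
  have t: "?t \<in> carrier (Gr A 1)" and u: "?u \<in> carrier (Gr A 1)"
    by (rule GMult_closed'[OF yn dy], simp)+
  have c: "GMult A 0 0 y (y [^]\<^bsub>deg0_ring A\<^esub> n) = y [^]\<^bsub>deg0_ring A\<^esub> Suc n"
    using R.m_comm[of y "y [^]\<^bsub>deg0_ring A\<^esub> n"] y yn by simp
  have "Diff A 0 (y [^]\<^bsub>deg0_ring A\<^esub> Suc (Suc n)) = Diff A 0 (GMult A 0 0 (y [^]\<^bsub>deg0_ring A\<^esub> Suc n) y)" by simp
  also have "\<dots> = GMult A 0 1 y (?t [^]\<^bsub>Gr A 1\<^esub> Suc n) \<otimes>\<^bsub>Gr A 1\<^esub> ?u"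
    by (subst Diff_deg0_mult[OF yn y]) (simp only: Suc)
  also have "GMult A 0 1 y (?t [^]\<^bsub>Gr A 1\<^esub> Suc n) = GMult A 0 1 y ?t [^]\<^bsub>Gr A 1\<^esub> Suc n"
    using GMult_r_pow[OF y t, of "Suc n"] by simp
  also have "GMult A 0 1 y ?t = ?u"
    using GMult_deg0_deg0[OF y yn dy] by (simp only: c)
  finally show ?case using u by simp
qed

section \<open>Morphisms from the completed de Rham complex to a strict Dieudonne algebra\<close>

locale derham_frobenius_target = S: frobenius_lift_ring S p \<phi> + A: strict_dieudonne_algebra A p FA
  for S :: "('s, 'k) ring_scheme" (structure) and p \<phi> and A :: "('b, 'n) dga_scheme" and FA +
  fixes F assumes F: "derham_frobenius p S \<phi> F"
begin

sublocale derham_ring S ..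

sublocale pre_dga_completion "derham S" p
  by (intro pre_dga_completion.intro derham_pre_dga)

abbreviation Dx where "Dx \<equiv> derham_of_ring p S"

lemma Dx_eq: "Dx x = tc 0 (cls 0 (frag_of (x, [])))"
  by (simp add: derham_of_ring_def)

lemma cls_deg0_closed: "x \<in> carrier S \<Longrightarrow> cls 0 (frag_of (x, [])) \<in> carrier (Gr (derham S) 0)"
  by (simp add: carrier_Gr_derham keys_frag_of gens_iff)

lemma Dx_closed: "x \<in> carrier S \<Longrightarrow> Dx x \<in> carrier (Gr PC 0)"
  unfolding Dx_eq by (intro tc_closed cls_deg0_closed)

lemma Dx_add: "\<lbrakk>x \<in> carrier S; y \<in> carrier S\<rbrakk> \<Longrightarrow> Dx (x \<oplus> y) = Dx x \<otimes>\<^bsub>Gr PC 0\<^esub> Dx y"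
proof -
  assume x: "x \<in> carrier S" and y: "y \<in> carrier S"
  let ?f = "\<lambda>x. frag_of (x, [])"
  have "?f (x \<oplus> y) - ?f x - ?f y \<in> null 0"
    using x y by (intro rels_null derham_rels.coeff_add) (auto simp: gens_iff)
  then have "?f (x \<oplus> y) - (?f x + ?f y) \<in> null 0" by (simp add: diff_diff_eq)
  moreover have "Poly_Mapping.keys (?f x + ?f y) \<subseteq> gens 0"
    using keys_add[of "?f x" "?f y"] x y by (auto simp: keys_frag_of gens_iff)
  ultimately have "cls 0 (?f (x \<oplus> y)) = cls 0 (?f x + ?f y)"
    unfolding derham_class_def using x y
    by (subst comm_group.rcos_eq_iff[OF abelian_free_Abelian_group null_subgroup]) (auto simp: keys_frag_of gens_iff algebra_simps)
  also have "\<dots> = cls 0 (?f x) \<otimes>\<^bsub>Gr (derham S) 0\<^esub> cls 0 (?f y)"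
    using hom_mult[OF cls_hom, of "?f x" 0 "?f y"] x y by (simp add: keys_frag_of gens_iff)
  finally show ?thesis
    unfolding Dx_eq using graded_ring_homD(3)[OF tc_graded_ring_hom cls_deg0_closed[OF x] cls_deg0_closed[OF y]] by simp
qed

lemma Dx_mult: "\<lbrakk>x \<in> carrier S; y \<in> carrier S\<rbrakk> \<Longrightarrow> Dx (x \<otimes> y) = GMult PC 0 0 (Dx x) (Dx y)"
  unfolding Dx_eq
  using graded_ring_homD(4)[OF tc_graded_ring_hom cls_deg0_closed cls_deg0_closed, of x y]
    GMult_cls[of "frag_of (x, [])" 0 "frag_of (y, [])" 0] by (simp add: keys_frag_of gens_iff)

lemma Dx_one: "Dx \<one> = GOne PC"
  by (simp add: Dx_eq GOne_PC GOne_cls)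

lemma Dx_hom:
  assumes v: "v \<in> graded_ring_hom PC B"
  shows "(\<lambda>x. v 0 (Dx x)) \<in> ring_hom S (deg0_ring B)"
  using graded_ring_homD(2)[OF v Dx_closed] graded_ring_homD(3)[OF v Dx_closed Dx_closed]
    graded_ring_homD(4)[OF v Dx_closed Dx_closed] graded_ring_homD(5)[OF v]
  by (intro ring_hom_memI) (simp_all add: deg0_ring_def Dx_add Dx_mult Dx_one)

text \<open>Multiples of p^r lie in level r of the filtration, so A is p-adically separated and maps
  on the completion are determined on the image of the de Rham complex. There the degree 0 elements
  and exact one-forms suffice.\<close>

lemma completed_derham_hom_ext:
  assumes v: "v \<in> graded_ring_hom PC A" and v': "v' \<in> graded_ring_hom PC A"
    and 0: "\<And>x. x \<in> carrier S \<Longrightarrow> v 0 (Dx x) = v' 0 (Dx x)"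
    and 1: "\<And>x. x \<in> carrier S \<Longrightarrow> v 1 (Diff PC 0 (Dx x)) = v' 1 (Diff PC 0 (Dx x))"
    and X: "X \<in> carrier (Gr PC n)"
  shows "v n X = v' n X"
proof (rule Gr.completion_hom_ext[OF A.comm_group_Gr])
  show "v n \<in> hom (completion (Gr (derham S) n) (N n)) (Gr A n)"
    "v' n \<in> hom (completion (Gr (derham S) n) (N n)) (Gr A n)"
    using graded_ring_homD(1)[OF v] graded_ring_homD(1)[OF v'] by (simp_all add: Gr_PC)
  show "X \<in> carrier (completion (Gr (derham S) n) (N n))" using X by (simp add: Gr_PC)
  show "a = \<one>\<^bsub>Gr A n\<^esub>" if "a \<in> carrier (Gr A n)" "\<And>r. a \<in> multiples (p ^ r) (Gr A n)" for a
    using that A.multiples_subset_Fil by (intro A.Fil_separated) blast+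
  show "v n (tc n x) = v' n (tc n x)" if x: "x \<in> carrier (Gr (derham S) n)" for x
  proof (rule derham_hom_ext[OF graded_ring_hom_compose[OF tc_graded_ring_hom v]
        graded_ring_hom_compose[OF tc_graded_ring_hom v'] A.comm_group_Gr _ _ x])
    fix x assume x: "x \<in> carrier S"
    show "v 0 (tc 0 (cls 0 (frag_of (x, [])))) = v' 0 (tc 0 (cls 0 (frag_of (x, []))))"
      using 0[OF x] by (simp add: Dx_eq)
    show "v 1 (tc 1 (Diff (derham S) 0 (cls 0 (frag_of (x, []))))) =
        v' 1 (tc 1 (Diff (derham S) 0 (cls 0 (frag_of (x, [])))))"
      using 1[OF x] Diff_tc[OF cls_deg0_closed[OF x]] by (simp add: Dx_eq)
  qed
qed

lemma F_hom: "F \<in> graded_ring_hom PC PC"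
  and F_Dx: "x \<in> carrier S \<Longrightarrow> F 0 (Dx x) = Dx (\<phi> x)"
  and F_Diff_Dx: "x \<in> carrier S \<Longrightarrow> F 1 (Diff PC 0 (Dx x)) =
        GMult PC 0 1 (Dx (x [^] (p - 1))) (Diff PC 0 (Dx x)) \<otimes>\<^bsub>Gr PC 1\<^esub> Diff PC 0 (Dx (S.\<delta> x))"
  using F by (simp_all add: derham_frobenius_def)

lemma dieudonne_hom_ext:
  assumes u: "u \<in> dieudonne_hom PC F A FA" and u': "u' \<in> dieudonne_hom PC F A FA"
    and 0: "\<And>x. x \<in> carrier S \<Longrightarrow> u 0 (Dx x) = u' 0 (Dx x)"
  shows "u = u'"
proof (intro ext)
  fix n X
  show "u n X = u' n X"
  proof (cases "X \<in> carrier (Gr PC n)")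
    case True
    show ?thesis
    proof (rule completed_derham_hom_ext[where v = u and v' = u', OF _ _ 0 _ True])
      show "u \<in> graded_ring_hom PC A" "u' \<in> graded_ring_hom PC A" using u u' by (auto simp: dieudonne_hom_def)
      fix x assume x: "x \<in> carrier S"
      have "u (0 + 1) (Diff PC 0 (Dx x)) = Diff A 0 (u 0 (Dx x))" "u' (0 + 1) (Diff PC 0 (Dx x)) = Diff A 0 (u' 0 (Dx x))"
        using u u' Dx_closed[OF x] unfolding dieudonne_hom_def by blast+
      then show "u 1 (Diff PC 0 (Dx x)) = u' 1 (Diff PC 0 (Dx x))" using 0[OF x] by simp
    qed
  next
    case False
    have "u n \<in> extensional (carrier (Gr PC n))" "u' n \<in> extensional (carrier (Gr PC n))"
      using u u' by (simp_all add: dieudonne_hom_def)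
    from this[THEN extensional_arb, OF False] show ?thesis by (rule trans[OF _ sym])
  qed
qed

text \<open>G F and F G are both homomorphisms of graded rings, so it is enough to compare them on
  the image of S and on the differentials of that image.\<close>

lemma dieudonne_hom_exists:
  assumes h: "h \<in> ring_hom S (deg0_ring A)" and hF: "\<And>x. x \<in> carrier S \<Longrightarrow> FA 0 (h x) = h (\<phi> x)"
  obtains u where "u \<in> dieudonne_hom PC F A FA" "\<And>x. x \<in> carrier S \<Longrightarrow> u 0 (Dx x) = h x"
proof -
  interpret l: derham_to_cdga S A h
    by (intro derham_to_cdga.intro derham_to_cdga_axioms.intro derham_ring_axioms A.cdga_axioms h)
  obtain g where g: "g \<in> graded_ring_hom (derham S) A"
    "\<And>n X. X \<in> carrier (Gr (derham S) n) \<Longrightarrow> g (n + 1) (Diff (derham S) n X) = Diff A n (g n X)"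
    and g0: "\<And>x. x \<in> carrier S \<Longrightarrow> g 0 (cls 0 (frag_of (x, []))) = h x"
    using l.derham_universal by blast
  interpret e: pre_dga_extension "derham S" A p FA g
    by (intro pre_dga_extension.intro pre_dga_extension_axioms.intro pre_dga_completion_axioms
        A.strict_dieudonne_algebra_axioms g)
  obtain G where G: "G \<in> graded_ring_hom PC A" and Ge: "\<And>n. G n \<in> extensional (carrier (Gr PC n))"
    and GD: "\<And>n X. X \<in> carrier (Gr PC n) \<Longrightarrow> G (n + 1) (Diff PC n X) = Diff A n (G n X)"
    and Gtc: "\<And>n x. x \<in> carrier (Gr (derham S) n) \<Longrightarrow> G n (tc n x) = g n x"
    using e.completion_extension by blast
  have GDx: "G 0 (Dx x) = h x" if "x \<in> carrier S" for x
    using Gtc[OF cls_deg0_closed[OF that]] g0[OF that] by (simp add: Dx_eq)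
  have GDDx: "G 1 (Diff PC 0 (Dx x)) = Diff A 0 (h x)" if "x \<in> carrier S" for x
    using GD[OF Dx_closed[OF that]] GDx[OF that] by simp
  have dDx: "Diff PC 0 (Dx x) \<in> carrier (Gr PC 1)" if "x \<in> carrier S" for x
    using Diff_PC_closed[OF Dx_closed[OF that]] by simp
  interpret R: cring "deg0_ring A" by (rule A.deg0_cring)
  interpret h: ring_hom_cring S "deg0_ring A" h by unfold_locales (rule h)
  \<comment> \<open>p F(d h x) = d F(h x) = d(h(x)^p + p h(\<delta> x)), and by the power rule the
    right side is p times the asserted value; p is then cancelled.\<close>
  have FD: "FA 1 (Diff A 0 (h x)) = GMult A 0 1 (h (x [^] (p - 1))) (Diff A 0 (h x)) \<otimes>\<^bsub>Gr A 1\<^esub> Diff A 0 (h (S.\<delta> x))"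
    if x: "x \<in> carrier S" for x
  proof (rule A.pow_cancel[where n = 1])
    have p: "Suc (p - 1) = p" using A.prime_p prime_gt_0_nat by force
    let ?t = "GMult A 0 1 (h (x [^] (p - 1))) (Diff A 0 (h x))"
    have t: "?t \<in> carrier (Gr A 1)"
      by (rule A.GMult_closed'[OF l.h_closed[OF S.nat_pow_closed[OF x]] l.dh_closed[OF x]]) simp
    have dd: "Diff A 0 (h (S.\<delta> x)) \<in> carrier (Gr A 1)" using x by simp
    show "FA 1 (Diff A 0 (h x)) \<in> carrier (Gr A 1)" using x by simp
    show "?t \<otimes>\<^bsub>Gr A 1\<^esub> Diff A 0 (h (S.\<delta> x)) \<in> carrier (Gr A 1)" using t dd by simp
    have hx: "h x [^]\<^bsub>deg0_ring A\<^esub> k \<in> carrier (Gr A 0)" for k :: nat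
      using R.nat_pow_closed[of "h x" k] x by simp
    have "FA 1 (Diff A 0 (h x)) [^]\<^bsub>Gr A 1\<^esub> p = Diff A 0 (FA 0 (h x))"
      using A.Diff_F[of "h x" 0] x by simp
    also have "\<dots> = Diff A 0 (h (x [^] p \<oplus> [p] \<cdot> S.\<delta> x))" using x hF S.delta by simp
    also have "h (x [^] p \<oplus> [p] \<cdot> S.\<delta> x) = h x [^]\<^bsub>deg0_ring A\<^esub> p \<otimes>\<^bsub>Gr A 0\<^esub> h (S.\<delta> x) [^]\<^bsub>Gr A 0\<^esub> p"
      using x h.hom_add_pow[of "S.\<delta> x" p] h.ring.hom_nat_pow[of x p] by (simp add: l.h_add)
    also have "Diff A 0 \<dots> = Diff A 0 (h x [^]\<^bsub>deg0_ring A\<^esub> p) \<otimes>\<^bsub>Gr A 1\<^esub> Diff A 0 (h (S.\<delta> x)) [^]\<^bsub>Gr A 1\<^esub> p"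
      using A.Diff.hom_mult[of "h x [^]\<^bsub>deg0_ring A\<^esub> p" 0 "h (S.\<delta> x) [^]\<^bsub>Gr A 0\<^esub> p"] hx x
        A.Diff.hom_nat_pow[of "h (S.\<delta> x)" 0 p] by simp
    also have "Diff A 0 (h x [^]\<^bsub>deg0_ring A\<^esub> p) = ?t [^]\<^bsub>Gr A 1\<^esub> p"
      using A.Diff_deg0_pow[of "h x" "p - 1"] x h.ring.hom_nat_pow[of x "p - 1"] by (simp only: p l.h_closed)
    finally show "FA 1 (Diff A 0 (h x)) [^]\<^bsub>Gr A 1\<^esub> p = (?t \<otimes>\<^bsub>Gr A 1\<^esub> Diff A 0 (h (S.\<delta> x))) [^]\<^bsub>Gr A 1\<^esub> p"
      using t dd by (simp add: A.Gr.nat_pow_distrib)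
  qed
  have "G n (F n X) = FA n (G n X)" if "X \<in> carrier (Gr PC n)" for n X
  proof (rule completed_derham_hom_ext[where v = "\<lambda>n X. G n (F n X)" and v' = "\<lambda>n X. FA n (G n X)",
        OF graded_ring_hom_compose[OF F_hom G] graded_ring_hom_compose[OF G A.F_ring_hom] _ _ that])
    fix x assume x: "x \<in> carrier S"
    show "G 0 (F 0 (Dx x)) = FA 0 (G 0 (Dx x))" using x by (simp add: F_Dx GDx hF)
    have xp: "x [^] (p - 1) \<in> carrier S" using x by simp
    have m: "GMult PC 0 1 (Dx (x [^] (p - 1))) (Diff PC 0 (Dx x)) \<in> carrier (Gr PC 1)"
      using GMult_PC_closed[OF Dx_closed[OF xp] dDx[OF x]] by simp
    show "G 1 (F 1 (Diff PC 0 (Dx x))) = FA 1 (G 1 (Diff PC 0 (Dx x)))"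
      using x xp m dDx graded_ring_hom_deg0[OF G Dx_closed[OF xp] dDx[OF x]]
      by (simp add: F_Diff_Dx GDDx FD GDx graded_ring_homD(3)[OF G])
  qed
  then have "G \<in> dieudonne_hom PC F A FA" unfolding dieudonne_hom_def using G Ge GD by blast
  then show thesis using GDx by (rule that)
qed

end

section \<open>Degree 0 cohomology modulo p and the proof of the universal property\<close>

lemma carrier_FactRing: "carrier (R Quot I) = (\<lambda>y. I +>\<^bsub>R\<^esub> y) ` carrier R"
  by (auto simp: FactRing_def A_RCOSETS_def RCOSETS_def a_r_coset_def)

lemma (in cdga) a_r_coset_deg0 [simp]: "H +>\<^bsub>deg0_ring A\<^esub> x = H #>\<^bsub>Gr A 0\<^esub> x"
  by (simp add: a_r_coset_def)

context strict_dieudonne_algebra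
begin

text \<open>p z = F (V z), and F is injective. This says that the map from A^0/VA^0 to A^0/pA^0
  induced by F is injective.\<close>

lemma F_in_multiples_iff:
  assumes a: "a \<in> carrier (Gr A 0)"
  shows "F 0 a \<in> multiples p (Gr A 0) \<longleftrightarrow> a \<in> V 0 ` carrier (Gr A 0)"
proof
  assume "F 0 a \<in> multiples p (Gr A 0)"
  then obtain z where z: "z \<in> carrier (Gr A 0)" "F 0 a = F 0 (V 0 z)" by (auto simp: multiples_def F_V)
  then show "a \<in> V 0 ` carrier (Gr A 0)" using F_eqD[of a 0 "V 0 z"] a by auto
qed (auto simp: multiples_def F_V)

text \<open>A representative of a cocycle modulo p has its differential in p A^1, which by
  saturation puts it in the image of F. This says that the map from A^0/VA^0 to H^0(A/pA) is
  surjective.\<close>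

lemma H0_modE:
  assumes "X \<in> carrier (H0_mod p A)"
  obtains b where "b \<in> carrier (Gr A 0)" "X = multiples p (Gr A 0) #>\<^bsub>Gr A 0\<^esub> F 0 b"
proof -
  have "X \<in> carrier (deg0_ring A Quot multiples p (Gr A 0))" and d: "Diff A 0 ` X \<subseteq> multiples p (Gr A 1)"
    using assms by (auto simp: H0_mod_def)
  then obtain a where a: "a \<in> carrier (Gr A 0)" "X = multiples p (Gr A 0) #>\<^bsub>Gr A 0\<^esub> a"
    unfolding carrier_FactRing by auto
  then have "a \<in> X" using Gr.rcos_self[OF a(1) Gr.multiples_subgroup] by simp
  then obtain b where "b \<in> carrier (Gr A 0)" "F 0 b = a" using F_image[OF a(1)] d by auto
  with a(2) show thesis using that by blast
qed

lemma H0_mod_ops: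
  "mult (H0_mod p A) = mult (deg0_ring A Quot multiples p (Gr A 0))"
  "add (H0_mod p A) = add (deg0_ring A Quot multiples p (Gr A 0))"
  "one (H0_mod p A) = one (deg0_ring A Quot multiples p (Gr A 0))"
  "carrier (H0_mod p A) \<subseteq> carrier (deg0_ring A Quot multiples p (Gr A 0))"
  by (auto simp: H0_mod_def)

end

lemma H0_mod_map_coset:
  assumes W: "cdga W" and A: "cdga A" and g: "g \<in> graded_ring_hom W A" and x: "x \<in> carrier (Gr W 0)"
  shows "H0_mod_map p A g (multiples p (Gr W 0) #>\<^bsub>Gr W 0\<^esub> x) = multiples p (Gr A 0) #>\<^bsub>Gr A 0\<^esub> g 0 x"
proof -
  interpret W: cdga W by (rule W)
  interpret A: cdga A by (rule A)
  show ?thesis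
    using coset_map[OF W.comm_group_Gr W.Gr.multiples_subgroup A.comm_group_Gr A.Gr.multiples_subgroup
      graded_ring_homD(1)[OF g] hom_multiples[OF graded_ring_homD(1)[OF g] W.Gr.is_group A.Gr.is_group] x]
    by (simp add: H0_mod_map_def)
qed

lemma dieudonne_hom_compose:
  assumes a: "a \<in> dieudonne_hom A F B G" and b: "b \<in> dieudonne_hom B G C H"
    and A: "\<And>n x y. \<lbrakk>x \<in> carrier (Gr A n); y \<in> carrier (Gr A n)\<rbrakk> \<Longrightarrow> x \<otimes>\<^bsub>Gr A n\<^esub> y \<in> carrier (Gr A n)"
      "\<And>m n x y. \<lbrakk>x \<in> carrier (Gr A m); y \<in> carrier (Gr A n)\<rbrakk> \<Longrightarrow> GMult A m n x y \<in> carrier (Gr A (m + n))"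
      "GOne A \<in> carrier (Gr A 0)"
      "\<And>n x. x \<in> carrier (Gr A n) \<Longrightarrow> Diff A n x \<in> carrier (Gr A (n + 1))"
      "\<And>n x. x \<in> carrier (Gr A n) \<Longrightarrow> F n x \<in> carrier (Gr A n)"
  shows "(\<lambda>n. restrict (\<lambda>x. b n (a n x)) (carrier (Gr A n))) \<in> dieudonne_hom A F C H"
proof -
  have ga: "a \<in> graded_ring_hom A B" and gb: "b \<in> graded_ring_hom B C"
    using a b by (auto simp: dieudonne_hom_def)
  have "(\<lambda>n. restrict (\<lambda>x. b n (a n x)) (carrier (Gr A n))) \<in> graded_ring_hom A C"
    by (rule graded_ring_hom_cong[OF graded_ring_hom_compose[OF ga gb]]) (auto simp: A)
  then show ?thesis using a b graded_ring_homD(2)[OF ga] A(4,5) by (auto simp: dieudonne_hom_def)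
qed

theorem theorem1p2p5:
  fixes p :: nat
    and k :: "'k ring" and R :: "'r ring" and \<alpha> :: "'k \<Rightarrow> 'r"
    and S :: "'s ring" and \<beta> :: "(nat \<Rightarrow> 'k) \<Rightarrow> 's" and \<theta> :: "'s set \<Rightarrow> 'r" and \<phi> :: "'s \<Rightarrow> 's"
    and F :: "int \<Rightarrow> (nat \<Rightarrow> (('s \<times> 's list) \<Rightarrow>\<^sub>0 int) set set)
                  \<Rightarrow> (nat \<Rightarrow> (('s \<times> 's list) \<Rightarrow>\<^sub>0 int) set set)"
    and W :: "'w dga" and FW :: "int \<Rightarrow> 'w \<Rightarrow> 'w"
    and \<iota> :: "int \<Rightarrow> (nat \<Rightarrow> (('s \<times> 's list) \<Rightarrow>\<^sub>0 int) set set) \<Rightarrow> 'w"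
    and A :: "'a dga" and FA :: "int \<Rightarrow> 'a \<Rightarrow> 'a"
    and f :: "'r \<Rightarrow> 'a set"
  assumes "perfect_field p k"
    and "smooth_algebra k R \<alpha>"
    and "saturated_derham_witt TYPE('a) p k R \<alpha> S \<beta> \<theta> \<phi> F W FW \<iota>"
    and "strict_dieudonne_algebra A p FA"
    and "f \<in> ring_hom R (H0_mod p A)"
  shows "\<exists>!g. g \<in> dieudonne_hom W FW A FA \<and>
    (\<forall>x\<in>carrier R. H0_mod_map p A g (canonical_rho p R S \<theta> \<phi> W \<iota> x) = f x)"
proof -
  note f = assms(5)
  have lift: "frobenius_lift p k R \<alpha> S \<beta> \<theta> \<phi>" and dF: "derham_frobenius p S \<phi> F"
    and sat: "completed_saturation TYPE('a) p (completed_derham p S) F W FW \<iota>"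
    using assms(3) by (auto simp: saturated_derham_witt_def)
  interpret A: strict_dieudonne_algebra A p FA by (rule assms(4))
  interpret W: strict_dieudonne_algebra W p FW using sat by (simp add: completed_saturation_def)
  interpret S: frobenius_lift_ring S p \<phi>
    using lift A.prime_p
    by (auto simp: frobenius_lift_def intro!: frobenius_lift_ring.intro frobenius_lift_ring_axioms.intro)
  interpret T: derham_frobenius_target S p \<phi> A FA F
    by (intro derham_frobenius_target.intro derham_frobenius_target_axioms.intro dF
        S.frobenius_lift_ring_axioms assms(4))
  interpret L: frobenius_lifting S "deg0_ring A" p \<phi> "FA 0" "A.V 0"
    by (intro frobenius_lifting.intro S.frobenius_lift_ring_axioms A.deg0_verschiebung_ring)
  let ?PS = "multiples p (add_monoid S)" and ?PA = "multiples p (Gr A 0)"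
  have vfil1: "L.vfil 1 = A.V 0 ` carrier (Gr A 0)" by (simp add: L.vfil_def)
  interpret PS: ideal ?PS S by (rule S.multiples_ideal)
  have PA: "ideal ?PA (deg0_ring A)" using cring.multiples_ideal[OF A.deg0_cring, of p] by simp

  \<comment> \<open>q is the reduction from S to R: a surjective homomorphism whose fibres are the
    cosets of pS.\<close>
  define q where "q y = \<theta> (?PS +>\<^bsub>S\<^esub> y)" for y
  have \<theta>: "\<theta> \<in> ring_hom (S Quot ?PS) R" "bij_betw \<theta> (carrier (S Quot ?PS)) (carrier R)"
    using lift by (auto simp: frobenius_lift_def ring_iso_def)
  have q_hom: "q \<in> ring_hom S R"
    using ring_hom_trans[OF PS.rcos_ring_hom \<theta>(1)] by (simp add: q_def[abs_def] o_def)
  have q_surj: "\<exists>y\<in>carrier S. q y = x" if "x \<in> carrier R" for x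
  proof -
    have "x \<in> \<theta> ` (\<lambda>y. ?PS +>\<^bsub>S\<^esub> y) ` carrier S"
      using bij_betw_imp_surj_on[OF \<theta>(2)] that by (simp only: carrier_FactRing)
    then show ?thesis by (auto simp only: q_def)
  qed
  have q_inj: "y \<ominus>\<^bsub>S\<^esub> y' \<in> ?PS" if "y \<in> carrier S" "y' \<in> carrier S" "q y = q y'" for y y'
  proof (rule S.quotient_eq_iff_same_a_r_cos[OF S.multiples_ideal that(1,2), THEN iffD2])
    show "?PS +>\<^bsub>S\<^esub> y = ?PS +>\<^bsub>S\<^esub> y'"
      using inj_onD[OF bij_betw_imp_inj_on[OF \<theta>(2)] that(3)[unfolded q_def]]
        ring_hom_closed[OF PS.rcos_ring_hom] that(1,2) by blast
  qed

  have fq: "f (q y) \<in> carrier (H0_mod p A)" if "y \<in> carrier S" for y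
    using ring_hom_closed[OF f ring_hom_closed[OF q_hom that]] .
  \<comment> \<open>f is pulled back along F: the preimage b is determined only modulo V and is
    chosen for each y separately, so the resulting f' is merely a map of sets.\<close>
  have "\<forall>y\<in>carrier S. \<exists>b. b \<in> carrier (Gr A 0) \<and> f (q y) = ?PA #>\<^bsub>Gr A 0\<^esub> FA 0 b"
    using A.H0_modE[OF fq] by metis
  then obtain f' where f': "\<And>y. y \<in> carrier S \<Longrightarrow> f' y \<in> carrier (Gr A 0)"
    "\<And>y. y \<in> carrier S \<Longrightarrow> f (q y) = ?PA #>\<^bsub>Gr A 0\<^esub> FA 0 (f' y)" by metis
  have "(\<lambda>y. FA 0 (f' y)) \<in> hom_mod S (deg0_ring A) ?PA"
  proof -
    have "(\<lambda>y. f (q y)) \<in> ring_hom S (deg0_ring A Quot ?PA)"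
      using ring_hom_trans[OF q_hom f] A.H0_mod_ops by (auto simp: ring_hom_def o_def)
    then have "(\<lambda>y. ?PA +>\<^bsub>deg0_ring A\<^esub> FA 0 (f' y)) \<in> ring_hom S (deg0_ring A Quot ?PA)"
      using f' by (simp add: ring_hom_def Pi_def)
    then show ?thesis using f'(1) by (simp add: hom_mod_def)
  qed
  note Ff' = L.hom_modD[OF PA S.is_cring this]
  have Vmem: "a \<in> L.vfil 1" if "a \<in> carrier (Gr A 0)" "FA 0 a \<in> ?PA" for a
    using A.F_in_multiples_iff[OF that(1)] that(2) vfil1 by simp
  \<comment> \<open>F f' represents f q and is a homomorphism modulo p; by \<open>Vmem\<close>,
    deleting F turns congruences modulo p into congruences modulo V.\<close>
  have f'_mod: "f' \<in> hom_mod S (deg0_ring A) (L.vfil 1)"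
  proof (rule L.hom_modI[OF L.vfil_ideal _ S.is_cring])
    fix x y assume x: "x \<in> carrier S" and y: "y \<in> carrier S"
    show "f' (x \<oplus>\<^bsub>S\<^esub> y) \<ominus>\<^bsub>deg0_ring A\<^esub> (f' x \<oplus>\<^bsub>deg0_ring A\<^esub> f' y) \<in> L.vfil 1"
      using Ff'(2)[OF x y] f'(1) x y by (intro Vmem) auto
    show "f' (x \<otimes>\<^bsub>S\<^esub> y) \<ominus>\<^bsub>deg0_ring A\<^esub> (f' x \<otimes>\<^bsub>deg0_ring A\<^esub> f' y) \<in> L.vfil 1"
      using Ff'(3)[OF x y] f'(1) x y A.F_mult[of "f' x" 0 "f' y" 0] A.GMult_closed[of "f' x" 0 "f' y" 0]
      by (intro Vmem) auto
  next
    show "f' \<one>\<^bsub>S\<^esub> \<ominus>\<^bsub>deg0_ring A\<^esub> \<one>\<^bsub>deg0_ring A\<^esub> \<in> L.vfil 1"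
      using Ff'(4) f'(1)[OF S.one_closed] A.GOne_closed graded_ring_homD(5)[OF A.F_ring_hom]
      by (intro Vmem) auto
  qed (use f' in simp)

  let ?D = "completed_derham p S"
  have \<iota>: "\<iota> \<in> dieudonne_hom ?D F W FW" using sat by (simp add: completed_saturation_def)
  then have \<iota>_hom: "\<iota> \<in> graded_ring_hom ?D W" by (simp add: dieudonne_hom_def)
  define on_S where "on_S g x = g 0 (\<iota> 0 (T.Dx x))" for g :: "int \<Rightarrow> 'w \<Rightarrow> 'a" and x

  have on_S: "on_S g \<in> ring_hom S (deg0_ring A)" "\<And>x. x \<in> carrier S \<Longrightarrow> FA 0 (on_S g x) = on_S g (\<phi> x)"
    if g: "g \<in> dieudonne_hom W FW A FA" for g
  proof -
    have "g \<in> graded_ring_hom W A" using g by (simp add: dieudonne_hom_def)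
    from T.Dx_hom[OF graded_ring_hom_compose[OF \<iota>_hom this]]
    show "on_S g \<in> ring_hom S (deg0_ring A)" by (simp add: on_S_def[abs_def])
    fix x assume x: "x \<in> carrier S"
    have "FA 0 (g 0 (\<iota> 0 (T.Dx x))) = g 0 (FW 0 (\<iota> 0 (T.Dx x)))"
      using g graded_ring_homD(2)[OF \<iota>_hom T.Dx_closed[OF x]] by (simp add: dieudonne_hom_def)
    also have "FW 0 (\<iota> 0 (T.Dx x)) = \<iota> 0 (F 0 (T.Dx x))"
      using \<iota> T.Dx_closed[OF x] by (simp add: dieudonne_hom_def)
    finally show "FA 0 (on_S g x) = on_S g (\<phi> x)" by (simp add: T.F_Dx[OF x] on_S_def)
  qed

  \<comment> \<open>\<rho> applies \<phi> to a lift, and \<phi> becomes the Frobenius of A after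
    mapping to A. Both sides of the condition are therefore classes of elements F a modulo p, and
    equality of such classes is a congruence modulo V.\<close>
  have condition_iff: "(\<forall>x\<in>carrier R. H0_mod_map p A g (canonical_rho p R S \<theta> \<phi> W \<iota> x) = f x) \<longleftrightarrow>
      (\<forall>y\<in>carrier S. on_S g y \<ominus>\<^bsub>deg0_ring A\<^esub> f' y \<in> L.vfil 1)"
    if g: "g \<in> dieudonne_hom W FW A FA" for g
  proof -
    have gh: "g \<in> graded_ring_hom W A" using g by (simp add: dieudonne_hom_def)
    interpret h: ring_hom_cring S "deg0_ring A" "on_S g"
      by unfold_locales (rule on_S(1)[OF g])
    have hc: "on_S g y \<in> carrier (Gr A 0)" if "y \<in> carrier S" for y using h.hom_closed[OF that] by simp
    \<comment> \<open>This is the lift chosen inside \<open>canonical_rho\<close>.\<close>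
    define r where "r x = (SOME y. y \<in> carrier S \<and> q y = x)" for x
    have r: "r x \<in> carrier S" "q (r x) = x" if "x \<in> carrier R" for x
      using someI_ex[of "\<lambda>y. y \<in> carrier S \<and> q y = x"] q_surj[OF that] unfolding r_def by blast+
    have map: "H0_mod_map p A g (canonical_rho p R S \<theta> \<phi> W \<iota> x) = ?PA #>\<^bsub>Gr A 0\<^esub> FA 0 (on_S g (r x))"
      if x: "x \<in> carrier R" for x
    proof -
      have "canonical_rho p R S \<theta> \<phi> W \<iota> x = multiples p (Gr W 0) #>\<^bsub>Gr W 0\<^esub> \<iota> 0 (T.Dx (\<phi> (r x)))"
        by (simp add: canonical_rho_def r_def q_def)
      moreover have "\<iota> 0 (T.Dx (\<phi> (r x))) \<in> carrier (Gr W 0)"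
        using graded_ring_homD(2)[OF \<iota>_hom T.Dx_closed] r(1)[OF x] by simp
      ultimately show ?thesis
        using H0_mod_map_coset[OF W.cdga_axioms A.cdga_axioms gh, of _ p] on_S(2)[OF g r(1)[OF x]]
        by (simp add: on_S_def)
    qed
    have iff: "?PA #>\<^bsub>Gr A 0\<^esub> FA 0 (on_S g y) = f (q y) \<longleftrightarrow> on_S g y \<ominus>\<^bsub>deg0_ring A\<^esub> f' y \<in> L.vfil 1"
      if y: "y \<in> carrier S" for y
    proof -
      have "?PA #>\<^bsub>Gr A 0\<^esub> FA 0 (on_S g y) = f (q y) \<longleftrightarrow>
          FA 0 (on_S g y) \<otimes>\<^bsub>Gr A 0\<^esub> inv\<^bsub>Gr A 0\<^esub> FA 0 (f' y) \<in> ?PA"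
        unfolding f'(2)[OF y] using hc[OF y] f'(1)[OF y] by (intro A.Gr.rcos_eq_iff A.Gr.multiples_subgroup) auto
      also have "\<dots> \<longleftrightarrow> FA 0 (on_S g y \<otimes>\<^bsub>Gr A 0\<^esub> inv\<^bsub>Gr A 0\<^esub> f' y) \<in> ?PA"
        using hc[OF y] f'(1)[OF y] by simp
      also have "\<dots> \<longleftrightarrow> on_S g y \<ominus>\<^bsub>deg0_ring A\<^esub> f' y \<in> L.vfil 1"
        using A.F_in_multiples_iff[of "on_S g y \<otimes>\<^bsub>Gr A 0\<^esub> inv\<^bsub>Gr A 0\<^esub> f' y"] hc[OF y] f'(1)[OF y]
        unfolding vfil1 by simp
      finally show ?thesis .
    qed
    \<comment> \<open>The condition on \<rho> speaks only of the chosen lifts, while the congruence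
      is wanted at every y in S. Two lifts of the same element differ by p z, which does not affect
      classes modulo p.\<close>
    have indep: "?PA #>\<^bsub>Gr A 0\<^esub> FA 0 (on_S g y) = ?PA #>\<^bsub>Gr A 0\<^esub> FA 0 (on_S g y')"
      if y: "y \<in> carrier S" "y' \<in> carrier S" "q y = q y'" for y y'
    proof -
      obtain z where z: "z \<in> carrier S" "y \<ominus>\<^bsub>S\<^esub> y' = [p] \<cdot>\<^bsub>S\<^esub> z"
        using q_inj[OF y] unfolding multiples_add_monoid by blast
      have "on_S g y \<otimes>\<^bsub>Gr A 0\<^esub> inv\<^bsub>Gr A 0\<^esub> on_S g y' = on_S g (y \<ominus>\<^bsub>S\<^esub> y')"
        using y h.hom_add[of y "\<ominus>\<^bsub>S\<^esub> y'"] h.hom_a_inv[of y'] by (simp add: S.minus_eq)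
      also have "\<dots> = on_S g z [^]\<^bsub>Gr A 0\<^esub> p" unfolding z(2) using h.hom_add_pow[OF z(1), of p] by simp
      finally have "FA 0 (on_S g y \<otimes>\<^bsub>Gr A 0\<^esub> inv\<^bsub>Gr A 0\<^esub> on_S g y') = FA 0 (on_S g z) [^]\<^bsub>Gr A 0\<^esub> p"
        using hc[OF z(1)] by (simp add: A.F.hom_nat_pow)
      then have "FA 0 (on_S g y) \<otimes>\<^bsub>Gr A 0\<^esub> inv\<^bsub>Gr A 0\<^esub> FA 0 (on_S g y') \<in> ?PA"
        using hc y(1,2) hc[OF z(1)] by (simp add: multiples_def)
      then show ?thesis using hc y(1,2) by (subst A.Gr.rcos_eq_iff[OF A.Gr.multiples_subgroup]) auto
    qed
    show ?thesis
    proof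
      assume *: "\<forall>x\<in>carrier R. H0_mod_map p A g (canonical_rho p R S \<theta> \<phi> W \<iota> x) = f x"
      show "\<forall>y\<in>carrier S. on_S g y \<ominus>\<^bsub>deg0_ring A\<^esub> f' y \<in> L.vfil 1"
      proof
        fix y assume y: "y \<in> carrier S"
        have qy: "q y \<in> carrier R" using ring_hom_closed[OF q_hom y] .
        have "?PA #>\<^bsub>Gr A 0\<^esub> FA 0 (on_S g y) = f (q y)"
          using indep[OF y r(1)[OF qy]] r(2)[OF qy] map[OF qy] *[rule_format, OF qy] by simp
        then show "on_S g y \<ominus>\<^bsub>deg0_ring A\<^esub> f' y \<in> L.vfil 1" using iff[OF y] by blast
      qed
    next
      assume *: "\<forall>y\<in>carrier S. on_S g y \<ominus>\<^bsub>deg0_ring A\<^esub> f' y \<in> L.vfil 1"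
      show "\<forall>x\<in>carrier R. H0_mod_map p A g (canonical_rho p R S \<theta> \<phi> W \<iota> x) = f x"
        using map iff[OF r(1)] * r by metis
    qed
  qed

  have extend: "\<exists>!g. g \<in> dieudonne_hom W FW A FA \<and> (\<forall>n. \<forall>x\<in>carrier (Gr ?D n). g n (\<iota> n x) = u n x)"
    if "u \<in> dieudonne_hom ?D F A FA" for u
    using sat assms(4) that unfolding completed_saturation_def by blast

  obtain h where h: "h \<in> ring_hom S (deg0_ring A)" "\<And>x. x \<in> carrier S \<Longrightarrow> FA 0 (h x) = h (\<phi> x)"
    and hf: "\<And>x. x \<in> carrier S \<Longrightarrow> h x \<ominus>\<^bsub>deg0_ring A\<^esub> f' x \<in> L.vfil 1"
    using L.lift_exists[OF f'_mod] by blast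
  obtain u where u: "u \<in> dieudonne_hom ?D F A FA" "\<And>x. x \<in> carrier S \<Longrightarrow> u 0 (T.Dx x) = h x"
    using T.dieudonne_hom_exists[OF h] by blast
  obtain g where g: "g \<in> dieudonne_hom W FW A FA" "\<And>n x. x \<in> carrier (Gr ?D n) \<Longrightarrow> g n (\<iota> n x) = u n x"
    using extend[OF u(1)] by blast
  have g_h: "on_S g x = h x" if "x \<in> carrier S" for x
    using g(2)[OF T.Dx_closed[OF that]] u(2)[OF that] by (simp add: on_S_def)
  show ?thesis
  proof (rule ex1I)
    show "g \<in> dieudonne_hom W FW A FA \<and>
        (\<forall>x\<in>carrier R. H0_mod_map p A g (canonical_rho p R S \<theta> \<phi> W \<iota> x) = f x)"
      using g(1) condition_iff[OF g(1)] hf g_h by simp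
    fix g' assume "g' \<in> dieudonne_hom W FW A FA \<and>
        (\<forall>x\<in>carrier R. H0_mod_map p A g' (canonical_rho p R S \<theta> \<phi> W \<iota> x) = f x)"
    then have g': "g' \<in> dieudonne_hom W FW A FA"
      and g'f: "\<And>x. x \<in> carrier S \<Longrightarrow> on_S g' x \<ominus>\<^bsub>deg0_ring A\<^esub> f' x \<in> L.vfil 1"
      using condition_iff by blast+
    \<comment> \<open>Both homomorphisms agree with f' modulo V, hence with each other, and the lift
      compatible with Frobenius is unique.\<close>
    have g'_h: "on_S g' x = h x" if x: "x \<in> carrier S" for x
    proof (rule L.lift_unique[OF on_S[OF g'] h _ x])
      fix x assume x: "x \<in> carrier S"
      have c: "on_S g' x \<in> carrier (deg0_ring A)" "f' x \<in> carrier (deg0_ring A)" "h x \<in> carrier (deg0_ring A)"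
        using ring_hom_closed[OF on_S(1)[OF g'] x] f'(1)[OF x] ring_hom_closed[OF h(1) x] by simp_all
      show "on_S g' x \<ominus>\<^bsub>deg0_ring A\<^esub> h x \<in> L.vfil 1"
        by (rule L.vfil_trans[OF g'f[OF x] L.vfil_sym[OF hf[OF x] c(3,2)] c])
    qed
    \<comment> \<open>The composite of g' with \<iota> has to be restricted to the carriers to be
      comparable with u. The two agree on S, hence everywhere, and g' and g then factor the same
      morphism through \<iota>.\<close>
    let ?u' = "\<lambda>n. restrict (\<lambda>x. g' n (\<iota> n x)) (carrier (Gr ?D n))"
    have u': "?u' \<in> dieudonne_hom ?D F A FA"
      using graded_ring_homD(2)[OF T.F_hom] T.Diff_PC_closed T.GMult_PC_closed T.Gr.C_mult_closed
        T.tc_closed[OF T.GOne_closed]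
      by (intro dieudonne_hom_compose[OF \<iota> g']) (auto simp: T.Gr_PC T.GOne_PC)
    have uu: "?u' = u"
      using T.dieudonne_hom_ext[OF u' u(1)] u(2) g'_h T.Dx_closed by (simp add: on_S_def)
    have "g' n (\<iota> n x) = u n x" if "x \<in> carrier (Gr ?D n)" for n x
      using fun_cong[OF fun_cong[OF uu, of n], of x] that by simp
    then show "g' = g" using extend[OF u(1)] g g' by blast
  qed
qed

end
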